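(* Assume that the thickness function $d:\partial C\to\mathbb{R}_+$ is a Morse function. Then the fixed points of the return map $F:\partial C\to\partial C$ satisfy $$\sum_{c^{*}\in\operatorname{Fix}(F)}(-1)^{\operatorname{ind}(c^{*})}=\chi(\partial C),$$ where $\operatorname{ind}(c^* )$ is the Morse index of $d$ at $c^*$ and $\chi(\partial C)=\sum_{k=0}^{N-1}(-1)^k b_k(\partial C)$ is the Euler characteristic of $\partial C$.
   Context: Setting. $C\subset\mathbb{R}^N$ is a compact convex set with nonempty interior whose boundary $\partial C$ is a compact manifold of class $C^2$, with outward unit normal $\nu$. $\Omega\subset\mathbb{R}^N$ is a bounded domain containing $C$ and belonging to the class $\mathcal{O}_C$: for almost every $x\in\partial\Omega$ where the inward unit normal $n(x)$ to $\partial\Omega$ exists, the half-line $D(x,n(x))=\{x+tn(x):t\ge 0\}$ intersects $C$. Thickness function: $d:\partial C\to\mathbb{R}_+$, $d(c)=\sup\{r\ge 0: c+r\nu(c)\in\Omega\}$, assumed of class $C^2$. Radial map: $\Phi(c)=c+d(c)\nu(c)$, which parametrizes $\partial\Omega\setminus C$ by $\partial C$. Reciprocal map $\pi$: for $x\in\partial\Omega$, $\pi(x)\in\partial C$ is the point of $\partial C$ reached when one moves from $x$ along the half-line $D(x,n(x))$ back to $\partial C$ (its first point in $C$). Return map: $F=\pi\circ\Phi:\partial C\to\partial C$, and $\operatorname{Fix}(F)$ is its set of fixed points. A function on $\partial C$ is Morse if all its critical points are nondegenerate, i.e. the Hessian at each critical point is non-singular. The Morse index $\operatorname{ind}(c^*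 )$ is the number of negative eigenvalues of the intrinsic Hessian $\operatorname{Hess}_{\partial C}(d)(c^* )$ of $d$ at $c^*$ (fixed points of $F$ coincide with critical points of $d$). $b_k(\partial C)$ is the rank of $H_k(\partial C)$. *)

theory Defs
  imports "HOL-Analysis.Analysis" "HOL-Homology.Homology"
begin

definition C2_map_on :: "'a::euclidean_space set \<Rightarrow> ('a \<Rightarrow> 'b::euclidean_space) \<Rightarrow> bool" where
  "C2_map_on U f \<longleftrightarrow>
     (\<exists>(f' :: 'a \<Rightarrow> ('a \<Rightarrow>\<^sub>L 'b)) (f'' :: 'a \<Rightarrow> ('a \<Rightarrow>\<^sub>L ('a \<Rightarrow>\<^sub>L 'b))).
        (\<forall>x\<in>U. (f has_derivative blinfun_apply (f' x)) (at x) \<and>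
               (f' has_derivative blinfun_apply (f'' x)) (at x)) \<and>
        continuous_on U f'')"

text \<open>An embedded submanifold of class C2 and codimension one: near each of its points, a
  C2 diffeomorphism between open sets of the ambient space straightens M to a hyperplane.\<close>

definition C2_hypersurface :: "'a::euclidean_space set \<Rightarrow> bool" where
  "C2_hypersurface M \<longleftrightarrow>
     (\<forall>p\<in>M. \<exists>U V \<psi> \<psi>i. \<exists>e::'a.
        open U \<and> p \<in> U \<and> open V \<and> homeomorphism U V \<psi> \<psi>i \<and>
        C2_map_on U \<psi> \<and> C2_map_on V \<psi>i \<and>
        e \<noteq> 0 \<and> \<psi> ` (M \<inter> U) = V \<inter> {y. e \<bullet> y = 0})"

definition C2_function_on :: "'a::euclidean_space set \<Rightarrow> ('a \<Rightarrow> real) \<Rightarrow> bool" where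
  "C2_function_on M f \<longleftrightarrow>
     (\<forall>p\<in>M. \<exists>U g. open U \<and> p \<in> U \<and> C2_map_on U g \<and> (\<forall>x\<in>M \<inter> U. g x = f x))"

definition tangent_space :: "'a::euclidean_space set \<Rightarrow> 'a \<Rightarrow> 'a set" where
  "tangent_space M x =
     {v. \<exists>\<gamma> e. 0 < (e::real) \<and> \<gamma> ` {-e<..<e} \<subseteq> M \<and> \<gamma> 0 = x \<and>
           \<gamma> C1_differentiable_on {-e<..<e} \<and> (\<gamma> has_vector_derivative v) (at 0)}"

text \<open>Differentiation along M is differentiation within M at a point. The derivative
  within M is determined only on tangent vectors, so the gradient is normalised by tangency and
  the Hessian is used on tangent vectors only.\<close>

definition surface_gradient :: "'a::euclidean_space set \<Rightarrow> ('a \<Rightarrow> real) \<Rightarrow> 'a \<Rightarrow> 'a" where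
  "surface_gradient M f x =
     (THE g. g \<in> tangent_space M x \<and> (f has_derivative (\<lambda>h. g \<bullet> h)) (at x within M))"

definition critical_point :: "'a::euclidean_space set \<Rightarrow> ('a \<Rightarrow> real) \<Rightarrow> 'a \<Rightarrow> bool" where
  "critical_point M f x \<longleftrightarrow> x \<in> M \<and> surface_gradient M f x = 0"

text \<open>The intrinsic Hessian, as the endomorphism sending v to the covariant derivative of the
  gradient in direction v. The Levi-Civita connection of the induced metric is the ambient
  derivative followed by orthogonal projection to the tangent space; projection to a linear
  subspace is \<^const>\<open>closest_point\<close>.\<close>

definition surface_hessian ::
    "'a::euclidean_space set \<Rightarrow> ('a \<Rightarrow> real) \<Rightarrow> 'a \<Rightarrow> 'a \<Rightarrow> 'a" where
  "surface_hessian M f x v =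
     closest_point (tangent_space M x)
       (frechet_derivative (surface_gradient M f) (at x within M) v)"

definition Morse_function_on :: "'a::euclidean_space set \<Rightarrow> ('a \<Rightarrow> real) \<Rightarrow> bool" where
  "Morse_function_on M f \<longleftrightarrow>
     (\<forall>x. critical_point M f x \<longrightarrow>
        bij_betw (surface_hessian M f x) (tangent_space M x) (tangent_space M x))"

text \<open>Negative eigenvalues counted with multiplicity; the Hessian is self-adjoint, so this is
  the dimension of the eigenspace.\<close>

definition hessian_eigenspace ::
    "'a::euclidean_space set \<Rightarrow> ('a \<Rightarrow> real) \<Rightarrow> 'a \<Rightarrow> real \<Rightarrow> 'a set" where
  "hessian_eigenspace M f x l = {v \<in> tangent_space M x. surface_hessian M f x v = l *\<^sub>R v}"

definition Morse_index :: "'a::euclidean_space set \<Rightarrow> ('a \<Rightarrow> real) \<Rightarrow> 'a \<Rightarrow> nat" where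
  "Morse_index M f x =
     (\<Sum>l | l < 0 \<and> (\<exists>v\<in>hessian_eigenspace M f x l. v \<noteq> 0). dim (hessian_eigenspace M f x l))"

text \<open>The s-dimensional Hausdorff outer measure, without normalising constant.
  The case distinction makes the empty set contribute 0 also for s = 0,
  where it is the counting measure.\<close>

definition hausdorff_premeasure :: "nat \<Rightarrow> real \<Rightarrow> 'a::metric_space set \<Rightarrow> ennreal" where
  "hausdorff_premeasure s \<delta> A =
     (INF U \<in> {U :: nat \<Rightarrow> 'a set. A \<subseteq> (\<Union>i. U i) \<and> (\<forall>i. bounded (U i) \<and> diameter (U i) \<le> \<delta>)}.
        suminf (\<lambda>i. if U i = {} then 0 else ennreal (diameter (U i) ^ s)))"

definition hausdorff_outer_measure :: "nat \<Rightarrow> 'a::metric_space set \<Rightarrow> ennreal" where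
  "hausdorff_outer_measure s A = (SUP \<delta> \<in> {0<..}. hausdorff_premeasure s \<delta> A)"

text \<open>n is the inward unit normal to S at the boundary point x: S has a tangent hyperplane at x
  orthogonal to n and lies on the side of n, in the sense that every open cone around n with apex x
  and aperture below a half-space is locally inside S, and the opposite one locally outside. For a
  Lipschitz domain these are the points where the graph representing the boundary is differentiable.
  There is at most one such n.\<close>

definition is_inward_normal :: "'a::euclidean_space set \<Rightarrow> 'a \<Rightarrow> 'a \<Rightarrow> bool" where
  "is_inward_normal S x n \<longleftrightarrow> norm n = 1 \<and>
     (\<forall>\<epsilon>>0. \<forall>\<^sub>F y in at x.
        (n \<bullet> (y - x) > \<epsilon> * norm (y - x) \<longrightarrow> y \<in> S) \<and>
        (n \<bullet> (y - x) < - \<epsilon> * norm (y - x) \<longrightarrow> y \<notin> S))"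

definition inward_normal :: "'a::euclidean_space set \<Rightarrow> 'a \<Rightarrow> 'a" where
  "inward_normal S x = (THE n. is_inward_normal S x n)"

definition outward_normal :: "'a::euclidean_space set \<Rightarrow> 'a \<Rightarrow> 'a" where
  "outward_normal S x = - inward_normal S x"

definition half_line :: "'a::euclidean_space \<Rightarrow> 'a \<Rightarrow> 'a set" where
  "half_line x n = {x + t *\<^sub>R n | t::real. 0 \<le> t}"

text \<open>The exceptional set is null for the (N-1)-dimensional surface measure.\<close>

definition class_O :: "'a::euclidean_space set \<Rightarrow> 'a set \<Rightarrow> bool" where
  "class_O C \<Omega> \<longleftrightarrow>
     hausdorff_outer_measure (DIM('a) - 1)
       {x \<in> frontier \<Omega>. \<exists>n. is_inward_normal \<Omega> x n \<and> half_line x n \<inter> C = {}} = 0"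

definition thickness :: "'a::euclidean_space set \<Rightarrow> 'a set \<Rightarrow> 'a \<Rightarrow> real" where
  "thickness C \<Omega> c = Sup {r. 0 \<le> r \<and> c + r *\<^sub>R outward_normal C c \<in> \<Omega>}"

definition radial_map :: "'a::euclidean_space set \<Rightarrow> 'a set \<Rightarrow> 'a \<Rightarrow> 'a" where
  "radial_map C \<Omega> c = c + thickness C \<Omega> c *\<^sub>R outward_normal C c"

text \<open>The first point of C on the half-line from x in the direction of the inward normal.\<close>

definition reciprocal_map :: "'a::euclidean_space set \<Rightarrow> 'a set \<Rightarrow> 'a \<Rightarrow> 'a" where
  "reciprocal_map C \<Omega> x =
     x + Inf {t. 0 \<le> t \<and> x + t *\<^sub>R inward_normal \<Omega> x \<in> C} *\<^sub>R inward_normal \<Omega> x"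

definition return_map :: "'a::euclidean_space set \<Rightarrow> 'a set \<Rightarrow> 'a \<Rightarrow> 'a" where
  "return_map C \<Omega> = reciprocal_map C \<Omega> \<circ> radial_map C \<Omega>"

definition Fix_on :: "'a set \<Rightarrow> ('a \<Rightarrow> 'a) \<Rightarrow> 'a set" where
  "Fix_on M F = {c \<in> M. F c = c}"

text \<open>The rank of an abelian group, written multiplicatively: the largest number of
  elements that are linearly independent over the integers. Meaningful for groups of finite rank, such
  as the homology groups of a compact manifold.\<close>

definition int_independent :: "('a, 'b) monoid_scheme \<Rightarrow> 'a set \<Rightarrow> bool" where
  "int_independent G B \<longleftrightarrow> finite B \<and> B \<subseteq> carrier G \<and>
     (\<forall>m :: 'a \<Rightarrow> int. finprod G (\<lambda>b. b [^]\<^bsub>G\<^esub> m b) B = \<one>\<^bsub>G\<^esub> \<longrightarrow> (\<forall>b\<in>B. m b = 0))"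

definition abelian_rank :: "('a, 'b) monoid_scheme \<Rightarrow> nat" where
  "abelian_rank G = Sup {card B | B. int_independent G B}"

definition betti_number :: "nat \<Rightarrow> 'a topology \<Rightarrow> nat" where
  "betti_number k X = abelian_rank (homology_group (int k) X)"

end

theory Submission
  imports Defs
begin

text \<open>Fixed points of the return map are the critical points of the thickness \<open>d\<close>: the domain is the
  sublevel set of \<open>dist(y, C) - d(proj y)\<close>, whose gradient at \<open>\<Phi> c\<close> is \<open>\<nu> c\<close> if and only if
  \<open>grad d\<close> vanishes at \<open>c\<close>.

  For the Morse sum, place the origin inside \<open>C\<close> and extend \<open>grad d\<close> radially to a vector field on the
  whole space that equals \<open>-y\<close> near the origin, points away from \<open>\<partial>C\<close> on both sides, and equals \<open>y\<close>
  near infinity. It vanishes at 0, with index \<open>(-1)\<close> to the power \<open>N\<close>, and at the critical points, where its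
  derivative is the Hessian of \<open>d\<close> together with a positive radial eigenvalue. The total index is 1.

  The latter is the degree of a map \<open>V = id + W\<close> with \<open>W\<close> of compact support, and is obtained without
  approximation by smooth maps, as in the Milnor--Rogers proof of Brouwer's theorem: for a polynomial \<open>p\<close>,
  the integral of \<open>det(id + s DW) p(id + s W)\<close> over a large box is a polynomial in \<open>s\<close>, and it is constant for
  small \<open>s\<close> by change of variables; hence it has the same value at \<open>s = 1\<close>. Weierstrass approximation
  then allows a bump function at 0 in place of \<open>p\<close>.\<close>

section \<open>Continuously differentiable maps\<close>

text \<open>Both sides of the formula are computed and compared; no homology of sublevel sets
  occurs. Since \<open>frontier C\<close> is homeomorphic to a sphere, the Betti numbers give 1 +
  (-1)^(N-1), and the index count gives 1 - (-1)^N. What shapes the analysis is regularity: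
  \<open>d\<close> is C2, so its gradient field is only C1, and so is the unit normal. Zeros must
  therefore be counted by an argument that uses one continuous derivative, and the gradient must be
  moved off \<open>frontier C\<close> by a C1 retraction. The Minkowski functional about an interior
  point supplies it: as a supremum of linear functionals it has a gradient that is read off from the
  supporting normals. Convexity is used again for the return map, where monotonicity of the normal
  makes the nearest-point projection differentiable at every point outside \<open>C\<close>. The
  passage from the sign of a determinant to the Morse index rests on self-adjointness of the
  Hessian, which is derived from symmetry of second derivatives of ambient functions.\<close>

text \<open>Continuity of the derivative is required direction by direction; in finite dimension this is
  continuity in operator norm.\<close>

definition C1_map_on :: "'a::euclidean_space set \<Rightarrow> ('a \<Rightarrow> 'b::real_normed_vector) \<Rightarrow> bool" where
  "C1_map_on U f \<longleftrightarrow>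
     (\<exists>f'. (\<forall>x\<in>U. (f has_derivative f' x) (at x)) \<and> (\<forall>v. continuous_on U (\<lambda>x. f' x v)))"

lemma C1_map_onI:
  assumes "\<And>x. x \<in> U \<Longrightarrow> (f has_derivative f' x) (at x)" "\<And>v. continuous_on U (\<lambda>x. f' x v)"
  shows "C1_map_on U f"
  using assms unfolding C1_map_on_def by blast

lemma C1_map_onE:
  assumes "C1_map_on U f"
  obtains f' where "\<And>x. x \<in> U \<Longrightarrow> (f has_derivative f' x) (at x)" "\<And>v. continuous_on U (\<lambda>x. f' x v)"
  using assms unfolding C1_map_on_def by blast

lemma C1_map_on_subset: "C1_map_on U f \<Longrightarrow> W \<subseteq> U \<Longrightarrow> C1_map_on W f"
  by (elim C1_map_onE, rule C1_map_onI) (auto intro: continuous_on_subset)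

lemma C1_map_on_continuous:
  assumes "C1_map_on U f"
  shows "continuous_on U f"
proof -
  obtain f' where f: "\<And>x. x \<in> U \<Longrightarrow> (f has_derivative f' x) (at x)"
    using assms by (elim C1_map_onE) (rule that)
  show ?thesis
    by (rule has_derivative_continuous_on[of _ _ f']) (rule has_derivative_at_withinI[OF f])
qed

lemma C1_map_on_const [intro]: "C1_map_on U (\<lambda>x. c)"
  by (rule C1_map_onI[of _ _ "\<lambda>x v. 0"]) auto

lemma C1_map_on_ident [intro]: "C1_map_on U (\<lambda>x. x)"
  by (rule C1_map_onI[of _ _ "\<lambda>x v. v"]) auto

lemma C1_map_on_add [intro]:
  assumes "C1_map_on U f" "C1_map_on U g"
  shows "C1_map_on U (\<lambda>x. f x + g x)"
proof -
  obtain f' g' where "\<And>x. x \<in> U \<Longrightarrow> (f has_derivative f' x) (at x)" "\<And>v. continuous_on U (\<lambda>x. f' x v)"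
    "\<And>x. x \<in> U \<Longrightarrow> (g has_derivative g' x) (at x)" "\<And>v. continuous_on U (\<lambda>x. g' x v)"
    using assms by (elim C1_map_onE) (rule that)
  then show ?thesis
    by (intro C1_map_onI[of _ _ "\<lambda>x v. f' x v + g' x v"] has_derivative_add continuous_on_add)
qed

lemma C1_map_on_bounded_linear:
  assumes "bounded_linear L" "C1_map_on U f"
  shows "C1_map_on U (\<lambda>x. L (f x))"
proof -
  obtain f' where f: "\<And>x. x \<in> U \<Longrightarrow> (f has_derivative f' x) (at x)" "\<And>v. continuous_on U (\<lambda>x. f' x v)"
    using assms(2) by (elim C1_map_onE) (rule that)
  show ?thesis
  proof (rule C1_map_onI[of _ _ "\<lambda>x v. L (f' x v)"])
    show "continuous_on U (\<lambda>x. L (f' x v))" for v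
      by (rule bounded_linear.continuous_on[OF assms(1) f(2)])
  qed (rule bounded_linear.has_derivative[OF assms(1) f(1)])
qed

lemma C1_map_on_minus [intro]: "C1_map_on U f \<Longrightarrow> C1_map_on U (\<lambda>x. - f x)"
  by (rule C1_map_on_bounded_linear[OF bounded_linear_minus[OF bounded_linear_ident]])

lemma C1_map_on_diff [intro]:
  assumes "C1_map_on U f" "C1_map_on U g"
  shows "C1_map_on U (\<lambda>x. f x - g x)"
  using C1_map_on_add[OF assms(1) C1_map_on_minus[OF assms(2)]] by simp

lemma C1_map_on_bilinear:
  assumes B: "bounded_bilinear B" and "C1_map_on U f" "C1_map_on U g"
  shows "C1_map_on U (\<lambda>x. B (f x) (g x))"
proof -
  obtain f' where f: "\<And>x. x \<in> U \<Longrightarrow> (f has_derivative f' x) (at x)" "\<And>v. continuous_on U (\<lambda>x. f' x v)"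
    using assms(2) by (elim C1_map_onE) (rule that)
  obtain g' where g: "\<And>x. x \<in> U \<Longrightarrow> (g has_derivative g' x) (at x)" "\<And>v. continuous_on U (\<lambda>x. g' x v)"
    using assms(3) by (elim C1_map_onE) (rule that)
  show ?thesis
  proof (rule C1_map_onI[of _ _ "\<lambda>x v. B (f x) (g' x v) + B (f' x v) (g x)"])
    show "continuous_on U (\<lambda>x. B (f x) (g' x v) + B (f' x v) (g x))" for v
      by (intro continuous_on_add bounded_bilinear.continuous_on[OF B] f(2) g(2)
          C1_map_on_continuous[OF assms(2)] C1_map_on_continuous[OF assms(3)])
  qed (intro bounded_bilinear.FDERIV[OF B] f(1) g(1))
qed

lemmas C1_map_on_scaleR [intro] = C1_map_on_bilinear[OF bounded_bilinear_scaleR]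
lemmas C1_map_on_inner [intro] = C1_map_on_bilinear[OF bounded_bilinear_inner]
lemmas C1_map_on_mult [intro] = C1_map_on_bilinear[OF bounded_bilinear_mult]

lemma C1_map_on_compose:
  fixes f :: "'a::euclidean_space \<Rightarrow> 'b::euclidean_space" and g :: "'b \<Rightarrow> 'c::real_normed_vector"
  assumes "C1_map_on U f" "C1_map_on W g" "\<And>x. x \<in> U \<Longrightarrow> f x \<in> W"
  shows "C1_map_on U (\<lambda>x. g (f x))"
proof -
  obtain f' where f: "\<And>x. x \<in> U \<Longrightarrow> (f has_derivative f' x) (at x)" "\<And>v. continuous_on U (\<lambda>x. f' x v)"
    using assms(1) by (elim C1_map_onE) (rule that)
  obtain g' where g: "\<And>x. x \<in> W \<Longrightarrow> (g has_derivative g' x) (at x)" "\<And>v. continuous_on W (\<lambda>x. g' x v)"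
    using assms(2) by (elim C1_map_onE) (rule that)
  show ?thesis
  proof (rule C1_map_onI[of _ _ "\<lambda>x v. g' (f x) (f' x v)"])
    fix x assume "x \<in> U"
    then show "((\<lambda>x. g (f x)) has_derivative (\<lambda>v. g' (f x) (f' x v))) (at x)"
      by (intro has_derivative_compose[OF f(1) g(1)] assms(3))
  next
    fix v
    \<comment> \<open>Both the map \<open>g' (f x)\<close> and its argument vary with
      \<open>x\<close>, while \<open>g'\<close> is known to be continuous for fixed directions;
      expanding the argument in the basis separates the two.\<close>
    have cont: "continuous_on U (\<lambda>x. \<Sum>b\<in>Basis. (f' x v \<bullet> b) *\<^sub>R g' (f x) b)"
      by (intro continuous_intros f(2) continuous_on_compose2[OF g(2) C1_map_on_continuous[OF assms(1)]])
        (use assms(3) in auto)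
    have eq: "g' (f x) (f' x v) = (\<Sum>b\<in>Basis. (f' x v \<bullet> b) *\<^sub>R g' (f x) b)" if "x \<in> U" for x
    proof -
      have lin: "linear (g' (f x))"
        using g(1)[OF assms(3)[OF that]] has_derivative_linear by blast
      have "g' (f x) (f' x v) = g' (f x) (\<Sum>b\<in>Basis. (f' x v \<bullet> b) *\<^sub>R b)"
        by (simp only: euclidean_representation)
      then show ?thesis
        by (simp only: linear_sum[OF lin] linear_cmul[OF lin])
    qed
    show "continuous_on U (\<lambda>x. g' (f x) (f' x v))"
      by (rule continuous_on_eq[OF cont]) (rule eq[symmetric])
  qed
qed

lemma C1_map_on_real:
  fixes \<phi> :: "real \<Rightarrow> real"
  assumes "\<And>t. t \<in> W \<Longrightarrow> (\<phi> has_real_derivative \<phi>' t) (at t)" "continuous_on W \<phi>'"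
  shows "C1_map_on W \<phi>"
  by (rule C1_map_onI[of _ _ "\<lambda>t v. \<phi>' t * v"])
    (use assms in \<open>auto simp: has_field_derivative_def intro!: continuous_intros\<close>)

lemma C1_map_on_inverse [intro]:
  fixes f :: "'a::euclidean_space \<Rightarrow> real"
  assumes "C1_map_on U f" "\<And>x. x \<in> U \<Longrightarrow> f x \<noteq> 0"
  shows "C1_map_on U (\<lambda>x. inverse (f x))"
proof (rule C1_map_on_compose[OF assms(1)])
  show "C1_map_on (- {0}) (inverse :: real \<Rightarrow> real)"
  proof (rule C1_map_on_real)
    show "(inverse has_real_derivative - (inverse t ^ Suc (Suc 0))) (at t)" if "t \<in> - {0}" for t :: real
      using that by (intro DERIV_inverse) simp
  qed (auto intro!: continuous_intros)
qed (use assms(2) in auto)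

lemma C1_map_on_norm [intro]:
  fixes f :: "'a::euclidean_space \<Rightarrow> 'b::euclidean_space"
  assumes "C1_map_on U f" "\<And>x. x \<in> U \<Longrightarrow> f x \<noteq> 0"
  shows "C1_map_on U (\<lambda>x. norm (f x))"
proof -
  have "C1_map_on {0<..} sqrt"
    by (rule C1_map_on_real[of _ _ "\<lambda>t. inverse (sqrt t) / 2"])
      (auto intro!: DERIV_real_sqrt continuous_intros)
  then have "C1_map_on U (\<lambda>x. sqrt (f x \<bullet> f x))"
    by (rule C1_map_on_compose[OF C1_map_on_inner[OF assms(1) assms(1)]]) (use assms(2) in auto)
  then show ?thesis
    by (simp add: norm_eq_sqrt_inner)
qed

lemma C1_map_on_cong:
  assumes "C1_map_on U f" "open U" "\<And>x. x \<in> U \<Longrightarrow> f x = g x"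
  shows "C1_map_on U g"
proof -
  obtain f' where f: "\<And>x. x \<in> U \<Longrightarrow> (f has_derivative f' x) (at x)" "\<And>v. continuous_on U (\<lambda>x. f' x v)"
    using assms(1) by (elim C1_map_onE) (rule that)
  show ?thesis
  proof (rule C1_map_onI[of _ _ f'])
    show "(g has_derivative f' x) (at x)" if "x \<in> U" for x
      by (rule has_derivative_transform_within_open[OF f(1)[OF that] assms(2) that]) (rule assms(3))
  qed (rule f(2))
qed

text \<open>The witness is \<open>frechet_derivative\<close>, which \<open>f\<close> determines, so
  the local derivatives need no gluing.\<close>

lemma C1_map_on_local:
  assumes "\<And>x. x \<in> S \<Longrightarrow> \<exists>U. open U \<and> x \<in> U \<and> C1_map_on U f"
  shows "C1_map_on S f"
proof (rule C1_map_onI[of _ _ "\<lambda>x. frechet_derivative f (at x)"])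
  fix x assume "x \<in> S"
  then obtain U where U: "open U" "x \<in> U" "C1_map_on U f"
    using assms by blast
  then show "(f has_derivative frechet_derivative f (at x)) (at x)"
    by (elim C1_map_onE) (auto simp: frechet_derivative_works[symmetric] differentiable_def)
next
  fix v
  have "continuous (at x within S) (\<lambda>x. frechet_derivative f (at x) v)" if "x \<in> S" for x
  proof -
    obtain U where U: "open U" "x \<in> U" "C1_map_on U f"
      using assms \<open>x \<in> S\<close> by blast
    then obtain f' where f: "\<And>x. x \<in> U \<Longrightarrow> (f has_derivative f' x) (at x)" "\<And>v. continuous_on U (\<lambda>x. f' x v)"
      by (elim C1_map_onE) (rule that)
    have "continuous_on U (\<lambda>x. frechet_derivative f (at x) v)"
      by (rule continuous_on_eq[OF f(2)[of v]]) (simp only: frechet_derivative_at[OF f(1)])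
    then have "continuous (at x) (\<lambda>x. frechet_derivative f (at x) v)"
      using U(1,2) by (simp add: continuous_on_eq_continuous_at)
    then show ?thesis
      by (rule continuous_at_imp_continuous_within)
  qed
  then show "continuous_on S (\<lambda>x. frechet_derivative f (at x) v)"
    by (simp add: continuous_on_eq_continuous_within)
qed

lemma C1_map_on_blinfun:
  fixes f :: "'a::euclidean_space \<Rightarrow> 'b::euclidean_space"
  assumes "C1_map_on U f"
  obtains f' where "\<And>x. x \<in> U \<Longrightarrow> (f has_derivative blinfun_apply (f' x)) (at x)" "continuous_on U f'"
proof -
  obtain f' where f: "\<And>x. x \<in> U \<Longrightarrow> (f has_derivative f' x) (at x)" "\<And>v. continuous_on U (\<lambda>x. f' x v)"
    using assms by (elim C1_map_onE) (rule that)
  have ap: "blinfun_apply (Blinfun (f' x)) = f' x" if "x \<in> U" for x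
    using has_derivative_bounded_linear[OF f(1)[OF that]] by (rule bounded_linear_Blinfun_apply)
  show thesis
  proof (rule that[of "\<lambda>x. Blinfun (f' x)"])
    show "continuous_on U (\<lambda>x. Blinfun (f' x))"
      by (rule continuous_on_blinfun_componentwise) (rule continuous_on_eq[OF f(2)], simp only: ap)
  qed (use ap f(1) in simp)
qed

section \<open>Symmetry of second derivatives\<close>

text \<open>The second difference over the parallelogram spanned by t v and t w is the increment
  over [0, t] of a function of one variable. The mean value theorem turns it into a difference of
  two values of the gradient, and differentiability of \<open>g\<close> at the single point
  \<open>x\<close> evaluates that difference up to o(t).\<close>

lemma mixed_difference:
  fixes \<gamma> :: "'a::real_inner \<Rightarrow> real"
  assumes U: "open U" "x \<in> U" and der: "\<And>y. y \<in> U \<Longrightarrow> (\<gamma> has_derivative (\<lambda>h. g y \<bullet> h)) (at y)"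
    and H: "(g has_derivative H) (at x)" and \<epsilon>: "0 < \<epsilon>"
  shows "\<forall>\<^sub>F t in at_right 0.
    \<bar>\<gamma> (x + t *\<^sub>R v + t *\<^sub>R w) - \<gamma> (x + t *\<^sub>R v) - \<gamma> (x + t *\<^sub>R w) + \<gamma> x - t\<^sup>2 * (H w \<bullet> v)\<bar>
      \<le> \<epsilon> * t\<^sup>2 * (2 * (norm v + norm w) * norm v)"
proof -
  obtain r where r: "0 < r" "ball x r \<subseteq> U"
    using U open_contains_ball by blast
  obtain d where d: "0 < d" "\<And>y. norm (y - x) < d \<Longrightarrow> norm (g y - g x - H (y - x)) \<le> \<epsilon> * norm (y - x)"
    using H \<epsilon> unfolding has_derivative_at_alt by blast
  interpret H: bounded_linear H
    using H by (rule has_derivative_bounded_linear)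
  \<comment> \<open>This bound keeps the parallelogram inside the ball of radius \<open>r\<close> in
    \<open>U\<close> and within the range \<open>d\<close> of the linear approximation of
    \<open>g\<close>; the added 1 avoids division by zero.\<close>
  define k where "k = min r d / (norm v + norm w + 1)"
  have "0 < k"
    using r d by (simp add: k_def add_nonneg_pos)
  have "\<bar>\<gamma> (x + t *\<^sub>R v + t *\<^sub>R w) - \<gamma> (x + t *\<^sub>R v) - \<gamma> (x + t *\<^sub>R w) + \<gamma> x - t\<^sup>2 * (H w \<bullet> v)\<bar>
      \<le> \<epsilon> * t\<^sup>2 * (2 * (norm v + norm w) * norm v)" if t: "0 < t" "t < k" for t
  proof -
    have tk: "t * (norm v + norm w) < min r d"
    proof -
      have "t * (norm v + norm w + 1) < min r d"
        using t(2) by (simp add: k_def pos_less_divide_eq add_nonneg_pos)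
      then show ?thesis using t(1) by (simp add: algebra_simps)
    qed
    have small: "norm (s *\<^sub>R v + u *\<^sub>R w) \<le> t * (norm v + norm w)" if "0 \<le> s" "s \<le> t" "0 \<le> u" "u \<le> t" for s u
    proof -
      have "norm (s *\<^sub>R v + u *\<^sub>R w) \<le> s * norm v + u * norm w"
        using that by (metis abs_of_nonneg norm_scaleR norm_triangle_ineq)
      also have "\<dots> \<le> t * norm v + t * norm w"
        using that by (intro add_mono mult_right_mono) auto
      finally show ?thesis by (simp add: distrib_left)
    qed
    have inU: "x + (s *\<^sub>R v + u *\<^sub>R w) \<in> U" if "0 \<le> s" "s \<le> t" "0 \<le> u" "u \<le> t" for s u
    proof -
      have "dist x (x + z) = norm z" for z :: 'a
        by (simp add: dist_norm)
      then have "x + (s *\<^sub>R v + u *\<^sub>R w) \<in> ball x r"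
        unfolding mem_ball using small[OF that] tk by (metis min_less_iff_conj order_le_less_trans)
      then show ?thesis using r(2) by blast
    qed
    have approx: "norm (g (x + (s *\<^sub>R v + u *\<^sub>R w)) - g x - H (s *\<^sub>R v + u *\<^sub>R w)) \<le> \<epsilon> * (t * (norm v + norm w))"
      if "0 \<le> s" "s \<le> t" "0 \<le> u" "u \<le> t" for s u
    proof -
      have "norm (g (x + (s *\<^sub>R v + u *\<^sub>R w)) - g x - H (s *\<^sub>R v + u *\<^sub>R w)) \<le> \<epsilon> * norm (s *\<^sub>R v + u *\<^sub>R w)"
        using d(2)[of "x + (s *\<^sub>R v + u *\<^sub>R w)"] small[OF that] tk by simp
      also have "\<dots> \<le> \<epsilon> * (t * (norm v + norm w))"
        using small[OF that] \<epsilon> by simp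
      finally show ?thesis .
    qed
    define \<phi> where "\<phi> = (\<lambda>s. \<gamma> (x + (s *\<^sub>R v + t *\<^sub>R w)) - \<gamma> (x + (s *\<^sub>R v + 0 *\<^sub>R w)))"
    have der\<phi>: "(\<phi> has_derivative (\<lambda>h. g (x + (s *\<^sub>R v + t *\<^sub>R w)) \<bullet> (h *\<^sub>R v) - g (x + (s *\<^sub>R v + 0 *\<^sub>R w)) \<bullet> (h *\<^sub>R v)))
        (at s within {0..t})" if "0 \<le> s" "s \<le> t" for s
    proof -
      have "((\<lambda>s. \<gamma> (x + (s *\<^sub>R v + u *\<^sub>R w))) has_derivative (\<lambda>h. g (x + (s *\<^sub>R v + u *\<^sub>R w)) \<bullet> (h *\<^sub>R v))) (at s within {0..t})"
        if "0 \<le> u" "u \<le> t" for u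
      proof (rule has_derivative_compose[OF _ der])
        show "((\<lambda>s. x + (s *\<^sub>R v + u *\<^sub>R w)) has_derivative (\<lambda>h. h *\<^sub>R v)) (at s within {0..t})"
          by (auto intro!: derivative_eq_intros)
        show "x + (s *\<^sub>R v + u *\<^sub>R w) \<in> U"
          using inU that \<open>0 \<le> s\<close> \<open>s \<le> t\<close> by blast
      qed
      from has_derivative_diff[OF this[of t] this[of 0]] show ?thesis
        unfolding \<phi>_def using t(1) by simp
    qed
    obtain s where s: "s \<in> {0<..<t}"
      "\<phi> t - \<phi> 0 = g (x + (s *\<^sub>R v + t *\<^sub>R w)) \<bullet> ((t - 0) *\<^sub>R v) - g (x + (s *\<^sub>R v + 0 *\<^sub>R w)) \<bullet> ((t - 0) *\<^sub>R v)"
      using mvt_simple[OF t(1) der\<phi>] by blast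
    then have st: "0 \<le> s" "s \<le> t" by auto
    define p where "p = g (x + (s *\<^sub>R v + t *\<^sub>R w)) - g x - H (s *\<^sub>R v + t *\<^sub>R w)"
    define q where "q = g (x + (s *\<^sub>R v + 0 *\<^sub>R w)) - g x - H (s *\<^sub>R v + 0 *\<^sub>R w)"
    have pq: "norm p \<le> \<epsilon> * (t * (norm v + norm w))" "norm q \<le> \<epsilon> * (t * (norm v + norm w))"
      using approx[of s t] approx[of s 0] st t(1) unfolding p_def q_def by auto
    have "\<phi> t - \<phi> 0 - t\<^sup>2 * (H w \<bullet> v) = t * ((p - q) \<bullet> v)"
      unfolding s(2) p_def q_def
      by (simp add: H.add H.scaleR inner_simps algebra_simps power2_eq_square)
    also have "\<bar>\<dots>\<bar> \<le> t * ((norm p + norm q) * norm v)"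
    proof -
      have "\<bar>(p - q) \<bullet> v\<bar> \<le> norm (p - q) * norm v"
        by (rule Cauchy_Schwarz_ineq2)
      also have "\<dots> \<le> (norm p + norm q) * norm v"
        by (intro mult_right_mono norm_triangle_ineq4) simp
      finally show ?thesis using t(1) by (simp add: abs_mult)
    qed
    also have "\<dots> \<le> t * ((\<epsilon> * (t * (norm v + norm w)) + \<epsilon> * (t * (norm v + norm w))) * norm v)"
      using pq t(1) by (intro mult_left_mono mult_right_mono add_mono) auto
    finally have "\<bar>\<phi> t - \<phi> 0 - t\<^sup>2 * (H w \<bullet> v)\<bar> \<le> \<epsilon> * t\<^sup>2 * (2 * (norm v + norm w) * norm v)"
      by (simp add: power2_eq_square algebra_simps)
    then show ?thesis
      by (simp add: \<phi>_def algebra_simps)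
  qed
  then show ?thesis
    using \<open>0 < k\<close> unfolding eventually_at_right_field by blast
qed

text \<open>Exchanging \<open>v\<close> and \<open>w\<close> leaves the second difference unchanged,
  so t^2 times either inner product approximates the same number up to a multiple of \<epsilon>
  t^2.\<close>

lemma symmetric_derivative_of_gradient:
  fixes \<gamma> :: "'a::real_inner \<Rightarrow> real"
  assumes U: "open U" "x \<in> U" and der: "\<And>y. y \<in> U \<Longrightarrow> (\<gamma> has_derivative (\<lambda>h. g y \<bullet> h)) (at y)"
    and H: "(g has_derivative H) (at x)"
  shows "H v \<bullet> w = v \<bullet> H w"
proof -
  define K where "K = 2 * (norm v + norm w) * norm v + 2 * (norm w + norm v) * norm w"
  have bound: "\<bar>H w \<bullet> v - H v \<bullet> w\<bar> \<le> \<epsilon> * K" if "0 < \<epsilon>" for \<epsilon>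
  proof -
    have "\<forall>\<^sub>F t in at_right 0. 0 < (t::real)"
      by (rule eventually_at_right_less)
    moreover have "\<forall>\<^sub>F t in at_right 0.
      \<bar>\<gamma> (x + t *\<^sub>R v + t *\<^sub>R w) - \<gamma> (x + t *\<^sub>R v) - \<gamma> (x + t *\<^sub>R w) + \<gamma> x - t\<^sup>2 * (H w \<bullet> v)\<bar>
        \<le> \<epsilon> * t\<^sup>2 * (2 * (norm v + norm w) * norm v)"
      by (rule mixed_difference[OF U _ H that]) (rule der)
    moreover have "\<forall>\<^sub>F t in at_right 0.
      \<bar>\<gamma> (x + t *\<^sub>R w + t *\<^sub>R v) - \<gamma> (x + t *\<^sub>R w) - \<gamma> (x + t *\<^sub>R v) + \<gamma> x - t\<^sup>2 * (H v \<bullet> w)\<bar>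
        \<le> \<epsilon> * t\<^sup>2 * (2 * (norm w + norm v) * norm w)"
      by (rule mixed_difference[OF U _ H that]) (rule der)
    ultimately have "\<forall>\<^sub>F t in at_right (0::real). \<bar>H w \<bullet> v - H v \<bullet> w\<bar> \<le> \<epsilon> * K"
    proof eventually_elim
      case (elim t)
      have comm: "x + t *\<^sub>R w + t *\<^sub>R v = x + t *\<^sub>R v + t *\<^sub>R w"
        by (simp add: add_ac)
      have "\<bar>t\<^sup>2 * (H w \<bullet> v) - t\<^sup>2 * (H v \<bullet> w)\<bar> \<le> \<epsilon> * t\<^sup>2 * (2 * (norm v + norm w) * norm v) + \<epsilon> * t\<^sup>2 * (2 * (norm w + norm v) * norm w)"
        using elim(2,3) unfolding comm abs_le_iff by linarith
      also have "\<dots> = t\<^sup>2 * (\<epsilon> * K)"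
        by (simp add: K_def algebra_simps)
      finally have "t\<^sup>2 * \<bar>H w \<bullet> v - H v \<bullet> w\<bar> \<le> t\<^sup>2 * (\<epsilon> * K)"
        by (simp add: abs_mult flip: right_diff_distrib)
      then show ?case
        using elim(1) by simp
    qed
    then show ?thesis
      by (metis eventually_happens trivial_limit_at_right_real)
  qed
  have "0 \<le> K" by (simp add: K_def)
  have "\<bar>H w \<bullet> v - H v \<bullet> w\<bar> \<le> 0"
  proof (rule field_le_epsilon)
    fix e :: real assume "0 < e"
    have "\<bar>H w \<bullet> v - H v \<bullet> w\<bar> \<le> (e / (K + 1)) * K"
      using \<open>0 < e\<close> \<open>0 \<le> K\<close> by (intro bound) simp
    also have "\<dots> \<le> e"
      using \<open>0 < e\<close> \<open>0 \<le> K\<close> by (simp add: divide_simps)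
    finally show "\<bar>H w \<bullet> v - H v \<bullet> w\<bar> \<le> 0 + e" by simp
  qed
  then show ?thesis
    by (simp add: inner_commute)
qed

section \<open>Hypersurfaces and their normals\<close>

text \<open>\<open>g\<close> is the gradient of the scalar function e \<bullet> f, written out in
  the basis. With \<open>e\<close> the normal of a straightened hyperplane it yields a defining
  function of a hypersurface; with \<open>f\<close> real-valued and \<open>e = 1\<close> it is the
  gradient of an ambient extension.\<close>

lemma C2_map_on_gradient:
  fixes f :: "'a::euclidean_space \<Rightarrow> 'b::euclidean_space"
  assumes "C2_map_on U f"
  obtains f' g where "\<And>x. x \<in> U \<Longrightarrow> (f has_derivative f' x) (at x)" "\<And>v. continuous_on U (\<lambda>x. f' x v)"
    "\<And>x v. x \<in> U \<Longrightarrow> g x \<bullet> v = e \<bullet> f' x v" "C1_map_on U g"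
proof -
  obtain F' :: "'a \<Rightarrow> ('a \<Rightarrow>\<^sub>L 'b)" and F'' :: "'a \<Rightarrow> ('a \<Rightarrow>\<^sub>L ('a \<Rightarrow>\<^sub>L 'b))"
    where F: "\<And>x. x \<in> U \<Longrightarrow> (f has_derivative blinfun_apply (F' x)) (at x)"
      "\<And>x. x \<in> U \<Longrightarrow> (F' has_derivative blinfun_apply (F'' x)) (at x)" "continuous_on U F''"
    using assms unfolding C2_map_on_def by (elim exE conjE) (rule that, auto)
  have contF': "continuous_on U F'"
    by (rule has_derivative_continuous_on) (rule has_derivative_at_withinI, rule F(2))
  have C1: "C1_map_on U (\<lambda>x. F' x b)" for b
  proof (rule C1_map_onI[of _ _ "\<lambda>x v. F'' x v b"])
    show "((\<lambda>x. F' x b) has_derivative (\<lambda>v. F'' x v b)) (at x)" if "x \<in> U" for x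
      using bounded_linear.has_derivative[OF bounded_bilinear.bounded_linear_left[OF bounded_bilinear_blinfun_apply] F(2)[OF that]] .
  qed (intro blinfun.continuous_on F(3) continuous_on_const)
  define g where "g = (\<lambda>x. \<Sum>b\<in>Basis. (e \<bullet> F' x b) *\<^sub>R b)"
  have sum: "C1_map_on U (\<lambda>x. \<Sum>b\<in>A. (e \<bullet> F' x b) *\<^sub>R b)" if "finite A" for A :: "'a set"
    using that
  proof (induction A rule: finite_induct)
    case (insert b A)
    show ?case
      unfolding sum.insert[OF insert.hyps] using insert.IH
      by (intro C1_map_on_add C1_map_on_scaleR C1_map_on_inner C1_map_on_const C1)
  qed (simp add: C1_map_on_const)
  show thesis
  proof (rule that[of "\<lambda>x. blinfun_apply (F' x)" g])
    show "continuous_on U (\<lambda>x. F' x v)" for v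
      by (intro blinfun.continuous_on contF' continuous_on_const)
    show "C1_map_on U g"
      unfolding g_def by (rule sum) simp
    show "g x \<bullet> v = e \<bullet> F' x v" if "x \<in> U" for x v
    proof -
      have "e \<bullet> F' x v = e \<bullet> F' x (\<Sum>b\<in>Basis. (v \<bullet> b) *\<^sub>R b)"
        by (simp only: euclidean_representation)
      also have "\<dots> = (\<Sum>b\<in>Basis. (v \<bullet> b) * (e \<bullet> F' x b))"
        by (simp add: blinfun.sum_right blinfun.scaleR_right inner_sum_right)
      also have "\<dots> = g x \<bullet> v"
        by (simp add: g_def inner_sum_left inner_sum_right mult.commute inner_commute)
      finally show ?thesis by simp
    qed
  qed (use F(1) in auto)
qed

text \<open>\<gamma> is the component e \<bullet> \<psi> of the straightening chart, a local
  equation of \<open>M\<close>; its gradient cannot vanish because the derivative of \<psi> is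
  invertible. Vectors orthogonal to the gradient are velocities of curves obtained by pulling
  straight lines in the hyperplane back through the inverse chart.\<close>

lemma hypersurface_chart:
  fixes M :: "'a::euclidean_space set"
  assumes "C2_hypersurface M" "c \<in> M"
  obtains U \<gamma> g where "open U" "c \<in> U" "\<And>x. x \<in> U \<Longrightarrow> (\<gamma> has_derivative (\<lambda>h. g x \<bullet> h)) (at x)"
    "C1_map_on U g" "\<And>x. x \<in> U \<Longrightarrow> x \<in> M \<longleftrightarrow> \<gamma> x = (0::real)" "\<And>x. x \<in> U \<Longrightarrow> g x \<noteq> 0"
    "\<And>x v. \<lbrakk>x \<in> U; x \<in> M; g x \<bullet> v = 0\<rbrakk> \<Longrightarrow> v \<in> tangent_space M x"
proof -
  obtain U V \<psi> \<psi>i and e :: 'a where U: "open U" "c \<in> U" "open V" and hom: "homeomorphism U V \<psi> \<psi>i"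
    and C2: "C2_map_on U \<psi>" "C2_map_on V \<psi>i" and e: "e \<noteq> 0" and img: "\<psi> ` (M \<inter> U) = V \<inter> {y. e \<bullet> y = 0}"
    using bspec[OF assms(1)[unfolded C2_hypersurface_def] assms(2)]
    by (elim exE conjE) (rule that)
  have inv: "\<psi>i (\<psi> x) = x" "\<psi> x \<in> V" if "x \<in> U" for x
    using hom that unfolding homeomorphism_def by auto
  have inv': "\<psi> (\<psi>i y) = y" "\<psi>i y \<in> U" if "y \<in> V" for y
    using hom that unfolding homeomorphism_def by auto
  obtain \<psi>' g where \<psi>': "\<And>x. x \<in> U \<Longrightarrow> (\<psi> has_derivative \<psi>' x) (at x)"
    and g: "\<And>x v. x \<in> U \<Longrightarrow> g x \<bullet> v = e \<bullet> \<psi>' x v" "C1_map_on U g"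
    by (rule C2_map_on_gradient[OF C2(1), of e]) (rule that)
  obtain \<psi>i' where \<psi>i': "\<And>x. x \<in> V \<Longrightarrow> (\<psi>i has_derivative \<psi>i' x) (at x)" "\<And>v. continuous_on V (\<lambda>x. \<psi>i' x v)"
    by (rule C2_map_on_gradient[OF C2(2), of e]) (rule that)
  have M_iff: "x \<in> M \<longleftrightarrow> e \<bullet> \<psi> x = 0" if "x \<in> U" for x
  proof
    assume "x \<in> M"
    then have "\<psi> x \<in> V \<inter> {y. e \<bullet> y = 0}"
      using that unfolding img[symmetric] by blast
    then show "e \<bullet> \<psi> x = 0" by simp
  next
    assume "e \<bullet> \<psi> x = 0"
    then have "\<psi> x \<in> \<psi> ` (M \<inter> U)"
      unfolding img using inv(2)[OF that] by blast
    then obtain z where "z \<in> M" "z \<in> U" "\<psi> x = \<psi> z" by blast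
    then show "x \<in> M" using inv(1)[OF that] inv(1)[of z] by metis
  qed
  have comp1: "\<psi>i' (\<psi> x) (\<psi>' x v) = v" if "x \<in> U" for x v
  proof -
    have "((\<lambda>x. \<psi>i (\<psi> x)) has_derivative (\<lambda>v. \<psi>i' (\<psi> x) (\<psi>' x v))) (at x)"
      by (rule has_derivative_compose[OF \<psi>'[OF that] \<psi>i'(1)[OF inv(2)[OF that]]])
    moreover have "((\<lambda>x. \<psi>i (\<psi> x)) has_derivative (\<lambda>v. v)) (at x)"
      by (rule has_derivative_transform_within_open[OF has_derivative_ident U(1) that]) (simp add: inv)
    ultimately show ?thesis
      using has_derivative_unique by metis
  qed
  have comp2: "\<psi>' x (\<psi>i' (\<psi> x) w) = w" if "x \<in> U" for x w
  proof -
    have "((\<lambda>y. \<psi> (\<psi>i y)) has_derivative (\<lambda>w. \<psi>' (\<psi>i (\<psi> x)) (\<psi>i' (\<psi> x) w))) (at (\<psi> x))"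
      by (rule has_derivative_compose[OF \<psi>i'(1)[OF inv(2)[OF that]] \<psi>'[OF inv'(2)[OF inv(2)[OF that]]]])
    moreover have "((\<lambda>y. \<psi> (\<psi>i y)) has_derivative (\<lambda>v. v)) (at (\<psi> x))"
      by (rule has_derivative_transform_within_open[OF has_derivative_ident U(3) inv(2)[OF that]]) (simp add: inv')
    ultimately have "\<psi>' (\<psi>i (\<psi> x)) (\<psi>i' (\<psi> x) w) = w"
      using has_derivative_unique by metis
    then show ?thesis by (simp add: inv(1)[OF that])
  qed
  show thesis
  proof (rule that[of U "\<lambda>x. e \<bullet> \<psi> x" g])
    show "((\<lambda>x. e \<bullet> \<psi> x) has_derivative (\<lambda>h. g x \<bullet> h)) (at x)" if "x \<in> U" for x
      unfolding g(1)[OF that] by (intro has_derivative_inner_right \<psi>' that)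
    show "g x \<noteq> 0" if "x \<in> U" for x
    proof
      assume "g x = 0"
      then have "e \<bullet> \<psi>' x (\<psi>i' (\<psi> x) e) = 0"
        using g(1)[OF that] by (metis inner_zero_left)
      then show False using e by (simp add: comp2[OF that])
    qed
    show "v \<in> tangent_space M x" if x: "x \<in> U" "x \<in> M" "g x \<bullet> v = 0" for x v
    proof -
      define w where "w = \<psi>' x v"
      have ew: "e \<bullet> w = 0"
        using x g(1) by (simp add: w_def)
      have e\<psi>: "e \<bullet> \<psi> x = 0"
        using M_iff x by blast
      obtain r where r: "0 < r" "ball (\<psi> x) r \<subseteq> V"
        using U(3) inv(2)[OF x(1)] open_contains_ball by blast
      define k where "k = r / (norm w + 1)"
      have "0 < k" using r by (simp add: k_def add_nonneg_pos)
      have inV: "\<psi> x + s *\<^sub>R w \<in> V" if "s \<in> {-k<..<k}" for s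
      proof -
        have "\<bar>s\<bar> < k" using that by auto
        then have "\<bar>s\<bar> * (norm w + 1) < r"
          by (simp add: k_def pos_less_divide_eq add_nonneg_pos)
        moreover have "\<bar>s\<bar> * norm w \<le> \<bar>s\<bar> * (norm w + 1)"
          by (rule mult_left_mono) auto
        ultimately have "\<psi> x + s *\<^sub>R w \<in> ball (\<psi> x) r"
          by (simp add: dist_norm)
        then show ?thesis using r(2) by blast
      qed
      define \<beta> where "\<beta> = (\<lambda>s. \<psi>i (\<psi> x + s *\<^sub>R w))"
      have der: "(\<beta> has_vector_derivative \<psi>i' (\<psi> x + s *\<^sub>R w) w) (at s)" if "s \<in> {-k<..<k}" for s
      proof -
        have "((\<lambda>s. \<psi> x + s *\<^sub>R w) has_derivative (\<lambda>h. h *\<^sub>R w)) (at s)"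
          by (auto intro!: derivative_eq_intros)
        from has_derivative_compose[OF this \<psi>i'(1)[OF inV[OF that]]]
        show ?thesis
          using has_derivative_linear[OF \<psi>i'(1)[OF inV[OF that]]]
          by (simp add: \<beta>_def has_vector_derivative_def linear_cmul)
      qed
      have "continuous_on {-k<..<k} (\<lambda>s. \<psi>i' (\<psi> x + s *\<^sub>R w) w)"
        by (rule continuous_on_compose2[OF \<psi>i'(2)]) (auto intro!: continuous_intros inV)
      then have "\<beta> C1_differentiable_on {-k<..<k}"
        unfolding C1_differentiable_on_def using der by (intro exI conjI ballI) auto
      moreover have "\<beta> ` {-k<..<k} \<subseteq> M"
      proof
        fix z assume "z \<in> \<beta> ` {-k<..<k}"
        then obtain s where s: "s \<in> {-k<..<k}" "z = \<beta> s" by blast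
        then show "z \<in> M"
          using M_iff[of z] inv'[OF inV[OF s(1)]] ew e\<psi> by (simp add: \<beta>_def inner_add_right)
      qed
      moreover have "\<beta> 0 = x"
        using inv(1)[OF x(1)] by (simp add: \<beta>_def)
      moreover have "(\<beta> has_vector_derivative v) (at 0)"
        using der[of 0] \<open>0 < k\<close> comp1[OF x(1), of v] by (simp add: w_def)
      ultimately show ?thesis
        unfolding tangent_space_def using \<open>0 < k\<close> by blast
    qed
  qed (use U g(2) M_iff in auto)
qed

locale convex_body =
  fixes C :: "'a::euclidean_space set" and x0 :: 'a
  assumes compact: "compact C" and convex: "convex C" and x0: "x0 \<in> interior C"

locale smooth_convex_body = convex_body +
  assumes hypersurface: "C2_hypersurface (frontier C)"

context convex_body
begin

lemma closed: "closed C"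
  using compact by (rule compact_imp_closed)

lemma frontier_subset: "c \<in> frontier C \<Longrightarrow> c \<in> C"
  using closed frontier_subset_closed by blast

lemma supporting_normal_exists:
  assumes "c \<in> frontier C"
  shows "\<exists>n. norm n = 1 \<and> (\<forall>y\<in>C. n \<bullet> (y - c) \<le> 0)"
proof -
  have "c \<in> C" "c \<notin> rel_interior C"
    using assms frontier_subset x0 rel_interior_nonempty_interior[of C] by (auto simp: frontier_def)
  then obtain a where a: "a \<noteq> 0" "\<And>y. y \<in> C \<Longrightarrow> a \<bullet> c \<le> a \<bullet> y"
    by (rule supporting_hyperplane_rel_boundary[OF convex]) (rule that)
  have "(- a /\<^sub>R norm a) \<bullet> (y - c) \<le> 0" if "y \<in> C" for y
  proof -
    have "0 \<le> inverse (norm a) * (a \<bullet> (y - c))"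
      using a(2)[OF that] by (simp add: inner_diff_right)
    then show ?thesis by simp
  qed
  moreover have "norm (- a /\<^sub>R norm a) = 1"
    using a(1) by simp
  ultimately show ?thesis by blast
qed

lemma supporting_normal_strict:
  assumes "norm n = 1" "\<And>y. y \<in> C \<Longrightarrow> n \<bullet> (y - c) \<le> 0"
  shows "n \<bullet> (x0 - c) < 0"
proof -
  obtain r where r: "0 < r" "cball x0 r \<subseteq> C"
    using x0 mem_interior_cball by blast
  have "x0 + r *\<^sub>R n \<in> C"
    using r assms(1) by (intro subsetD[OF r(2)]) (simp add: dist_norm)
  from assms(2)[OF this] have "n \<bullet> (x0 - c) + r * (n \<bullet> n) \<le> 0"
    by (simp add: inner_simps algebra_simps)
  then show ?thesis
    using assms(1) r(1) by (simp add: norm_eq_1)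
qed

text \<open>Along a curve in the boundary the function n \<bullet> (y - c) has a maximum at
  \<open>c\<close>, so its derivative vanishes there.\<close>

lemma supporting_normal_tangent:
  assumes "\<And>y. y \<in> C \<Longrightarrow> n \<bullet> (y - c) \<le> 0" "v \<in> tangent_space (frontier C) c"
  shows "n \<bullet> v = 0"
proof -
  obtain \<beta> and e :: real where \<beta>: "0 < e" "\<beta> ` {-e<..<e} \<subseteq> frontier C" "\<beta> 0 = c"
    "(\<beta> has_vector_derivative v) (at 0)"
    using assms(2) unfolding tangent_space_def by blast
  have "((\<lambda>s. n \<bullet> (\<beta> s - c)) has_derivative (\<lambda>h. n \<bullet> (h *\<^sub>R v - 0))) (at 0)"
    using \<beta>(4) unfolding has_vector_derivative_def
    by (intro has_derivative_inner_right has_derivative_diff has_derivative_const)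
  moreover have "\<forall>s\<in>{-e<..<e}. n \<bullet> (\<beta> s - c) \<le> n \<bullet> (\<beta> 0 - c)"
  proof
    fix s assume "s \<in> {-e<..<e}"
    then have "\<beta> s \<in> C"
      using \<beta>(2) frontier_subset by blast
    then show "n \<bullet> (\<beta> s - c) \<le> n \<bullet> (\<beta> 0 - c)"
      using assms(1) \<beta>(3) by simp
  qed
  ultimately have "(\<lambda>h. n \<bullet> (h *\<^sub>R v - 0)) = (\<lambda>h. 0)"
    using \<beta>(1) by (intro differential_zero_maxmin[of 0 "{-e<..<e}"]) auto
  from fun_cong[OF this, of 1] show ?thesis by simp
qed

end

context smooth_convex_body
begin

abbreviation M :: "'a set" where "M \<equiv> frontier C"

text \<open>The part of \<open>n\<close> orthogonal to \<open>g\<close> is tangent, hence orthogonal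
  to \<open>n\<close>, hence zero. So \<open>n\<close> is a multiple of \<open>g\<close>, with its
  sign fixed by the interior point \<open>x0\<close>. This gives uniqueness of supporting normals
  and a formula that can be differentiated.\<close>

lemma supporting_normal_parallel:
  assumes "norm n = 1" "\<And>y. y \<in> C \<Longrightarrow> n \<bullet> (y - c) \<le> 0"
    and g: "g \<noteq> 0" "\<And>v. g \<bullet> v = 0 \<Longrightarrow> v \<in> tangent_space M c"
  shows "n = (sgn (g \<bullet> (c - x0)) / norm g) *\<^sub>R g" and "g \<bullet> (c - x0) \<noteq> 0"
proof -
  define k where "k = (n \<bullet> g) / (g \<bullet> g)"
  have gg: "g \<bullet> g \<noteq> 0" using g(1) by simp
  define v where "v = n - k *\<^sub>R g"
  have "g \<bullet> v = 0"
    using gg by (simp add: v_def k_def inner_diff_right inner_commute)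
  then have "n \<bullet> v = 0"
    using supporting_normal_tangent[OF assms(2) g(2)] by blast
  then have "v \<bullet> v = 0"
    using \<open>g \<bullet> v = 0\<close> by (simp add: v_def inner_diff_left inner_commute)
  then have n: "n = k *\<^sub>R g"
    by (simp add: v_def)
  have "0 < n \<bullet> (c - x0)"
    using supporting_normal_strict[OF assms(1,2)] by (simp add: inner_diff_right)
  then have pos: "0 < k * (g \<bullet> (c - x0))"
    by (simp add: n)
  then show "g \<bullet> (c - x0) \<noteq> 0" by auto
  have "\<bar>k\<bar> * norm g = 1"
    using assms(1) by (simp add: n)
  moreover have "sgn (g \<bullet> (c - x0)) = sgn k"
    using pos by (auto simp: zero_less_mult_iff)
  ultimately have "sgn (g \<bullet> (c - x0)) / norm g = k"
    using g(1) by (metis abs_mult_sgn divide_eq_eq mult.assoc mult.commute mult.left_neutral norm_eq_zero abs_sgn_eq abs_0 mult_zero_left sgn_0 sgn_zero)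
  then show "n = (sgn (g \<bullet> (c - x0)) / norm g) *\<^sub>R g"
    using n by simp
qed

text \<open>The outward normal is encoded through support and not through the cone condition of
  \<open>outward_normal\<close>, because inequalities against points of \<open>C\<close> are what
  convexity provides. \<open>outward_normal_C\<close> identifies the two on the boundary.\<close>

definition nu :: "'a \<Rightarrow> 'a" where
  "nu c = (THE n. norm n = 1 \<and> (\<forall>y\<in>C. n \<bullet> (y - c) \<le> 0))"

lemma supporting_normal_unique:
  assumes c: "c \<in> M" and "norm n = 1" "\<And>y. y \<in> C \<Longrightarrow> n \<bullet> (y - c) \<le> 0"
    and "norm m = 1" "\<And>y. y \<in> C \<Longrightarrow> m \<bullet> (y - c) \<le> 0"
  shows "n = m"
proof -
  obtain U \<gamma> g where U: "c \<in> U" "\<And>x. x \<in> U \<Longrightarrow> g x \<noteq> 0"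
    "\<And>x v. \<lbrakk>x \<in> U; x \<in> M; g x \<bullet> v = 0\<rbrakk> \<Longrightarrow> v \<in> tangent_space M x"
    by (rule hypersurface_chart[OF hypersurface c]) (rule that)
  have "n = (sgn (g c \<bullet> (c - x0)) / norm (g c)) *\<^sub>R g c"
    by (rule supporting_normal_parallel(1)[OF assms(2,3) U(2)[OF U(1)] U(3)[OF U(1) c]])
  moreover have "m = (sgn (g c \<bullet> (c - x0)) / norm (g c)) *\<^sub>R g c"
    by (rule supporting_normal_parallel(1)[OF assms(4,5) U(2)[OF U(1)] U(3)[OF U(1) c]])
  ultimately show ?thesis by simp
qed

lemma nu_eqI:
  assumes "c \<in> M" "norm n = 1" "\<And>y. y \<in> C \<Longrightarrow> n \<bullet> (y - c) \<le> 0"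
  shows "nu c = n"
  unfolding nu_def
proof (rule the_equality)
  show "m = n" if "norm m = 1 \<and> (\<forall>y\<in>C. m \<bullet> (y - c) \<le> 0)" for m
    using that by (intro supporting_normal_unique[OF assms(1) _ _ assms(2,3)]) auto
qed (use assms in simp)

lemma
  assumes "c \<in> M"
  shows norm_nu: "norm (nu c) = 1"
    and nu_support: "y \<in> C \<Longrightarrow> nu c \<bullet> (y - c) \<le> 0"
    and nu_inner_pos: "0 < nu c \<bullet> (c - x0)"
proof -
  obtain n where n: "norm n = 1" "\<And>y. y \<in> C \<Longrightarrow> n \<bullet> (y - c) \<le> 0"
    using supporting_normal_exists[OF assms] by blast
  have "nu c = n" by (rule nu_eqI[OF assms n])
  then show "norm (nu c) = 1" "y \<in> C \<Longrightarrow> nu c \<bullet> (y - c) \<le> 0" "0 < nu c \<bullet> (c - x0)"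
    using n supporting_normal_strict[OF n] by (auto simp: inner_diff_right)
qed

lemma nu_inner_nu: "c \<in> M \<Longrightarrow> nu c \<bullet> nu c = 1"
  using norm_nu by (simp add: norm_eq_1)

text \<open>\<open>N\<close> is the normalised gradient of a local defining function; it extends
  \<open>nu\<close> to an open set so that ordinary derivatives exist. Symmetry of \<open>N'\<close>
  on tangent vectors is symmetry of second derivatives: differentiating the scalar factor adds only
  a multiple of \<open>g c\<close>, which is orthogonal to them. The last conclusion says that
  \<open>M\<close> departs from its tangent hyperplane at \<open>c\<close> by o(|z - c|).\<close>

lemma local_normal_field:
  assumes "c \<in> M"
  obtains U N where "open U" "c \<in> U" "C1_map_on U N" "\<And>z. z \<in> U \<Longrightarrow> norm (N z) = 1"
    "\<And>z. \<lbrakk>z \<in> U; z \<in> M\<rbrakk> \<Longrightarrow> N z = nu z"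
    "\<And>z v. \<lbrakk>z \<in> U; z \<in> M; nu z \<bullet> v = 0\<rbrakk> \<Longrightarrow> v \<in> tangent_space M z"
    "\<And>N' v w. \<lbrakk>(N has_derivative N') (at c); nu c \<bullet> v = 0; nu c \<bullet> w = 0\<rbrakk> \<Longrightarrow> N' v \<bullet> w = v \<bullet> N' w"
    "((\<lambda>z. nu c \<bullet> (z - c)) has_derivative (\<lambda>h. 0)) (at c within M)"
proof -
  obtain U \<gamma> g where U: "open U" "c \<in> U" and der: "\<And>x. x \<in> U \<Longrightarrow> (\<gamma> has_derivative (\<lambda>h. g x \<bullet> h)) (at x)"
    and g: "C1_map_on U g" and M_iff: "\<And>x. x \<in> U \<Longrightarrow> x \<in> M \<longleftrightarrow> \<gamma> x = (0::real)" and gnz: "\<And>x. x \<in> U \<Longrightarrow> g x \<noteq> 0"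
    and tan: "\<And>x v. \<lbrakk>x \<in> U; x \<in> M; g x \<bullet> v = 0\<rbrakk> \<Longrightarrow> v \<in> tangent_space M x"
    by (rule hypersurface_chart[OF hypersurface assms]) (rule that)
  have nu_eq: "nu z = (sgn (g z \<bullet> (z - x0)) / norm (g z)) *\<^sub>R g z" "g z \<bullet> (z - x0) \<noteq> 0"
    if "z \<in> U" "z \<in> M" for z
    using supporting_normal_parallel[OF norm_nu nu_support gnz tan] that by blast+
  define \<sigma> where "\<sigma> = sgn (g c \<bullet> (c - x0))"
  have \<sigma>: "\<sigma> = 1 \<or> \<sigma> = -1"
    using nu_eq(2)[OF U(2) assms] by (simp add: \<sigma>_def sgn_if)
  \<comment> \<open>The sign of g z \<bullet> (z - x0) decides whether the gradient points outward.
    On \<open>W\<close> it is the sign at \<open>c\<close>, so one constant \<sigma> serves for all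
    of \<open>N\<close>.\<close>
  define W where "W = U \<inter> {z. 0 < \<sigma> * (g z \<bullet> (z - x0))}"
  have contg: "continuous_on U g"
    using g by (rule C1_map_on_continuous)
  have "open W"
  proof -
    have "continuous_on U (\<lambda>z. \<sigma> * (g z \<bullet> (z - x0)))"
      by (intro continuous_intros contg)
    then have "open ((\<lambda>z. \<sigma> * (g z \<bullet> (z - x0))) -` {0<..} \<inter> U)"
      using U(1) by (simp add: continuous_on_open_vimage)
    then show ?thesis
      by (simp add: W_def vimage_def Int_commute Int_def conj_commute)
  qed
  have "c \<in> W"
    using U(2) nu_eq(2)[OF U(2) assms] by (auto simp: W_def \<sigma>_def sgn_if)
  have WU: "W \<subseteq> U" by (auto simp: W_def)
  have \<sigma>W: "sgn (g z \<bullet> (z - x0)) = \<sigma>" if "z \<in> W" for z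
    using that \<sigma> by (auto simp: W_def)
  define N where "N = (\<lambda>z. (\<sigma> * inverse (norm (g z))) *\<^sub>R g z)"
  have NW: "N z = nu z" if "z \<in> W" "z \<in> M" for z
    using nu_eq(1)[of z] \<sigma>W[OF that(1)] that WU by (auto simp: N_def divide_inverse)
  have gW: "C1_map_on W g"
    using g WU C1_map_on_subset by blast
  have r: "C1_map_on W (\<lambda>z. \<sigma> * inverse (norm (g z)))"
    using gW gnz WU by (intro C1_map_on_mult C1_map_on_inverse C1_map_on_norm C1_map_on_const) auto
  have nu_c: "nu c = N c"
    using NW[OF \<open>c \<in> W\<close> assms] by simp
  have g_nu: "g z \<bullet> v = 0" if "z \<in> W" "z \<in> M" "nu z \<bullet> v = 0" for z v
  proof -
    have "(\<sigma> * inverse (norm (g z))) * (g z \<bullet> v) = 0"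
      using that(3) unfolding NW[OF that(1,2), symmetric] N_def by simp
    then show ?thesis
      using gnz[of z] that(1) WU \<sigma> by auto
  qed
  show thesis
  proof (rule that[OF \<open>open W\<close> \<open>c \<in> W\<close>, of N])
    show "C1_map_on W N"
      unfolding N_def by (intro C1_map_on_scaleR r gW)
    show "norm (N z) = 1" if "z \<in> W" for z
      using gnz[of z] that WU \<sigma> by (auto simp: N_def)
    show "N z = nu z" if "z \<in> W" "z \<in> M" for z
      using NW that .
    show "v \<in> tangent_space M z" if "z \<in> W" "z \<in> M" "nu z \<bullet> v = 0" for z v
      using tan[of z v] g_nu[OF that] that WU by blast
    fix N' v w assume N': "(N has_derivative N') (at c)" "nu c \<bullet> v = 0" "nu c \<bullet> w = 0"
    obtain g' where g': "(g has_derivative g') (at c)"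
      using gW \<open>c \<in> W\<close> by (elim C1_map_onE) blast
    obtain r' where r': "((\<lambda>z. \<sigma> * inverse (norm (g z))) has_derivative r') (at c)"
      using r \<open>c \<in> W\<close> by (elim C1_map_onE) blast
    have "(N has_derivative (\<lambda>h. (\<sigma> * inverse (norm (g c))) *\<^sub>R g' h + r' h *\<^sub>R g c)) (at c)"
      unfolding N_def by (rule has_derivative_scaleR[OF r' g'])
    then have "N' = (\<lambda>h. (\<sigma> * inverse (norm (g c))) *\<^sub>R g' h + r' h *\<^sub>R g c)"
      using N'(1) has_derivative_unique by blast
    moreover have "g' v \<bullet> w = v \<bullet> g' w"
      by (rule symmetric_derivative_of_gradient[OF U _ g']) (rule der)
    moreover have "g c \<bullet> v = 0" "g c \<bullet> w = 0"
      using g_nu[OF \<open>c \<in> W\<close> assms] N'(2,3) by auto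
    ultimately show "N' v \<bullet> w = v \<bullet> N' w"
      by (simp add: inner_add_left inner_add_right inner_commute)
  next
    obtain d where d: "0 < d" "ball c d \<subseteq> U"
      using U open_contains_ball by blast
    have "((\<lambda>z. 0) has_derivative (\<lambda>h. g c \<bullet> h)) (at c within M)"
    proof (rule has_derivative_transform_within[OF has_derivative_at_withinI[OF der[OF U(2)]]])
      show "0 < d" by fact
      show "c \<in> M" by fact
      show "\<gamma> z = 0" if "z \<in> M" "dist z c < d" for z
        using that d(2) M_iff[of z] by (auto simp: dist_commute)
    qed
    then have "((\<lambda>z. 0 - g c \<bullet> (z - c)) has_derivative (\<lambda>h. g c \<bullet> h - g c \<bullet> (h - 0))) (at c within M)"
      by (intro has_derivative_diff has_derivative_inner_right has_derivative_ident has_derivative_const)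
    then have "((\<lambda>z. (- \<sigma> * inverse (norm (g c))) * (0 - g c \<bullet> (z - c))) has_derivative
        (\<lambda>h. (- \<sigma> * inverse (norm (g c))) * (g c \<bullet> h - g c \<bullet> (h - 0)))) (at c within M)"
      by (rule has_derivative_mult_right)
    then show "((\<lambda>z. nu c \<bullet> (z - c)) has_derivative (\<lambda>h. 0)) (at c within M)"
      unfolding nu_c N_def by simp
  qed
qed

lemma tangent_space_eq:
  assumes "c \<in> M"
  shows "tangent_space M c = {v. nu c \<bullet> v = 0}"
proof -
  obtain U where "c \<in> U" "\<And>z v. \<lbrakk>z \<in> U; z \<in> M; nu z \<bullet> v = 0\<rbrakk> \<Longrightarrow> v \<in> tangent_space M z"
    by (rule local_normal_field[OF assms]) (rule that)
  then show ?thesis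
    using supporting_normal_tangent[OF nu_support[OF assms]] assms by blast
qed

end

section \<open>Surface gradient and Hessian\<close>

text \<open>A derivative within \<open>S\<close> need not be unique, but composed with a curve in
  \<open>S\<close> of velocity \<open>v\<close> it becomes a derivative on an open interval, and
  that is unique.\<close>

lemma derivative_within_tangent_unique:
  fixes f :: "'a::euclidean_space \<Rightarrow> 'b::real_normed_vector"
  assumes "(f has_derivative f1) (at c within S)" "(f has_derivative f2) (at c within S)"
    and "v \<in> tangent_space S c"
  shows "f1 v = f2 v"
proof -
  obtain \<beta> and e :: real where \<beta>: "0 < e" "\<beta> ` {-e<..<e} \<subseteq> S" "\<beta> 0 = c"
    "(\<beta> has_vector_derivative v) (at 0)"
    using assms(3) unfolding tangent_space_def by blast
  have der: "((f \<circ> \<beta>) has_derivative (f' \<circ> (\<lambda>h. h *\<^sub>R v))) (at 0)" if "(f has_derivative f') (at c within S)" for f'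
  proof -
    have "((f \<circ> \<beta>) has_derivative (f' \<circ> (\<lambda>h. h *\<^sub>R v))) (at 0 within {-e<..<e})"
    proof (rule diff_chain_within)
      show "(\<beta> has_derivative (\<lambda>h. h *\<^sub>R v)) (at 0 within {-e<..<e})"
        using \<beta>(4) unfolding has_vector_derivative_def by (rule has_derivative_at_withinI)
      show "(f has_derivative f') (at (\<beta> 0) within \<beta> ` {-e<..<e})"
        using that \<beta>(2,3) has_derivative_subset by metis
    qed
    moreover have "at 0 within {-e<..<e} = at (0::real)"
      using \<beta>(1) by (intro at_within_open) auto
    ultimately show ?thesis by simp
  qed
  have "f1 \<circ> (\<lambda>h. h *\<^sub>R v) = f2 \<circ> (\<lambda>h. h *\<^sub>R v)"
    using der[OF assms(1)] der[OF assms(2)] has_derivative_unique by blast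
  from fun_cong[OF this, of 1] show ?thesis by simp
qed

locale smooth_function = smooth_convex_body +
  fixes f :: "'a \<Rightarrow> real"
  assumes C2_f: "C2_function_on (frontier C) f"
begin

abbreviation G :: "'a \<Rightarrow> 'a" where "G \<equiv> surface_gradient M f"

lemma surface_gradient_eqI:
  assumes "c \<in> M" "nu c \<bullet> g = 0" "(f has_derivative (\<lambda>h. g \<bullet> h)) (at c within M)"
  shows "G c = g"
  unfolding surface_gradient_def
proof (rule the_equality)
  show "g \<in> tangent_space M c \<and> (f has_derivative (\<lambda>h. g \<bullet> h)) (at c within M)"
    using assms by (simp add: tangent_space_eq)
  fix k assume k: "k \<in> tangent_space M c \<and> (f has_derivative (\<lambda>h. k \<bullet> h)) (at c within M)"
  have "k - g \<in> tangent_space M c"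
    using k assms(1,2) by (simp add: tangent_space_eq inner_diff_right)
  then have "k \<bullet> (k - g) = g \<bullet> (k - g)"
    using derivative_within_tangent_unique k assms(3) by blast
  then have "(k - g) \<bullet> (k - g) = 0"
    by (simp add: inner_diff_left)
  then show "k = g" by simp
qed

text \<open>\<open>E\<close> is the tangential part of the gradient of an ambient extension, and it
  extends \<open>G\<close> to an open set. The claims about \<open>D\<close> describe the Hessian at
  a critical point. Differentiating N \<bullet> E = 0 where \<open>E c = 0\<close> shows that
  \<open>D\<close> takes tangential values. The terms by which \<open>D\<close> differs from a
  symmetric second derivative are either normal or multiples of the derivative of \<open>N\<close>,
  which is symmetric on tangent vectors.\<close>

lemma local_gradient_field:
  assumes "c \<in> M"
  obtains U E where "open U" "c \<in> U" "C1_map_on U E" "\<And>z. \<lbrakk>z \<in> U; z \<in> M\<rbrakk> \<Longrightarrow> G z = E z"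
    "nu c \<bullet> G c = 0" "(f has_derivative (\<lambda>h. G c \<bullet> h)) (at c within M)"
    "\<And>D v. \<lbrakk>G c = 0; (E has_derivative D) (at c)\<rbrakk> \<Longrightarrow> nu c \<bullet> D v = 0"
    "\<And>D v w. \<lbrakk>G c = 0; (E has_derivative D) (at c); nu c \<bullet> v = 0; nu c \<bullet> w = 0\<rbrakk> \<Longrightarrow> D v \<bullet> w = v \<bullet> D w"
proof -
  obtain U1 h where U1: "open U1" "c \<in> U1" and h: "C2_map_on U1 h" "\<And>x. x \<in> M \<inter> U1 \<Longrightarrow> h x = f x"
    using bspec[OF C2_f[unfolded C2_function_on_def] assms] by (elim exE conjE) (rule that, assumption+, erule bspec)
  obtain h' g where h': "\<And>x. x \<in> U1 \<Longrightarrow> (h has_derivative h' x) (at x)"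
    and g: "\<And>x v. x \<in> U1 \<Longrightarrow> g x \<bullet> v = 1 \<bullet> h' x v" "C1_map_on U1 g"
    by (rule C2_map_on_gradient[OF h(1), of 1]) (rule that)
  obtain U2 N where U2: "open U2" "c \<in> U2" and N: "C1_map_on U2 N" "\<And>z. z \<in> U2 \<Longrightarrow> norm (N z) = 1"
    "\<And>z. \<lbrakk>z \<in> U2; z \<in> M\<rbrakk> \<Longrightarrow> N z = nu z"
    and Nsym: "\<And>N' v w. \<lbrakk>(N has_derivative N') (at c); nu c \<bullet> v = 0; nu c \<bullet> w = 0\<rbrakk> \<Longrightarrow> N' v \<bullet> w = v \<bullet> N' w"
    by (rule local_normal_field[OF assms]) (rule that)
  have hder: "(h has_derivative (\<lambda>v. g x \<bullet> v)) (at x)" if "x \<in> U1" for x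
  proof -
    have "h' x = (\<lambda>v. g x \<bullet> v)"
      using g(1)[OF that] by (simp add: fun_eq_iff)
    then show ?thesis using h'[OF that] by simp
  qed
  define U where "U = U1 \<inter> U2"
  have U: "open U" "c \<in> U"
    using U1 U2 by (auto simp: U_def)
  define E where "E = (\<lambda>z. g z - (N z \<bullet> g z) *\<^sub>R N z)"
  have gU: "C1_map_on U g" and NU: "C1_map_on U N"
    using g(2) N(1) by (auto simp: U_def intro: C1_map_on_subset)
  have EU: "C1_map_on U E"
    unfolding E_def by (intro C1_map_on_diff C1_map_on_scaleR C1_map_on_inner gU NU)
  have NE: "N z \<bullet> E z = 0" if "z \<in> U" for z
    using N(2)[of z] that by (simp add: E_def U_def inner_diff_right norm_eq_1)
  have fE: "(f has_derivative (\<lambda>v. E z \<bullet> v)) (at z within M)" if z: "z \<in> U" "z \<in> M" for z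
  proof -
    have zU: "z \<in> U1" "z \<in> U2" using z by (auto simp: U_def)
    have nuz: "((\<lambda>y. nu z \<bullet> (y - z)) has_derivative (\<lambda>h. 0)) (at z within M)"
      by (rule local_normal_field[OF z(2)]) blast
    have "(f has_derivative (\<lambda>v. g z \<bullet> v)) (at z within M)"
    proof -
      obtain d where d: "0 < d" "ball z d \<subseteq> U1"
        using U1(1) zU(1) open_contains_ball by blast
      show ?thesis
      proof (rule has_derivative_transform_within[OF has_derivative_at_withinI[OF hder[OF zU(1)]] d(1) z(2)])
        show "h y = f y" if "y \<in> M" "dist y z < d" for y
          using that d(2) by (intro h(2)) (auto simp: dist_commute)
      qed
    qed
    \<comment> \<open>The term with \<open>nu z\<close> is subtracted and added back, but
      differentiated in two ways: as a linear function where it is subtracted, and with derivative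
      zero within \<open>M\<close> where it is added. This trades the ambient gradient for its
      tangential part.\<close>
    then have "((\<lambda>y. f y - (N z \<bullet> g z) * (nu z \<bullet> (y - z)) + (N z \<bullet> g z) * (nu z \<bullet> (y - z))) has_derivative
        (\<lambda>v. g z \<bullet> v - (N z \<bullet> g z) * (nu z \<bullet> (v - 0)) + (N z \<bullet> g z) * 0)) (at z within M)"
      by (intro has_derivative_add[OF has_derivative_diff has_derivative_mult_right[OF nuz]]
          has_derivative_mult_right has_derivative_inner_right has_derivative_diff
          has_derivative_ident has_derivative_const)
    then show ?thesis
      using N(3)[OF zU(2) z(2)] by (simp add: E_def inner_diff_left)
  qed
  have GE: "G z = E z" if "z \<in> U" "z \<in> M" for z
    using NE[OF that(1)] N(3)[of z] that by (intro surface_gradient_eqI fE) (auto simp: U_def)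
  have nuc: "N c = nu c"
    using N(3) U assms by (simp add: U_def)
  show thesis
  proof (rule that[OF U EU GE])
    show "nu c \<bullet> G c = 0"
      using NE[OF U(2)] by (simp add: GE[OF U(2) assms] nuc)
    show "(f has_derivative (\<lambda>h. G c \<bullet> h)) (at c within M)"
      using fE[OF U(2) assms] by (simp add: GE[OF U(2) assms])
    fix D v assume Gc: "G c = 0" and D: "(E has_derivative D) (at c)"
    have Ec: "E c = 0"
      using Gc GE[OF U(2) assms] by simp
    obtain N' where N': "(N has_derivative N') (at c)"
      using NU U(2) by (elim C1_map_onE) blast
    obtain g' where g': "(g has_derivative g') (at c)"
      using gU U(2) by (elim C1_map_onE) blast
    have "((\<lambda>z. N z \<bullet> E z) has_derivative (\<lambda>v. N c \<bullet> D v + N' v \<bullet> E c)) (at c)"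
      by (rule has_derivative_inner[OF N' D])
    moreover have "((\<lambda>z. N z \<bullet> E z) has_derivative (\<lambda>v. 0)) (at c)"
      by (rule has_derivative_transform_within_open[OF has_derivative_const U]) (simp add: NE)
    ultimately have "(\<lambda>v. N c \<bullet> D v + N' v \<bullet> E c) = (\<lambda>v. 0)"
      using has_derivative_unique by blast
    from fun_cong[OF this, of v] show "nu c \<bullet> D v = 0"
      by (simp add: Ec nuc)
    fix w assume vw: "nu c \<bullet> v = 0" "nu c \<bullet> w = 0"
    have "(E has_derivative (\<lambda>v. g' v - ((N c \<bullet> g c) *\<^sub>R N' v + (N c \<bullet> g' v + N' v \<bullet> g c) *\<^sub>R N c))) (at c)"
      unfolding E_def
      by (intro has_derivative_diff has_derivative_scaleR has_derivative_inner g' N')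
    then have "D = (\<lambda>v. g' v - ((N c \<bullet> g c) *\<^sub>R N' v + (N c \<bullet> g' v + N' v \<bullet> g c) *\<^sub>R N c))"
      using D has_derivative_unique by blast
    moreover have "g' v \<bullet> w = v \<bullet> g' w"
      by (rule symmetric_derivative_of_gradient[OF U1 _ g']) (rule hder)
    moreover have "N' v \<bullet> w = v \<bullet> N' w"
      by (rule Nsym[OF N' vw])
    ultimately show "D v \<bullet> w = v \<bullet> D w"
      using vw by (simp add: nuc inner_diff_left inner_diff_right inner_add_left inner_add_right inner_commute)
  qed
qed

lemma
  assumes "c \<in> M"
  shows nu_inner_gradient: "nu c \<bullet> G c = 0"
    and has_derivative_gradient: "(f has_derivative (\<lambda>h. G c \<bullet> h)) (at c within M)"
proof -
  show "nu c \<bullet> G c = 0"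
    by (rule local_gradient_field[OF assms]) assumption
  show "(f has_derivative (\<lambda>h. G c \<bullet> h)) (at c within M)"
    by (rule local_gradient_field[OF assms]) assumption
qed

text \<open>On tangent vectors the derivative of \<open>G\<close> within \<open>M\<close> agrees
  with that of its extension \<open>E\<close>; as \<open>D v\<close> is already tangential, the
  projection in the definition fixes it.\<close>

lemma surface_hessian_eq:
  assumes c: "c \<in> M" and U: "open U" "c \<in> U" and GE: "\<And>z. \<lbrakk>z \<in> U; z \<in> M\<rbrakk> \<Longrightarrow> G z = E z"
    and D: "(E has_derivative D) (at c)" "nu c \<bullet> D v = 0" and v: "nu c \<bullet> v = 0"
  shows "surface_hessian M f c v = D v"
proof -
  obtain d where d: "0 < d" "ball c d \<subseteq> U"
    using U open_contains_ball by blast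
  have "(G has_derivative D) (at c within M)"
  proof (rule has_derivative_transform_within[OF has_derivative_at_withinI[OF D(1)] d(1) c])
    show "E z = G z" if "z \<in> M" "dist z c < d" for z
      using that d(2) by (intro GE[symmetric]) (auto simp: dist_commute)
  qed
  moreover from this have "(G has_derivative frechet_derivative G (at c within M)) (at c within M)"
    using frechet_derivative_works differentiableI by blast
  moreover have "v \<in> tangent_space M c"
    using v by (simp add: tangent_space_eq[OF c])
  ultimately have "frechet_derivative G (at c within M) v = D v"
    by (intro derivative_within_tangent_unique)
  then show ?thesis
    unfolding surface_hessian_def using D(2) by (simp add: closest_point_self tangent_space_eq[OF c])
qed

lemma Morse_index_eq:
  assumes c: "c \<in> M" and H: "\<And>v. nu c \<bullet> v = 0 \<Longrightarrow> surface_hessian M f c v = D v"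
  defines "T \<equiv> {v. nu c \<bullet> v = 0}"
  shows "Morse_index M f c =
    (\<Sum>m | m < 0 \<and> (\<exists>v\<in>{v \<in> T. D v = m *\<^sub>R v}. v \<noteq> 0). dim {v \<in> T. D v = m *\<^sub>R v})"
proof -
  have "hessian_eigenspace M f c m = {v \<in> T. D v = m *\<^sub>R v}" for m
    unfolding hessian_eigenspace_def tangent_space_eq[OF c] T_def using H by auto
  then show ?thesis
    unfolding Morse_index_def by simp
qed

end

section \<open>The Minkowski functional of a smooth convex body\<close>

context convex_body
begin

lemma ray_exists:
  assumes "y \<noteq> 0"
  shows "\<exists>t>0. x0 + t *\<^sub>R y \<in> frontier C"
proof -
  obtain d where "0 < d" "x0 + d *\<^sub>R y \<in> frontier C"
    by (rule ray_to_frontier[OF compact_imp_bounded[OF compact] x0 assms]) (rule that)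
  then show ?thesis by blast
qed

text \<open>At \<open>y = 0\<close> the functional is junk, because no multiple of 0 reaches the boundary.\<close>

definition minkowski :: "'a \<Rightarrow> real" where
  "minkowski y = inverse (SOME t. 0 < t \<and> x0 + t *\<^sub>R y \<in> frontier C)"

definition radial :: "'a \<Rightarrow> 'a" where
  "radial y = x0 + inverse (minkowski y) *\<^sub>R y"

lemma
  assumes "y \<noteq> 0"
  shows minkowski_pos: "0 < minkowski y" and radial_in_frontier: "radial y \<in> frontier C"
proof -
  have "0 < (SOME t. 0 < t \<and> x0 + t *\<^sub>R y \<in> frontier C) \<and>
      x0 + (SOME t. 0 < t \<and> x0 + t *\<^sub>R y \<in> frontier C) *\<^sub>R y \<in> frontier C"
    by (rule someI_ex) (use ray_exists[OF assms] in simp)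
  then show "0 < minkowski y" "radial y \<in> frontier C"
    by (simp_all add: minkowski_def radial_def)
qed

lemma frontier_not_x0: "c \<in> frontier C \<Longrightarrow> c \<noteq> x0"
  using x0 by (auto simp: frontier_def)

end

context smooth_convex_body
begin

text \<open>The normal rescaled to the point of the polar body of C - x0 that is dual to
  \<open>c\<close>: as a functional it is at most 1 on C - x0 and equals 1 at c - x0.\<close>

definition conormal :: "'a \<Rightarrow> 'a" where
  "conormal c = inverse (nu c \<bullet> (c - x0)) *\<^sub>R nu c"

lemma conormal_inner_self: "c \<in> M \<Longrightarrow> conormal c \<bullet> (c - x0) = 1"
  using nu_inner_pos by (simp add: conormal_def less_imp_neq[symmetric])

lemma conormal_support:
  assumes "c \<in> M" "z \<in> C"
  shows "conormal c \<bullet> (z - x0) \<le> 1"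
proof -
  have "nu c \<bullet> (z - x0) \<le> nu c \<bullet> (c - x0)"
    using nu_support[OF assms] by (simp add: inner_diff_right)
  then have "inverse (nu c \<bullet> (c - x0)) * (nu c \<bullet> (z - x0)) \<le> inverse (nu c \<bullet> (c - x0)) * (nu c \<bullet> (c - x0))"
    using nu_inner_pos[OF assms(1)] by (intro mult_left_mono) auto
  then show ?thesis
    using nu_inner_pos[OF assms(1)] by (simp add: conormal_def)
qed

lemma conormal_inner_le_minkowski:
  assumes "c \<in> M" "y \<noteq> 0"
  shows "conormal c \<bullet> y \<le> minkowski y"
proof -
  have "conormal c \<bullet> (radial y - x0) \<le> 1"
    using assms radial_in_frontier frontier_subset by (intro conormal_support) auto
  then have "inverse (minkowski y) * (conormal c \<bullet> y) \<le> 1"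
    by (simp add: radial_def)
  then show ?thesis
    using minkowski_pos[OF assms(2)] by (simp add: field_simps)
qed

lemma conormal_radial_inner:
  assumes "y \<noteq> 0"
  shows "conormal (radial y) \<bullet> y = minkowski y"
proof -
  have "conormal (radial y) \<bullet> (radial y - x0) = 1"
    by (rule conormal_inner_self[OF radial_in_frontier[OF assms]])
  then have "inverse (minkowski y) * (conormal (radial y) \<bullet> y) = 1"
    by (simp add: radial_def)
  then show ?thesis
    using minkowski_pos[OF assms] by (simp add: field_simps)
qed

lemma
  assumes "c \<in> M"
  shows minkowski_frontier: "minkowski (c - x0) = 1" and radial_frontier: "radial (c - x0) = c"
proof -
  have nz: "c - x0 \<noteq> 0"
    using frontier_not_x0[OF assms] by simp
  have "1 \<le> minkowski (c - x0)"
    using conormal_inner_le_minkowski[OF assms nz] conormal_inner_self[OF assms] by simp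
  moreover have "minkowski (c - x0) \<le> 1"
    using conormal_support[OF radial_in_frontier[OF nz] frontier_subset[OF assms]]
    by (simp add: conormal_radial_inner[OF nz])
  ultimately show "minkowski (c - x0) = 1" by simp
  then show "radial (c - x0) = c"
    by (simp add: radial_def)
qed

text \<open>A ball of radius \<open>r\<close> about \<open>x0\<close> inside \<open>C\<close> forces
  the distance nu c \<bullet> (c - x0) from \<open>x0\<close> to each supporting hyperplane to be at
  least \<open>r\<close>.\<close>

lemma conormal_bounded:
  obtains r where "0 < r" "\<And>c. c \<in> M \<Longrightarrow> norm (conormal c) \<le> 1 / r"
proof -
  obtain r where r: "0 < r" "cball x0 r \<subseteq> C"
    using x0 mem_interior_cball by blast
  have "norm (conormal c) \<le> 1 / r" if c: "c \<in> M" for c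
  proof -
    have "x0 + r *\<^sub>R nu c \<in> C"
      using r norm_nu[OF c] by (intro subsetD[OF r(2)]) (simp add: dist_norm)
    from nu_support[OF c this] have "r \<le> nu c \<bullet> (c - x0)"
      using nu_inner_nu[OF c] by (simp add: inner_simps)
    then have "inverse (nu c \<bullet> (c - x0)) \<le> inverse r"
      using r(1) by (intro le_imp_inverse_le)
    then show ?thesis
      using norm_nu[OF c] nu_inner_pos[OF c] by (simp add: conormal_def divide_inverse)
  qed
  then show thesis using that r(1) by blast
qed

lemma minkowski_bounds:
  obtains r R where "0 < r" "0 < R" "\<And>y. y \<noteq> 0 \<Longrightarrow> minkowski y \<le> norm y / r" "\<And>y. y \<noteq> 0 \<Longrightarrow> norm y / R \<le> minkowski y"
proof -
  obtain r where r: "0 < r" "\<And>c. c \<in> M \<Longrightarrow> norm (conormal c) \<le> 1 / r"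
    by (rule conormal_bounded) (rule that)
  obtain R where R: "0 < R" "\<And>c. c \<in> C \<Longrightarrow> norm (c - x0) \<le> R"
  proof -
    have "bounded ((\<lambda>c. c - x0) ` C)"
      using bounded_translation_minus[OF compact_imp_bounded[OF compact]] .
    then show thesis
      using that unfolding bounded_pos by auto
  qed
  show thesis
  proof (rule that[OF r(1) R(1)])
    fix y :: 'a assume y: "y \<noteq> 0"
    have "minkowski y \<le> norm (conormal (radial y)) * norm y"
      using norm_cauchy_schwarz[of "conormal (radial y)" y] conormal_radial_inner[OF y] by simp
    also have "\<dots> \<le> (1 / r) * norm y"
      using r(2)[OF radial_in_frontier[OF y]] by (rule mult_right_mono) simp
    finally show "minkowski y \<le> norm y / r" by simp
    have "norm (radial y - x0) \<le> R"
      using R(2) frontier_subset[OF radial_in_frontier[OF y]] .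
    then have "inverse (minkowski y) * norm y \<le> R"
      using minkowski_pos[OF y] by (simp add: radial_def)
    then show "norm y / R \<le> minkowski y"
      using minkowski_pos[OF y] R(1) by (simp add: field_simps)
  qed
qed

lemma continuous_on_nu: "continuous_on M nu"
proof -
  have "continuous (at c within M) nu" if c: "c \<in> M" for c
  proof -
    obtain U N where U: "open U" "c \<in> U" and N: "C1_map_on U N" "\<And>z. \<lbrakk>z \<in> U; z \<in> M\<rbrakk> \<Longrightarrow> N z = nu z"
      by (rule local_normal_field[OF c]) (rule that)
    have "continuous (at c) N"
      using C1_map_on_continuous[OF N(1)] U by (simp add: continuous_on_eq_continuous_at)
    then have "continuous (at c within M) N"
      by (rule continuous_at_imp_continuous_within)
    moreover have "\<forall>\<^sub>F z in at c within M. N z = nu z"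
      unfolding eventually_at_topological using U N(2) by (intro exI[of _ U]) simp
    ultimately show ?thesis
      unfolding continuous_within N(2)[OF U(2) c] by (rule Lim_transform_eventually)
  qed
  then show ?thesis by (simp add: continuous_on_eq_continuous_within)
qed

lemma continuous_on_conormal: "continuous_on M conormal"
  unfolding conormal_def
  by (intro continuous_on_scaleR continuous_on_inverse continuous_on_inner continuous_on_diff
      continuous_on_id continuous_on_const continuous_on_nu ballI)
    (rule less_imp_neq[symmetric], rule nu_inner_pos)

text \<open>A supremum of linear functionals of norm at most 1/r is Lipschitz: the functional
  attained at one of two points bounds the difference of the values from above.\<close>

lemma continuous_on_minkowski: "continuous_on (- {0}) minkowski"
proof -
  obtain r where r: "0 < r" "\<And>c. c \<in> M \<Longrightarrow> norm (conormal c) \<le> 1 / r"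
    by (rule conormal_bounded) (rule that)
  have le: "minkowski y - minkowski z \<le> 1 / r * dist y z" if "y \<noteq> 0" "z \<noteq> 0" for y z
  proof -
    have "minkowski y - minkowski z \<le> conormal (radial y) \<bullet> y - conormal (radial y) \<bullet> z"
      using conormal_radial_inner[OF that(1)] conormal_inner_le_minkowski[OF radial_in_frontier[OF that(1)] that(2)] by simp
    also have "\<dots> \<le> norm (conormal (radial y)) * norm (y - z)"
      by (metis inner_diff_right norm_cauchy_schwarz)
    also have "\<dots> \<le> 1 / r * norm (y - z)"
      using r(2)[OF radial_in_frontier[OF that(1)]] by (rule mult_right_mono) simp
    finally show ?thesis by (simp add: dist_norm)
  qed
  have "(1 / r)-lipschitz_on (- {0}) minkowski"
  proof (rule lipschitz_onI)
    fix y z :: 'a assume "y \<in> - {0}" "z \<in> - {0}"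
    then show "dist (minkowski y) (minkowski z) \<le> 1 / r * dist y z"
      using le[of y z] le[of z y] by (simp add: dist_real_def abs_le_iff dist_commute)
  qed (use r(1) in simp)
  then show ?thesis by (rule lipschitz_on_continuous_on)
qed

lemma continuous_on_radial: "continuous_on (- {0}) radial"
  unfolding radial_def
  by (intro continuous_on_add continuous_on_scaleR continuous_on_inverse continuous_on_minkowski
      continuous_on_id continuous_on_const ballI)
    (rule less_imp_neq[symmetric], rule minkowski_pos, simp)

lemma continuous_on_conormal_radial: "continuous_on (- {0}) (\<lambda>y. conormal (radial y))"
  by (rule continuous_on_compose2[OF continuous_on_conormal continuous_on_radial])
    (use radial_in_frontier in auto)

text \<open>The Minkowski functional is a supremum of the linear functionals \<open>conormal c\<close>, attained at \<open>c = radial y\<close>, so its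
  gradient at \<open>y\<close> is \<open>conormal (radial y)\<close>.\<close>

lemma has_derivative_minkowski:
  assumes y: "y \<noteq> 0"
  shows "(minkowski has_derivative (\<lambda>h. conormal (radial y) \<bullet> h)) (at y)"
  unfolding has_derivative_at_alt
proof (intro conjI allI impI)
  show "bounded_linear (\<lambda>h. conormal (radial y) \<bullet> h)"
    by (rule bounded_linear_inner_right)
  fix e :: real assume "0 < e"
  have "continuous (at y) (\<lambda>y. conormal (radial y))"
    using continuous_on_conormal_radial y by (simp add: continuous_on_eq_continuous_at open_Compl)
  then obtain d where d: "0 < d" "\<And>z. dist z y < d \<Longrightarrow> dist (conormal (radial z)) (conormal (radial y)) < e"
    using \<open>0 < e\<close> unfolding continuous_at_eps_delta by blast
  show "\<exists>d>0. \<forall>z. norm (z - y) < d \<longrightarrow>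
      norm (minkowski z - minkowski y - conormal (radial y) \<bullet> (z - y)) \<le> e * norm (z - y)"
  proof (intro exI[of _ "min d (norm y)"] conjI allI impI)
    show "0 < min d (norm y)" using d(1) y by simp
    fix z assume z: "norm (z - y) < min d (norm y)"
    then have nz: "z \<noteq> 0" by auto
    \<comment> \<open>The functional attained at \<open>y\<close> bounds the remainder from below,
      the one attained at \<open>z\<close> bounds it from above, and continuity of the maximiser
      makes the gap o(|z - y|).\<close>
    have "0 \<le> minkowski z - minkowski y - conormal (radial y) \<bullet> (z - y)"
      using conormal_inner_le_minkowski[OF radial_in_frontier[OF y] nz] conormal_radial_inner[OF y]
      by (simp add: inner_diff_right)
    moreover have "minkowski z - minkowski y - conormal (radial y) \<bullet> (z - y) \<le> (conormal (radial z) - conormal (radial y)) \<bullet> (z - y)"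
      using conormal_inner_le_minkowski[OF radial_in_frontier[OF nz] y] conormal_radial_inner[OF nz]
      by (simp add: inner_diff_right inner_diff_left)
    moreover have "\<dots> \<le> norm (conormal (radial z) - conormal (radial y)) * norm (z - y)"
      by (rule norm_cauchy_schwarz)
    moreover have "\<dots> \<le> e * norm (z - y)"
      using d(2)[of z] z by (intro mult_right_mono) (auto simp: dist_norm)
    ultimately show "norm (minkowski z - minkowski y - conormal (radial y) \<bullet> (z - y)) \<le> e * norm (z - y)"
      by simp
  qed
qed

lemma C1_map_on_minkowski: "C1_map_on (- {0}) minkowski"
proof (rule C1_map_onI[of _ _ "\<lambda>y h. conormal (radial y) \<bullet> h"])
  show "(minkowski has_derivative (\<lambda>h. conormal (radial y) \<bullet> h)) (at y)" if "y \<in> - {0}" for y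
    using that by (intro has_derivative_minkowski) simp
  show "continuous_on (- {0}) (\<lambda>y. conormal (radial y) \<bullet> v)" for v
    by (intro continuous_intros continuous_on_conormal_radial)
qed

lemma C1_map_on_radial: "C1_map_on (- {0}) radial"
  unfolding radial_def
  by (intro C1_map_on_add C1_map_on_const C1_map_on_scaleR C1_map_on_inverse C1_map_on_minkowski C1_map_on_ident)
    (rule less_imp_neq[symmetric], rule minkowski_pos, simp)

text \<open>The derivative is the oblique projection onto the tangent space along the ray: it kills
  c - x0 and fixes the vectors annihilated by \<open>conormal c\<close>.\<close>

lemma has_derivative_radial:
  assumes c: "c \<in> M"
  shows "(radial has_derivative (\<lambda>h. h - (conormal c \<bullet> h) *\<^sub>R (c - x0))) (at (c - x0))"
proof -
  have nz: "c - x0 \<noteq> 0"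
    using frontier_not_x0[OF c] by simp
  have 1: "minkowski (c - x0) = 1"
    by (rule minkowski_frontier[OF c])
  have "((\<lambda>y. inverse (minkowski y)) has_derivative
      (\<lambda>h. - (inverse (minkowski (c - x0)) * (conormal (radial (c - x0)) \<bullet> h) * inverse (minkowski (c - x0))))) (at (c - x0))"
    by (rule Deriv.has_derivative_inverse[OF _ has_derivative_minkowski[OF nz]]) (simp add: 1)
  then have "((\<lambda>y. inverse (minkowski y)) has_derivative (\<lambda>h. - (conormal c \<bullet> h))) (at (c - x0))"
    by (simp add: 1 radial_frontier[OF c])
  then have "((\<lambda>y. x0 + inverse (minkowski y) *\<^sub>R y) has_derivative
      (\<lambda>h. 0 + (inverse (minkowski (c - x0)) *\<^sub>R h + (- (conormal c \<bullet> h)) *\<^sub>R (c - x0)))) (at (c - x0))"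
    by (intro has_derivative_add has_derivative_const has_derivative_scaleR has_derivative_ident)
  then show ?thesis
    unfolding radial_def by (simp add: 1)
qed

end

section \<open>The degree of a compact perturbation of the identity\<close>

text \<open>The degree bound is uniform in \<open>x\<close> and the coefficients are continuous in
  \<open>x\<close>, so integration over a box leaves a polynomial in \<open>s\<close>. Coefficients
  vanish beyond \<open>n\<close> for every \<open>x\<close>, which lets products be computed by the
  convolution formula.\<close>

definition poly_family :: "'a::topological_space set \<Rightarrow> (real \<Rightarrow> 'a \<Rightarrow> real) \<Rightarrow> bool" where
  "poly_family B F \<longleftrightarrow>
     (\<exists>n c. (\<forall>k. continuous_on B (c k)) \<and> (\<forall>k>n. \<forall>x. c k x = 0) \<and>
            (\<forall>s. \<forall>x\<in>B. F s x = (\<Sum>k\<le>n. c k x * s ^ k)))"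

lemma poly_family_continuous:
  assumes "continuous_on B f"
  shows "poly_family B (\<lambda>s. f)"
proof -
  have "continuous_on B (\<lambda>x. if k = 0 then f x else 0)" for k :: nat
    using assms by (cases "k = 0") auto
  then show ?thesis
    unfolding poly_family_def
    by (intro exI[of _ 0] exI[of _ "\<lambda>k x. if k = 0 then f x else 0"]) auto
qed

lemma poly_family_param: "poly_family B (\<lambda>s x. s)"
proof -
  have "(\<Sum>k\<le>1::nat. (if k = 1 then 1 else 0) * s ^ k) = s" for s :: real
    by (simp add: numeral_eq_Suc atMost_Suc)
  then show ?thesis
    unfolding poly_family_def
    by (intro exI[of _ 1] exI[of _ "\<lambda>k x. if k = 1 then 1 else 0"]) (auto intro: continuous_on_const)
qed

lemma poly_family_add:
  assumes "poly_family B F" "poly_family B G"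
  shows "poly_family B (\<lambda>s x. F s x + G s x)"
proof -
  obtain n c where c: "\<And>k. continuous_on B (c k)" "\<And>k x. k > n \<Longrightarrow> c k x = 0"
    "\<And>s x. x \<in> B \<Longrightarrow> F s x = (\<Sum>k\<le>n. c k x * s ^ k)"
    using assms(1) unfolding poly_family_def by metis
  obtain m d where d: "\<And>k. continuous_on B (d k)" "\<And>k x. k > m \<Longrightarrow> d k x = 0"
    "\<And>s x. x \<in> B \<Longrightarrow> G s x = (\<Sum>k\<le>m. d k x * s ^ k)"
    using assms(2) unfolding poly_family_def by metis
  have c': "F s x = (\<Sum>k\<le>max n m. c k x * s ^ k)" if "x \<in> B" for s x
    unfolding c(3)[OF that] by (rule sum.mono_neutral_left) (auto simp: c(2))
  have d': "G s x = (\<Sum>k\<le>max n m. d k x * s ^ k)" if "x \<in> B" for s x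
    unfolding d(3)[OF that] by (rule sum.mono_neutral_left) (auto simp: d(2))
  show ?thesis
    unfolding poly_family_def
    by (intro exI[of _ "max n m"] exI[of _ "\<lambda>k x. c k x + d k x"])
      (auto intro!: continuous_intros simp: c(1,2) d(1,2) c' d' sum.distrib distrib_right)
qed

lemma poly_family_mult:
  assumes "poly_family B F" "poly_family B G"
  shows "poly_family B (\<lambda>s x. F s x * G s x)"
proof -
  obtain n c where c: "\<And>k. continuous_on B (c k)" "\<And>k x. k > n \<Longrightarrow> c k x = 0"
    "\<And>s x. x \<in> B \<Longrightarrow> F s x = (\<Sum>k\<le>n. c k x * s ^ k)"
    using assms(1) unfolding poly_family_def by metis
  obtain m d where d: "\<And>k. continuous_on B (d k)" "\<And>k x. k > m \<Longrightarrow> d k x = 0"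
    "\<And>s x. x \<in> B \<Longrightarrow> G s x = (\<Sum>k\<le>m. d k x * s ^ k)"
    using assms(2) unfolding poly_family_def by metis
  have eq: "F s x * G s x = (\<Sum>r\<le>n+m. (\<Sum>k\<le>r. c k x * d (r - k) x) * s ^ r)" if "x \<in> B" for s x
    unfolding c(3)[OF that] d(3)[OF that] by (rule polynomial_product) (auto simp: c d)
  have zero: "(\<Sum>k\<le>r. c k x * d (r - k) x) = 0" if "r > n + m" for r x
  proof (rule sum.neutral, safe)
    fix k
    show "c k x * d (r - k) x = 0"
      using that c(2)[of k x] d(2)[of "r - k" x] by (cases "k > n") auto
  qed
  show ?thesis
    unfolding poly_family_def
    by (intro exI[of _ "n + m"] exI[of _ "\<lambda>r x. \<Sum>k\<le>r. c k x * d (r - k) x"] conjI allI impI ballI)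
      (auto intro!: continuous_intros simp: c(1) d(1) eq zero)
qed

lemma poly_family_sum:
  assumes "finite I" "\<And>i. i \<in> I \<Longrightarrow> poly_family B (F i)"
  shows "poly_family B (\<lambda>s x. \<Sum>i\<in>I. F i s x)"
  using assms
  by (induction I rule: finite_induct) (auto intro: poly_family_add poly_family_continuous)

lemma poly_family_prod:
  assumes "finite I" "\<And>i. i \<in> I \<Longrightarrow> poly_family B (F i)"
  shows "poly_family B (\<lambda>s x. \<Prod>i\<in>I. F i s x)"
  using assms
  by (induction I rule: finite_induct) (auto intro: poly_family_mult poly_family_continuous)

lemma poly_family_det:
  fixes A :: "real \<Rightarrow> 'a::topological_space \<Rightarrow> real^'n^'n"
  assumes "\<And>i j. poly_family B (\<lambda>s x. A s x $ i $ j)"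
  shows "poly_family B (\<lambda>s x. det (A s x))"
  unfolding det_def
  by (intro poly_family_sum poly_family_mult poly_family_prod assms)
    (auto intro: poly_family_continuous)

lemma poly_family_real_polynomial_function:
  fixes \<psi> :: "'b::real_normed_vector \<Rightarrow> real"
  assumes "real_polynomial_function \<psi>" "continuous_on B g" "continuous_on B h"
  shows "poly_family B (\<lambda>s x. \<psi> (g x + s *\<^sub>R h x))"
  using assms(1)
proof (induction rule: real_polynomial_function.induct)
  case (linear f)
  then interpret bounded_linear f .
  have "poly_family B (\<lambda>s x. f (g x) + s * f (h x))"
    using assms(2,3)
    by (intro poly_family_add poly_family_mult poly_family_param poly_family_continuous continuous_on)
  then show ?case
    by (simp add: add scaleR)
qed (auto intro: poly_family_continuous poly_family_add poly_family_mult)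

lemma poly_family_integral:
  fixes a b :: "'a::euclidean_space"
  assumes "poly_family (cbox a b) F"
  obtains q where "\<And>s. integral (cbox a b) (F s) = poly q s"
proof -
  obtain n c where c: "\<And>k. continuous_on (cbox a b) (c k)"
    "\<And>s x. x \<in> cbox a b \<Longrightarrow> F s x = (\<Sum>k\<le>n. c k x * s ^ k)"
    using assms(1) unfolding poly_family_def by metis
  have "integral (cbox a b) (F s) = poly (\<Sum>k\<le>n. Polynomial.monom (integral (cbox a b) (c k)) k) s" for s
  proof -
    have "integral (cbox a b) (F s) = integral (cbox a b) (\<lambda>x. \<Sum>k\<le>n. c k x * s ^ k)"
      by (rule integral_cong) (simp add: c)
    also have "\<dots> = (\<Sum>k\<le>n. integral (cbox a b) (\<lambda>x. c k x * s ^ k))"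
      by (rule integral_sum) (auto intro!: integrable_continuous continuous_intros c)
    finally show ?thesis
      by (simp add: poly_sum Polynomial.poly_monom)
  qed
  then show thesis using that by blast
qed

lemma poly_const_on_interval:
  fixes q :: "real poly"
  assumes "0 < \<delta>" "\<And>s. 0 \<le> s \<Longrightarrow> s < \<delta> \<Longrightarrow> poly q s = c"
  shows "poly q t = c"
proof -
  have "infinite {0..<\<delta>}"
    using assms(1) by (simp add: infinite_Ico_iff)
  moreover have "{0..<\<delta>} \<subseteq> {x. poly (q - [:c:]) x = 0}"
    using assms(2) by auto
  ultimately have "q - [:c:] = 0"
    using poly_roots_finite finite_subset by blast
  then show ?thesis
    by (metis add.right_neutral eq_iff_diff_eq_0 mult_zero_right poly_0 poly_pCons)
qed

section \<open>Invariance of the integral under deformation\<close>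

text \<open>The detour through one-dimensional vectors fits the change of variables theorem for
  vector-valued integrands. Integrability is a conclusion of its own because each piece around a
  zero must be integrable before the pieces are added.\<close>

lemma integral_real_change_of_variables:
  fixes g :: "real^'n::{finite,wellorder} \<Rightarrow> real^'n::_" and \<psi> :: "real^'n::_ \<Rightarrow> real"
  assumes "compact S" "\<And>x. x \<in> S \<Longrightarrow> (g has_derivative g' x) (at x)"
    and "inj_on g S" "continuous_on (g ` S) \<psi>"
  shows "integral (g ` S) \<psi> = integral S (\<lambda>x. \<bar>det (matrix (g' x))\<bar> * \<psi> (g x))"
    and "(\<lambda>x. \<bar>det (matrix (g' x))\<bar> * \<psi> (g x)) absolutely_integrable_on S"
proof -
  let ?f = "\<lambda>y. vec (\<psi> y) :: real^1"
  have [simp]: "S \<in> sets lebesgue"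
    using assms(1) by (simp add: lmeasurable_compact fmeasurableD)
  have der: "\<And>x. x \<in> S \<Longrightarrow> (g has_derivative g' x) (at x within S)"
    using assms(2) has_derivative_at_withinI by blast
  have "compact (g ` S)"
    using assms(1) der has_derivative_continuous_on compact_continuous_image by blast
  moreover have contf: "continuous_on (g ` S) ?f"
    unfolding vec_def using assms(4) by (intro continuous_on_vec_lambda)
  ultimately have "integrable lborel (\<lambda>x. indicator (g ` S) x *\<^sub>R ?f x)"
    by (rule borel_integrable_compact)
  then have f: "?f absolutely_integrable_on (g ` S)"
    by (simp add: integrable_completion set_integrable_def)
  let ?D = "\<lambda>x. \<bar>det (matrix (g' x))\<bar> *\<^sub>R ?f (g x)"
  have D: "?D absolutely_integrable_on S"
    using absolutely_integrable_change_of_variables[OF _ der assms(3), where f = ?f] f by simp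
  have eq: "integral (g ` S) ?f = integral S ?D"
    using integral_change_of_variables[OF _ der assms(3), where f = ?f] f by simp
  have "integral (g ` S) \<psi> = integral (g ` S) (\<lambda>x. ?f x $ 1)"
    by simp
  also have "\<dots> = integral (g ` S) ?f $ 1"
    using f integral_component_eq_cart[of ?f "g ` S" 1]
    by (simp add: absolutely_integrable_on_def)
  also have "\<dots> = integral S (\<lambda>x. ?D x $ 1)"
    unfolding eq using D integral_component_eq_cart[of ?D "S" 1]
    by (simp add: absolutely_integrable_on_def)
  finally show "integral (g ` S) \<psi> = integral S (\<lambda>x. \<bar>det (matrix (g' x))\<bar> * \<psi> (g x))"
    by simp
  have "(\<lambda>x. ?D x \<bullet> axis 1 1) absolutely_integrable_on S"
    using absolutely_integrable_component[OF D] by simp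
  then show "(\<lambda>x. \<bar>det (matrix (g' x))\<bar> * \<psi> (g x)) absolutely_integrable_on S"
    by (simp add: inner_axis)
qed

text \<open>Along the path v + t f v the determinant starts at 1 and cannot vanish up to
  \<open>s\<close>, since a kernel vector would have norm at most s K times its own norm; the
  intermediate value theorem keeps it positive.\<close>

lemma det_id_plus_small_pos:
  fixes f :: "real^'n \<Rightarrow> real^'n"
  assumes "linear f" "\<And>v. norm (f v) \<le> K * norm v" "0 \<le> s" "s * K < 1"
  shows "0 < det (matrix (\<lambda>v. v + s *\<^sub>R f v))"
proof -
  have lin: "linear (\<lambda>v. v + t *\<^sub>R f v)" for t
    using assms(1) by (intro linear_compose_add linear_compose_scale_right linear_id[unfolded id_def])
  have nz: "det (matrix (\<lambda>v. v + t *\<^sub>R f v)) \<noteq> 0" if t: "0 \<le> t" "t \<le> s" for t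
  proof -
    have "v = 0" if "v + t *\<^sub>R f v = 0" for v
    proof (rule ccontr)
      assume "v \<noteq> 0"
      have "norm v = norm (t *\<^sub>R f v)"
        using that by (metis add_eq_0_iff norm_minus_cancel)
      also have "\<dots> \<le> t * (K * norm v)"
        using assms(2) t by (simp add: mult_left_mono)
      also have "\<dots> \<le> (s * K) * norm v"
      proof -
        have "0 \<le> K * norm v"
          using assms(2)[of v] norm_ge_zero order_trans by blast
        then show ?thesis
          using mult_right_mono[OF t(2)] by (simp add: mult.assoc)
      qed
      also have "\<dots> < norm v"
        using assms(4) \<open>v \<noteq> 0\<close> by simp
      finally show False by simp
    qed
    then show ?thesis
      using lin det_nz_iff_inj linear_injective_0 by blast
  qed
  have m: "matrix (\<lambda>v. v + t *\<^sub>R f v) = mat 1 + t *\<^sub>R matrix f" for t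
    by (simp add: matrix_def mat_def vec_eq_iff axis_def)
  have cont: "continuous_on {0..s} (\<lambda>t. det (matrix (\<lambda>v. v + t *\<^sub>R f v)))"
    unfolding m det_def by (auto intro!: continuous_intros)
  have one: "det (matrix (\<lambda>v. v + 0 *\<^sub>R f v)) = 1"
    unfolding m by simp
  show ?thesis
  proof (rule ccontr)
    assume "\<not> ?thesis"
    then have "\<exists>t\<ge>0. t \<le> s \<and> det (matrix (\<lambda>v. v + t *\<^sub>R f v)) = 0"
      by (intro IVT2' cont assms(3)) (use one in auto)
    then show False using nz by blast
  qed
qed

locale compact_perturbation =
  fixes W :: "real^'n::{finite,wellorder} \<Rightarrow> real^'n::_" and W' b
  assumes der: "\<And>x. (W has_derivative blinfun_apply (W' x)) (at x)"
    and contW': "continuous_on UNIV W'"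
    and supp: "\<And>x. x \<notin> cbox (- b) b \<Longrightarrow> W x = 0"
begin

lemma contW: "continuous_on S W"
  by (rule has_derivative_continuous_on) (rule has_derivative_at_withinI, rule der)

lemma W'_zero:
  assumes "x \<notin> cbox (- b) b"
  shows "W' x = 0"
proof -
  have "((\<lambda>x. 0) has_derivative blinfun_apply (W' x)) (at x)"
    by (rule has_derivative_transform_within_open[OF der, where s = "- cbox (- b) b"])
      (use assms supp in \<open>auto simp: closed_cbox open_Compl\<close>)
  then have "blinfun_apply (W' x) = (\<lambda>v. 0)"
    using has_derivative_const has_derivative_unique by blast
  then show ?thesis
    by (simp add: blinfun_eqI)
qed

lemma bounded_derivative:
  obtains K where "0 < K" "\<And>x. norm (W' x) \<le> K"
proof -
  have "compact (W' ` cbox (- b) b)"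
    by (intro compact_continuous_image compact_cbox continuous_on_subset[OF contW'] subset_UNIV)
  then have "bounded (W' ` cbox (- b) b)"
    by (rule compact_imp_bounded)
  then obtain K where "0 < K" "\<And>y. y \<in> W' ` cbox (- b) b \<Longrightarrow> norm y \<le> K"
    unfolding bounded_pos by blast
  then have "norm (W' x) \<le> K" for x
    by (cases "x \<in> cbox (- b) b") (auto simp: W'_zero)
  then show thesis using that \<open>0 < K\<close> by blast
qed

text \<open>For s K < 1 the map id + s W is injective by the Lipschitz bound and surjective by the
  contraction principle. Being the identity off the box, it maps the box onto itself; its
  determinant is positive, so change of variables applies without absolute values. The threshold
  \<delta> is independent of \<psi>.\<close>

lemma integral_small_perturbation:
  obtains \<delta> where "0 < \<delta>"
    "\<And>s \<psi>. \<lbrakk>0 \<le> s; s < \<delta>; continuous_on (cbox (- b) b) \<psi>\<rbrakk> \<Longrightarrow>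
       integral (cbox (- b) b) (\<lambda>x. det (matrix (\<lambda>v. v + s *\<^sub>R W' x v)) * \<psi> (x + s *\<^sub>R W x)) =
       integral (cbox (- b) b) \<psi>"
proof -
  obtain K where K: "0 < K" "\<And>x. norm (W' x) \<le> K"
    by (rule bounded_derivative) (rule that)
  have Wlip: "norm (W x - W y) \<le> K * norm (x - y)" for x y
    using differentiable_bound[of UNIV W "\<lambda>x. blinfun_apply (W' x)" K x y] der K(2)
    by (simp add: norm_blinfun.rep_eq)
  show thesis
  proof (rule that[of "1 / K"])
    show "0 < 1 / K" using K by simp
    fix s :: real and \<psi> :: "real^'n::_ \<Rightarrow> real"
    assume s: "0 \<le> s" "s < 1 / K" and \<psi>: "continuous_on (cbox (- b) b) \<psi>"
    have sK: "s * K < 1"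
      using s K(1) by (simp add: field_simps)
    define V where "V = (\<lambda>x. x + s *\<^sub>R W x)"
    have Voff: "V x = x" if "x \<notin> cbox (- b) b" for x
      using supp that by (simp add: V_def)
    have inj: "inj V"
    proof (rule injI, rule ccontr)
      fix x y assume "V x = V y" "x \<noteq> y"
      then have "x - y = s *\<^sub>R (W y - W x)"
        by (simp add: V_def algebra_simps)
      then have "norm (x - y) = s * norm (W y - W x)"
        using s by simp
      also have "\<dots> \<le> (s * K) * norm (x - y)"
        using mult_left_mono[OF Wlip[of y x] s(1)] by (simp add: norm_minus_commute mult.assoc)
      also have "\<dots> < norm (x - y)"
        using sK \<open>x \<noteq> y\<close> by simp
      finally show False by simp
    qed
    have surj: "\<exists>x. V x = y" for y
    proof -
      have "dist (y - s *\<^sub>R W u) (y - s *\<^sub>R W v) \<le> (s * K) * dist u v" for u v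
      proof -
        have "(y - s *\<^sub>R W u) - (y - s *\<^sub>R W v) = s *\<^sub>R (W v - W u)"
          by (simp add: scaleR_diff_right)
        then have "dist (y - s *\<^sub>R W u) (y - s *\<^sub>R W v) = s * norm (W v - W u)"
          using s(1) by (simp add: dist_norm)
        also have "\<dots> \<le> s * (K * norm (v - u))"
          using mult_left_mono[OF Wlip s(1)] .
        finally show ?thesis by (simp add: dist_norm mult.assoc norm_minus_commute)
      qed
      moreover have "0 \<le> s * K" using s(1) K(1) by simp
      ultimately have "\<exists>!x. y - s *\<^sub>R W x = x"
        using sK by (intro banach_fix_type[of "s * K"]) auto
      then obtain x where "y - s *\<^sub>R W x = x" by blast
      then have "V x = y" by (simp add: V_def algebra_simps)
      then show ?thesis by blast
    qed
    \<comment> \<open>If \<open>V x\<close> lay outside the box, \<open>V\<close> would fix it; then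
      injectivity applied to V (V x) = V x gives V x = x, which is in the box.\<close>
    have "V x \<in> cbox (- b) b" if "x \<in> cbox (- b) b" for x
      using Voff[of "V x"] inj that by (metis injD)
    moreover have "y \<in> V ` cbox (- b) b" if "y \<in> cbox (- b) b" for y
    proof -
      obtain x where x: "V x = y" using surj by blast
      then have "x \<in> cbox (- b) b" using Voff[of x] that by metis
      then show ?thesis using x by (metis imageI)
    qed
    ultimately have img: "V ` cbox (- b) b = cbox (- b) b"
      by (intro subset_antisym image_subsetI subsetI)
    have "(V has_derivative (\<lambda>v. v + s *\<^sub>R W' x v)) (at x)" for x
      unfolding V_def by (intro derivative_intros der)
    moreover have "inj_on V (cbox (- b) b)"
      using inj by (rule inj_on_subset) simp
    ultimately have "integral (cbox (- b) b) \<psi> =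
        integral (cbox (- b) b) (\<lambda>x. \<bar>det (matrix (\<lambda>v. v + s *\<^sub>R W' x v))\<bar> * \<psi> (V x))"
      using integral_real_change_of_variables(1)[where S = "cbox (- b) b" and g = V and \<psi> = \<psi>
          and g' = "\<lambda>x v. v + s *\<^sub>R W' x v"] \<psi>
      by (simp add: img)
    also have "\<dots> = integral (cbox (- b) b) (\<lambda>x. det (matrix (\<lambda>v. v + s *\<^sub>R W' x v)) * \<psi> (x + s *\<^sub>R W x))"
    proof -
      have "0 < det (matrix (\<lambda>v. v + s *\<^sub>R W' x v))" for x
      proof (rule det_id_plus_small_pos)
        show "norm (W' x v) \<le> K * norm v" for v
          using norm_blinfun[of "W' x" v] mult_right_mono[OF K(2)[of x] norm_ge_zero[of v]]
          by (rule order_trans)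
        show "linear (blinfun_apply (W' x))"
          by (rule bounded_linear.linear[OF blinfun.bounded_linear_right])
      qed (rule s(1), rule sK)
      then have "\<bar>det (matrix (\<lambda>v. v + s *\<^sub>R W' x v))\<bar> = det (matrix (\<lambda>v. v + s *\<^sub>R W' x v))" for x
        by (rule abs_of_pos)
      then show ?thesis unfolding V_def by (simp only:)
    qed
    finally show "integral (cbox (- b) b) (\<lambda>x. det (matrix (\<lambda>v. v + s *\<^sub>R W' x v)) * \<psi> (x + s *\<^sub>R W x)) =
       integral (cbox (- b) b) \<psi>" by (rule sym)
  qed
qed

lemma matrix_entry:
  "matrix (\<lambda>v. v + s *\<^sub>R W' x v) $ i $ j = axis j 1 $ i + s * (W' x (axis j 1) $ i)"
  by (simp add: matrix_def)

lemma continuous_entry: "continuous_on S (\<lambda>x. W' x (axis j 1) $ i)"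
proof -
  have "continuous_on S W'"
    using contW' continuous_on_subset by blast
  then show ?thesis
    by (intro continuous_on_component blinfun.continuous_on continuous_on_const)
qed

lemma continuous_det_matrix: "continuous_on S (\<lambda>x. det (matrix (\<lambda>v. v + s *\<^sub>R W' x v)))"
  unfolding det_def matrix_entry
  by (intro continuous_on_sum continuous_on_mult continuous_on_prod continuous_on_add
      continuous_on_const continuous_entry)

lemma integral_polynomial:
  assumes "real_polynomial_function \<psi>"
  shows "integral (cbox (- b) b) (\<lambda>x. det (matrix (\<lambda>v. v + W' x v)) * \<psi> (x + W x)) =
         integral (cbox (- b) b) \<psi>"
proof -
  have "poly_family (cbox (- b) b) (\<lambda>s x. (matrix (\<lambda>v. v + s *\<^sub>R W' x v)) $ i $ j)" for i j
    unfolding matrix_entry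
    by (intro poly_family_add poly_family_mult poly_family_param
        poly_family_continuous[OF continuous_entry] poly_family_continuous[OF continuous_on_const])
  then have "poly_family (cbox (- b) b)
      (\<lambda>s x. det (matrix (\<lambda>v. v + s *\<^sub>R W' x v)) * \<psi> (x + s *\<^sub>R W x))"
    by (intro poly_family_mult poly_family_det poly_family_real_polynomial_function assms contW continuous_on_id)
  then obtain q where q: "\<And>s. integral (cbox (- b) b)
      (\<lambda>x. det (matrix (\<lambda>v. v + s *\<^sub>R W' x v)) * \<psi> (x + s *\<^sub>R W x)) = poly q s"
    using poly_family_integral by blast
  obtain \<delta> where "0 < \<delta>" and \<delta>: "\<And>s \<psi>. \<lbrakk>0 \<le> s; s < \<delta>; continuous_on (cbox (- b) b) \<psi>\<rbrakk> \<Longrightarrow>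
       integral (cbox (- b) b) (\<lambda>x. det (matrix (\<lambda>v. v + s *\<^sub>R W' x v)) * \<psi> (x + s *\<^sub>R W x)) =
       integral (cbox (- b) b) \<psi>"
    by (rule integral_small_perturbation) (rule that)
  have "continuous_on (cbox (- b) b) \<psi>"
    using assms continuous_on_polymonial_function real_polynomial_function_eq by blast
  then have "poly q s = integral (cbox (- b) b) \<psi>" if "0 \<le> s" "s < \<delta>" for s
    unfolding q[symmetric] by (rule \<delta>[OF that])
  then have "poly q 1 = integral (cbox (- b) b) \<psi>"
    by (rule poly_const_on_interval[OF \<open>0 < \<delta>\<close>])
  then show ?thesis
    using q[of 1] by simp
qed

lemma integral_continuous:
  fixes \<psi> :: "real^'n::_ \<Rightarrow> real"
  assumes \<psi>: "continuous_on UNIV \<psi>"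
  shows "integral (cbox (- b) b) (\<lambda>x. det (matrix (\<lambda>v. v + W' x v)) * \<psi> (x + W x)) =
         integral (cbox (- b) b) \<psi>"
proof (rule ccontr)
  let ?B = "cbox (- b) b" and ?D = "\<lambda>x. det (matrix (\<lambda>v. v + W' x v))"
  let ?I = "integral ?B (\<lambda>x. ?D x * \<psi> (x + W x)) - integral ?B \<psi>"
  assume neq: "\<not> ?thesis"
  have contD: "continuous_on ?B ?D"
    using continuous_det_matrix[of ?B 1] by simp
  have contV: "continuous_on ?B (\<lambda>x. x + W x)"
    by (intro continuous_intros contW)
  \<comment> \<open>\<psi> is evaluated at points of the box and at their images, so the polynomial
    approximation must hold on both sets.\<close>
  define S where "S = ?B \<union> (\<lambda>x. x + W x) ` ?B"
  have "compact S"
    unfolding S_def by (intro compact_Un compact_cbox compact_continuous_image contV)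
  define J where "J = integral ?B (\<lambda>x. \<bar>?D x\<bar> + 1)"
  have intD: "(\<lambda>x. \<bar>?D x\<bar> + 1) integrable_on ?B"
    by (intro integrable_continuous continuous_intros contD)
  have "0 \<le> J"
    unfolding J_def by (intro integral_nonneg intD) simp
  \<comment> \<open>Replacing \<psi> by a polynomial changes the difference \<open>?I\<close> by at
    most \<epsilon> J, and for polynomials the difference is zero. This choice of \<epsilon> makes
    \<epsilon> J smaller than |?I|.\<close>
  define \<epsilon> where "\<epsilon> = \<bar>?I\<bar> / (J + 1)"
  have "0 < \<epsilon>"
    using neq \<open>0 \<le> J\<close> by (simp add: \<epsilon>_def)
  obtain p where p: "real_polynomial_function p" "\<And>x. x \<in> S \<Longrightarrow> \<bar>\<psi> x - p x\<bar> < \<epsilon>"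
  proof (rule Stone_Weierstrass_real_polynomial_function[OF \<open>compact S\<close> _ \<open>0 < \<epsilon>\<close>])
    show "continuous_on S \<psi>"
      using \<psi> continuous_on_subset by blast
  qed blast
  have contp: "continuous_on T p" for T
    using p(1) continuous_on_polymonial_function real_polynomial_function_eq by blast
  have cont\<psi>V: "continuous_on ?B (\<lambda>x. \<psi> (x + W x))"
    using continuous_on_compose2[OF \<psi> contV] by simp
  have contpV: "continuous_on ?B (\<lambda>x. p (x + W x))"
    using continuous_on_compose2[OF contp contV, of UNIV] by simp
  have cont\<psi>: "continuous_on ?B \<psi>"
    using \<psi> continuous_on_subset by blast
  note ints = integrable_continuous[OF continuous_on_mult[OF contD cont\<psi>V]]
    integrable_continuous[OF continuous_on_mult[OF contD contpV]]
    integrable_continuous[OF cont\<psi>] integrable_continuous[OF contp]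
  have "?I = integral ?B (\<lambda>x. ?D x * \<psi> (x + W x)) - integral ?B \<psi>
      - (integral ?B (\<lambda>x. ?D x * p (x + W x)) - integral ?B p)"
    using integral_polynomial[OF p(1)] by simp
  also have "\<dots> = integral ?B (\<lambda>x. (?D x * \<psi> (x + W x) - \<psi> x) - (?D x * p (x + W x) - p x))"
    using ints by (simp add: integral_diff integrable_diff)
  also have "\<dots> = integral ?B (\<lambda>x. ?D x * (\<psi> (x + W x) - p (x + W x)) - (\<psi> x - p x))"
    by (simp add: algebra_simps)
  finally have "\<bar>?I\<bar> = norm (integral ?B (\<lambda>x. ?D x * (\<psi> (x + W x) - p (x + W x)) - (\<psi> x - p x)))"
    by simp
  also have "\<dots> \<le> integral ?B (\<lambda>x. \<epsilon> * (\<bar>?D x\<bar> + 1))"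
  proof (rule integral_norm_bound_integral)
    show "(\<lambda>x. ?D x * (\<psi> (x + W x) - p (x + W x)) - (\<psi> x - p x)) integrable_on ?B"
      by (intro integrable_continuous continuous_intros contD contpV cont\<psi>V contp cont\<psi>)
    show "(\<lambda>x. \<epsilon> * (\<bar>?D x\<bar> + 1)) integrable_on ?B"
      by (intro integrable_continuous continuous_intros contD)
    fix x assume "x \<in> ?B"
    then have "\<bar>\<psi> (x + W x) - p (x + W x)\<bar> \<le> \<epsilon>" "\<bar>\<psi> x - p x\<bar> \<le> \<epsilon>"
      using p(2)[of x] p(2)[of "x + W x"] by (auto simp: S_def intro: less_imp_le)
    then have "\<bar>?D x * (\<psi> (x + W x) - p (x + W x))\<bar> + \<bar>\<psi> x - p x\<bar> \<le> \<bar>?D x\<bar> * \<epsilon> + \<epsilon>"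
      unfolding abs_mult by (intro add_mono mult_left_mono) auto
    then show "norm (?D x * (\<psi> (x + W x) - p (x + W x)) - (\<psi> x - p x)) \<le> \<epsilon> * (\<bar>?D x\<bar> + 1)"
      using abs_triangle_ineq4[of "?D x * (\<psi> (x + W x) - p (x + W x))" "\<psi> x - p x"]
      by (simp add: algebra_simps)
  qed
  also have "\<dots> = \<epsilon> * J"
    by (simp add: J_def)
  also have "\<dots> < \<epsilon> * (J + 1)"
    using \<open>0 < \<epsilon>\<close> by simp
  also have "\<dots> = \<bar>?I\<bar>"
    using \<open>0 \<le> J\<close> by (simp add: \<epsilon>_def)
  finally show False by simp
qed

end

section \<open>Counting zeros with signs\<close>

lemma continuous_on_det_matrix_blinfun:
  fixes V' :: "'b::topological_space \<Rightarrow> ((real^'n) \<Rightarrow>\<^sub>L (real^'n))"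
  assumes "continuous_on S V'"
  shows "continuous_on S (\<lambda>x. det (matrix (V' x)))"
proof -
  have "continuous_on S (\<lambda>x. matrix (V' x) $ i $ j)" for i j
    unfolding matrix_def vec_lambda_beta
    by (intro continuous_on_component blinfun.continuous_on continuous_on_const assms)
  then show ?thesis
    unfolding det_def by (intro continuous_on_sum continuous_on_mult continuous_on_prod continuous_on_const)
qed

text \<open>The inverse function theorem is applied inside the open set where the determinant has
  the same sign as at \<open>z\<close>, so that the sign can later be pulled out of an integral over
  the neighbourhood.\<close>

lemma local_inverse_constant_sign:
  fixes V :: "real^'n \<Rightarrow> real^'n" and V' :: "real^'n \<Rightarrow> ((real^'n) \<Rightarrow>\<^sub>L (real^'n))"
  assumes der: "\<And>x. (V has_derivative V' x) (at x)" and cont: "continuous_on UNIV V'"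
    and z: "V z = 0" "det (matrix (V' z)) \<noteq> 0" and Q: "open Q" "z \<in> Q"
  obtains U Y g where "open U" "U \<subseteq> Q" "z \<in> U" "open Y" "0 \<in> Y" "homeomorphism U Y V g"
    "\<And>x. x \<in> U \<Longrightarrow> sgn (det (matrix (V' x))) = sgn (det (matrix (V' z)))"
proof -
  define D where "D = (\<lambda>x. det (matrix (V' x)))"
  have contD: "continuous_on UNIV D"
    unfolding D_def using cont by (rule continuous_on_det_matrix_blinfun)
  define P where "P = Q \<inter> {x. D x * D z > 0}"
  have "open P"
    unfolding P_def by (intro open_Int Q open_Collect_less continuous_on_mult contD continuous_on_const)
  have "z \<in> P"
    using z(2) Q(2) by (auto simp: P_def D_def zero_less_mult_iff)
  have linV: "linear (V' z)"
    by (rule bounded_linear.linear[OF blinfun.bounded_linear_right])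
  have "inj (V' z)"
    using z(2) det_nz_iff_inj[OF linV] by simp
  then obtain h where h: "linear h" "h \<circ> V' z = id"
    using linear_injective_left_inverse[OF linV \<open>inj (V' z)\<close>] by blast
  have "Blinfun h o\<^sub>L V' z = id_blinfun"
  proof (rule blinfun_eqI)
    fix v
    show "(Blinfun h o\<^sub>L V' z) v = id_blinfun v"
      using h(2) bounded_linear_Blinfun_apply[of h] linear_conv_bounded_linear[of h] h(1)
      by (simp add: fun_eq_iff)
  qed
  then obtain U Y g g' where U: "open U" "U \<subseteq> P" "z \<in> U" "open Y" "V z \<in> Y" "homeomorphism U Y V g"
    by (rule inverse_function_theorem[OF \<open>open P\<close> der continuous_on_subset[OF cont subset_UNIV] \<open>z \<in> P\<close>])
      (rule that)
  show thesis
  proof (rule that[of U Y g])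
    show "sgn (det (matrix (V' x))) = sgn (det (matrix (V' z)))" if "x \<in> U" for x
      using that U(2) by (auto simp: P_def D_def zero_less_mult_iff)
  qed (use U z(1) in \<open>auto simp: P_def\<close>)
qed

text \<open>The zeros form a compact set because \<open>V\<close> is the identity near infinity, and
  local inverses isolate them; finitely many isolating neighbourhoods cover the set.\<close>

lemma finite_zeros:
  fixes V :: "real^'n \<Rightarrow> real^'n" and V' :: "real^'n \<Rightarrow> ((real^'n) \<Rightarrow>\<^sub>L (real^'n))"
  assumes der: "\<And>x. (V has_derivative V' x) (at x)" and cont: "continuous_on UNIV V'"
    and off: "\<And>x. R < norm x \<Longrightarrow> V x = x"
    and nz: "\<And>x. V x = 0 \<Longrightarrow> det (matrix (V' x)) \<noteq> 0"
  shows "finite {x. V x = 0}"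
proof -
  let ?Z = "{x. V x = 0}"
  have contV: "continuous_on UNIV V"
    by (rule has_derivative_continuous_on) (rule has_derivative_at_withinI, rule der)
  have "norm x \<le> \<bar>R\<bar>" if "V x = 0" for x
    using off[of x] that by (cases "x = 0") force+
  then have "bounded ?Z"
    unfolding bounded_iff by auto
  moreover have "closed ?Z"
    by (rule closed_Collect_eq[OF contV continuous_on_const])
  ultimately have "compact ?Z"
    by (simp add: compact_eq_bounded_closed)
  have "\<exists>U. open U \<and> z \<in> U \<and> U \<inter> ?Z = {z}" if z: "z \<in> ?Z" for z
  proof -
    obtain U Y g where U: "open U" "z \<in> U" "homeomorphism U Y V g"
    proof -
      have "V z = 0" using z by simp
      from local_inverse_constant_sign[OF der cont this nz[OF this] open_UNIV UNIV_I] that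
      show thesis by metis
    qed
    then have "x = z" if "x \<in> U" "V x = 0" for x
      using that z unfolding homeomorphism_def by (metis mem_Collect_eq)
    then show ?thesis using U z by blast
  qed
  then obtain U where U: "\<And>z. z \<in> ?Z \<Longrightarrow> open (U z) \<and> z \<in> U z \<and> U z \<inter> ?Z = {z}"
    by metis
  obtain C where C: "C \<subseteq> ?Z" "finite C" "?Z \<subseteq> (\<Union>c\<in>C. U c)"
  proof (rule compactE_image[OF \<open>compact ?Z\<close>, of ?Z U])
    show "open (U z)" if "z \<in> ?Z" for z
      using U[OF that] by (elim conjE)
    show "?Z \<subseteq> \<Union> (U ` ?Z)"
    proof
      fix z assume "z \<in> ?Z"
      then show "z \<in> \<Union> (U ` ?Z)"
        using U[of z] by (intro UN_I[of z]) simp_all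
    qed
  qed (rule that)
  have "?Z \<subseteq> C"
  proof
    fix z assume z: "z \<in> ?Z"
    then obtain c where c: "c \<in> C" "z \<in> U c"
      using C(3) by blast
    then have "z \<in> U c \<inter> ?Z" "U c \<inter> ?Z = {c}"
      using z U[of c] C(1) by auto
    then have "z = c" by simp
    then show "z \<in> C" using c(1) by simp
  qed
  then show ?thesis
    using C(2) finite_subset by blast
qed

lemma disjoint_neighbourhoods:
  fixes Z :: "'a::metric_space set"
  assumes "finite Z"
  obtains Q where "\<And>z. z \<in> Z \<Longrightarrow> open (Q z) \<and> z \<in> Q z"
    "\<And>z w. \<lbrakk>z \<in> Z; w \<in> Z; z \<noteq> w\<rbrakk> \<Longrightarrow> Q z \<inter> Q w = {}"
proof -
  have "\<exists>d>0. \<forall>x\<in>Z. x \<noteq> z \<longrightarrow> d \<le> dist z x" for z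
    using finite_set_avoid[OF assms] .
  then have "\<forall>z. \<exists>d>0. \<forall>x\<in>Z. x \<noteq> z \<longrightarrow> d \<le> dist z x"
    by (rule allI)
  from choice[OF this]
  obtain d where d: "\<And>z. 0 < d z" "\<And>z x. x \<in> Z \<Longrightarrow> x \<noteq> z \<Longrightarrow> d z \<le> dist z x"
    by auto
  show thesis
  proof (rule that[of "\<lambda>z. ball z (d z / 2)"])
    fix z w assume zw: "z \<in> Z" "w \<in> Z" "z \<noteq> w"
    have False if "dist z x < d z / 2" "dist w x < d w / 2" for x
      using that d(2)[of w z] d(2)[of z w] zw dist_triangle2[of z w x] by (simp add: dist_commute)
    then show "ball z (d z / 2) \<inter> ball w (d w / 2) = {}"
      by auto
  qed (use d in auto)
qed

text \<open>With \<psi> concentrated near 0, the integral of det(V') \<psi>(V) over a large box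
  splits into one piece per zero, each equal to the sign there times the integral \<open>c\<close>
  of \<psi>. Invariance under deformation to the identity says that the total is
  \<open>c\<close>.\<close>

theorem sum_signs_of_zeros_cart:
  fixes V :: "real^'n::{finite,wellorder} \<Rightarrow> real^'n::_" and V' :: "real^'n::_ \<Rightarrow> ((real^'n::_) \<Rightarrow>\<^sub>L (real^'n::_))"
  assumes der: "\<And>x. (V has_derivative V' x) (at x)" and cont: "continuous_on UNIV V'"
    and off: "\<And>x. R < norm x \<Longrightarrow> V x = x"
    and nz: "\<And>x. V x = 0 \<Longrightarrow> det (matrix (V' x)) \<noteq> 0"
  shows "(\<Sum>x | V x = 0. sgn (det (matrix (V' x)))) = 1"
proof -
  define Z where "Z = {x. V x = 0}"
  have "finite Z"
    unfolding Z_def using der cont off nz by (rule finite_zeros)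
  have contV: "continuous_on S V" for S
    by (rule has_derivative_continuous_on) (rule has_derivative_at_withinI, rule der)
  obtain Q where Q: "\<And>z. z \<in> Z \<Longrightarrow> open (Q z) \<and> z \<in> Q z"
    and disjQ: "\<And>z w. \<lbrakk>z \<in> Z; w \<in> Z; z \<noteq> w\<rbrakk> \<Longrightarrow> Q z \<inter> Q w = {}"
    using disjoint_neighbourhoods[OF \<open>finite Z\<close>] by metis
  have "\<exists>U Y g. open U \<and> U \<subseteq> Q z \<and> z \<in> U \<and> open Y \<and> 0 \<in> Y \<and> homeomorphism U Y V g \<and>
          (\<forall>x\<in>U. sgn (det (matrix (V' x))) = sgn (det (matrix (V' z))))" if "z \<in> Z" for z
  proof -
    have "V z = 0" using that by (simp add: Z_def)
    from local_inverse_constant_sign[OF der cont this nz[OF this], of "Q z"] Q[OF that]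
    show ?thesis by metis
  qed
  then obtain U Y g where UYg: "\<And>z. z \<in> Z \<Longrightarrow> open (U z) \<and> U z \<subseteq> Q z \<and> z \<in> U z \<and> open (Y z) \<and> 0 \<in> Y z \<and>
       homeomorphism (U z) (Y z) V (g z) \<and>
       (\<forall>x\<in>U z. sgn (det (matrix (V' x))) = sgn (det (matrix (V' z))))"
    by metis
  define r where "r = max R 0 + 1"
  have off': "V x = x" if "r \<le> norm x" for x
    using off that by (auto simp: r_def)
  obtain b :: "real^'n::_" where b: "cball 0 r \<subseteq> cbox (- b) b"
    using bounded_subset_cbox_symmetric[OF bounded_cball] by metis
  let ?B = "cbox (- b) b"
  define K where "K = cball 0 r - (\<Union>z\<in>Z. U z)"
  have "compact K"
    unfolding K_def using UYg by (intro compact_diff compact_cball open_UN) auto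
  have Vnz: "V x \<noteq> 0" if "x \<in> K" for x
    using that UYg by (auto simp: K_def Z_def)
  obtain e0 where e0: "0 < e0" "\<And>x. x \<in> K \<Longrightarrow> e0 \<le> norm (V x)"
  proof (cases "K = {}")
    case False
    then obtain x where "x \<in> K" "\<And>y. y \<in> K \<Longrightarrow> norm (V x) \<le> norm (V y)"
      using continuous_attains_inf[OF \<open>compact K\<close> _ continuous_on_norm[OF contV]] by metis
    then show thesis
      using that[of "norm (V x)"] Vnz by simp
  qed (use that[of 1] in auto)
  have "open (\<Inter>z\<in>Z. Y z)"
    using UYg \<open>finite Z\<close> by (intro open_INT) auto
  moreover have "0 \<in> (\<Inter>z\<in>Z. Y z)"
    using UYg by auto
  ultimately obtain e1 where e1: "0 < e1" "cball 0 e1 \<subseteq> (\<Inter>z\<in>Z. Y z)"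
    using open_contains_cball by metis
  \<comment> \<open>Below \<open>e0\<close>, values of this size occur in the large ball only in the
    neighbourhoods of zeros; below \<open>e1\<close>, every local inverse is defined on the ball of
    radius \<open>e\<close>; below 1, they do not occur at norm at least \<open>r\<close>, where V x
    = x and r \<ge> 1.\<close>
  define e where "e = min (min e0 e1) 1 / 2"
  have e: "0 < e" "e < e0" "e < e1" "e < 1"
    using e0 e1 by (auto simp: e_def)
  have eY: "cball 0 e \<subseteq> Y z" if "z \<in> Z" for z
    using e1(2) e(3) that by (force simp: subset_iff)
  \<comment> \<open>A cone-shaped bump: it is continuous, which is what
    \<open>integral_continuous\<close> asks for, and it vanishes outside the ball of radius
    \<open>e\<close>, which confines \<open>h\<close> to the sets \<open>S z\<close>.\<close>
  define \<psi> where "\<psi> = (\<lambda>y::real^'n::_. max 0 (e - norm y))"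
  have cont\<psi>: "continuous_on S \<psi>" for S
    unfolding \<psi>_def by (intro continuous_intros)
  define S where "S = (\<lambda>z. g z ` cball 0 e)"
  have VS: "V ` S z = cball 0 e" "inj_on V (S z)" "compact (S z)" "S z \<subseteq> U z" if "z \<in> Z" for z
  proof -
    have hom: "homeomorphism (U z) (Y z) V (g z)"
      using UYg[OF that] by blast
    have Vg: "V (g z y) = y" "g z y \<in> U z" if "y \<in> cball 0 e" for y
    proof -
      have "y \<in> Y z" using eY[OF \<open>z \<in> Z\<close>] that by (rule subsetD)
      then show "V (g z y) = y" "g z y \<in> U z"
        using hom unfolding homeomorphism_def by auto
    qed
    show "V ` S z = cball 0 e"
      using Vg by (force simp: S_def image_image)
    show "S z \<subseteq> U z"
      using Vg by (auto simp: S_def)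
    show "inj_on V (S z)"
      using Vg by (auto simp: S_def inj_on_def)
    show "compact (S z)"
      unfolding S_def using hom eY[OF that]
      by (intro compact_continuous_image compact_cball)
        (auto simp: homeomorphism_def intro: continuous_on_subset)
  qed
  define h where "h = (\<lambda>x. det (matrix (V' x)) * \<psi> (V x))"
  have h0: "h x = 0" if "x \<notin> (\<Union>z\<in>Z. S z)" for x
  proof -
    have "e \<le> norm (V x)"
    proof (rule ccontr)
      assume *: "\<not> e \<le> norm (V x)"
      have "norm x \<le> r"
        using * off'[of x] e(4) by (cases "r \<le> norm x") (auto simp: r_def)
      then have "x \<in> (\<Union>z\<in>Z. U z)"
        using e0(2)[of x] * e by (auto simp: K_def)
      then obtain z where z: "z \<in> Z" "x \<in> U z" by blast
      then have "x = g z (V x)"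
        using UYg[OF z(1)] unfolding homeomorphism_def by metis
      then have "x \<in> S z"
        using * unfolding S_def by (intro image_eqI[of _ _ "V x"]) auto
      then show False using that z(1) by blast
    qed
    then show ?thesis by (simp add: h_def \<psi>_def)
  qed
  have SB: "(\<Union>z\<in>Z. S z) \<subseteq> ?B"
  proof
    fix x assume "x \<in> (\<Union>z\<in>Z. S z)"
    then have "norm (V x) \<le> e"
      using VS(1) by fastforce
    then have "norm x \<le> r"
      using off'[of x] e by (cases "r \<le> norm x") (auto simp: r_def)
    then show "x \<in> ?B" using b by auto
  qed
  define c where "c = integral (cball 0 e) \<psi>"
  have piece: "(h has_integral (sgn (det (matrix (V' z))) * c)) (S z)" if z: "z \<in> Z" for z
  proof -
    let ?k = "\<lambda>x. \<bar>det (matrix (V' x))\<bar> * \<psi> (V x)"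
    have "integral (V ` S z) \<psi> = integral (S z) ?k"
      by (rule integral_real_change_of_variables(1)[OF VS(3)[OF z] der VS(2)[OF z] cont\<psi>])
    moreover have "?k integrable_on S z"
      using integral_real_change_of_variables(2)[OF VS(3)[OF z] der VS(2)[OF z] cont\<psi>]
      by (simp add: absolutely_integrable_on_def)
    ultimately have "(?k has_integral c) (S z)"
      by (simp add: c_def VS(1)[OF z] has_integral_iff)
    then have "((\<lambda>x. sgn (det (matrix (V' z))) * ?k x) has_integral (sgn (det (matrix (V' z))) * c)) (S z)"
      by (rule has_integral_mult_right)
    moreover have "sgn (det (matrix (V' z))) * ?k x = h x" if "x \<in> S z" for x
    proof -
      have "sgn (det (matrix (V' x))) = sgn (det (matrix (V' z)))"
        using UYg[OF z] VS(4)[OF z] that by blast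
      then have "sgn (det (matrix (V' z))) * \<bar>det (matrix (V' x))\<bar> = det (matrix (V' x))"
        by (metis mult.commute abs_mult_sgn)
      then show ?thesis
        unfolding h_def by (metis mult.assoc)
    qed
    ultimately show ?thesis
      by (rule has_integral_eq[rotated])
  qed
  have "(h has_integral (\<Sum>z\<in>Z. sgn (det (matrix (V' z))) * c)) (\<Union>z\<in>Z. S z)"
  proof (rule has_integral_UN[OF \<open>finite Z\<close> piece])
    have "S z \<inter> S w = {}" if "z \<in> Z" "w \<in> Z" "z \<noteq> w" for z w
      using disjQ[OF that] VS(4)[OF that(1)] VS(4)[OF that(2)] UYg[OF that(1)] UYg[OF that(2)] by blast
    then show "pairwise (\<lambda>z w. negligible (S z \<inter> S w)) Z"
      by (simp add: pairwise_def)
  qed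
  then have "(h has_integral (\<Sum>z\<in>Z. sgn (det (matrix (V' z))) * c)) ?B"
    by (rule has_integral_on_superset[OF _ h0 SB])
  then have 1: "integral ?B h = (\<Sum>z\<in>Z. sgn (det (matrix (V' z)))) * c"
    by (simp add: integral_unique sum_distrib_right)
  interpret compact_perturbation "\<lambda>x. V x - x" "\<lambda>x. V' x - id_blinfun" b
  proof
    show "((\<lambda>x. V x - x) has_derivative blinfun_apply (V' x - id_blinfun)) (at x)" for x
      by (rule has_derivative_eq_rhs[OF has_derivative_diff[OF der has_derivative_ident]])
        (auto simp: blinfun.diff_left)
    show "V x - x = 0" if "x \<notin> ?B" for x
    proof -
      have "x \<notin> cball 0 r" using b that by blast
      then show ?thesis using off'[of x] by simp
    qed
  qed (intro continuous_intros cont)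
  have 2: "integral ?B h = integral ?B \<psi>"
    using integral_continuous[OF cont\<psi>] by (simp add: h_def blinfun.diff_left)
  have eB: "cball 0 e \<subseteq> ?B"
    using b e by (force simp: r_def subset_iff)
  have int\<psi>: "(\<psi> has_integral c) (cball 0 e)"
  proof -
    have "integrable lborel (\<lambda>x. indicator (cball 0 e) x *\<^sub>R \<psi> x)"
      by (rule borel_integrable_compact[OF compact_cball cont\<psi>])
    then have "\<psi> absolutely_integrable_on cball 0 e"
      by (simp add: integrable_completion set_integrable_def)
    then show ?thesis
      by (simp add: c_def absolutely_integrable_on_def has_integral_iff)
  qed
  have B: "(\<psi> has_integral c) ?B"
    by (rule has_integral_on_superset[OF int\<psi> _ eB]) (simp add: \<psi>_def)
  have "c \<noteq> 0"
  proof
    assume "c = 0"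
    have "0 \<in> interior ?B"
      using eB e(1) interior_maximal[of "ball 0 e" ?B] by force
    then have "box (- b) b \<noteq> {}"
      by (metis empty_iff interior_cbox)
    then have ne: "box (- b) b \<noteq> {}" .
    have "(\<psi> has_integral 0) ?B"
      using B \<open>c = 0\<close> by simp
    moreover have "0 \<le> \<psi> x" for x
      by (simp add: \<psi>_def)
    moreover have "0 \<in> ?B"
      using eB e(1) by force
    ultimately have "\<psi> 0 = 0"
      by (intro has_integral_0_cbox_imp_0[OF cont\<psi> _ _ ne])
    then show False using e(1) by (simp add: \<psi>_def)
  qed
  moreover have "(\<Sum>z\<in>Z. sgn (det (matrix (V' z)))) * c = c"
    using 1 2 integral_unique[OF B] by simp
  ultimately show ?thesis
    by (simp add: Z_def)
qed

section \<open>Determinants on abstract Euclidean spaces\<close>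

text \<open>An index type with \<open>DIM('a)\<close> elements. It receives a well-order because the
  degree theorem above, through change of variables, speaks of coordinate spaces with a finite
  well-ordered index type.\<close>

typedef (overloaded) ('a::euclidean_space) coord = "{..<DIM('a)}"
  by (rule exI[of _ 0]) simp

lemma CARD_coord: "CARD('a::euclidean_space coord) = DIM('a)"
  using type_definition.card[OF type_definition_coord] by simp

instantiation coord :: (euclidean_space) "{finite, wellorder}"
begin

definition less_eq_coord :: "'a coord \<Rightarrow> 'a coord \<Rightarrow> bool" where
  "less_eq_coord i j \<longleftrightarrow> Rep_coord i \<le> Rep_coord j"

definition less_coord :: "'a coord \<Rightarrow> 'a coord \<Rightarrow> bool" where
  "less_coord i j \<longleftrightarrow> Rep_coord i < Rep_coord j"

instance
proof
  show "finite (UNIV :: 'a coord set)"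
    using CARD_coord[where 'a = 'a] card.infinite DIM_positive by force
  fix P :: "'a coord \<Rightarrow> bool" and i
  assume step: "\<And>i. (\<And>j. j < i \<Longrightarrow> P j) \<Longrightarrow> P i"
  show "P i"
    by (induction i rule: measure_induct_rule[of Rep_coord]) (use step in \<open>auto simp: less_coord_def\<close>)
qed (auto simp: less_eq_coord_def less_coord_def Rep_coord_inject)

end

lemma ex_coordinates:
  "\<exists>T :: 'a::euclidean_space \<Rightarrow> real^'a coord. \<exists>S. linear T \<and> linear S \<and>
     (\<forall>x. norm (T x) = norm x) \<and> (\<forall>x. S (T x) = x) \<and> (\<forall>y. T (S y) = y)"
proof -
  have "DIM('a) = DIM(real^'a coord)"
    by (simp add: CARD_coord)
  then obtain T :: "'a \<Rightarrow> real^'a coord" and S where "linear T" "linear S" "\<And>x. norm (T x) = norm x"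
    "\<And>y. norm (S y) = norm y" "\<And>x. S (T x) = x" "\<And>y. T (S y) = y"
    by (rule isomorphisms_UNIV_UNIV) (rule that)
  then have "linear T \<and> linear S \<and> (\<forall>x. norm (T x) = norm x) \<and> (\<forall>x. S (T x) = x) \<and> (\<forall>y. T (S y) = y)"
    by simp
  then show ?thesis by (intro exI)
qed

text \<open>An arbitrarily chosen linear isometry. Preservation of the norm carries over the
  condition that a field is the identity outside a ball.\<close>

definition to_coords :: "'a::euclidean_space \<Rightarrow> real^'a coord" where
  "to_coords = (SOME T. \<exists>S. linear T \<and> linear S \<and> (\<forall>x. norm (T x) = norm x) \<and>
     (\<forall>x. S (T x) = x) \<and> (\<forall>y. T (S y) = y))"

definition of_coords :: "real^'a coord \<Rightarrow> 'a::euclidean_space" where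
  "of_coords = inv_into UNIV to_coords"

lemma
  fixes x :: "'a::euclidean_space" and y :: "real^'a coord"
  shows linear_to_coords: "linear (to_coords :: 'a \<Rightarrow> _)"
    and linear_of_coords: "linear (of_coords :: _ \<Rightarrow> 'a)"
    and norm_to_coords: "norm (to_coords x) = norm x"
    and of_to_coords [simp]: "of_coords (to_coords x) = x"
    and to_of_coords [simp]: "to_coords (of_coords y) = y"
proof -
  have "\<exists>S :: _ \<Rightarrow> 'a. linear (to_coords :: 'a \<Rightarrow> _) \<and> linear S \<and>
     (\<forall>x::'a. norm (to_coords x) = norm x) \<and> (\<forall>x. S (to_coords x) = x) \<and> (\<forall>y. to_coords (S y) = y)"
    unfolding to_coords_def by (rule someI_ex[OF ex_coordinates])
  then obtain S :: "_ \<Rightarrow> 'a" where S: "linear (to_coords :: 'a \<Rightarrow> _)" "linear S"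
      "\<And>x::'a. norm (to_coords x) = norm x" "\<And>x. S (to_coords x) = x" "\<And>y. to_coords (S y) = y"
    by (elim exE conjE) (rule that, assumption+, (erule spec)+)
  have "of_coords = S"
  proof
    fix y
    have "inj (to_coords :: 'a \<Rightarrow> _)"
      using S(4) by (metis injI)
    then show "of_coords y = S y"
      unfolding of_coords_def by (intro inv_into_f_eq) (auto simp: S(5))
  qed
  with S show "linear (to_coords :: 'a \<Rightarrow> _)" "linear (of_coords :: _ \<Rightarrow> 'a)" "norm (to_coords x) = norm x"
    "of_coords (to_coords x) = x" "to_coords (of_coords y) = y"
    by auto
qed

definition linear_det :: "('a::euclidean_space \<Rightarrow> 'a) \<Rightarrow> real" where
  "linear_det f = det (matrix (\<lambda>v. to_coords (f (of_coords v))))"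

lemma linear_conj_coords:
  assumes "linear f"
  shows "linear (\<lambda>v. to_coords (f (of_coords v)))"
  using linear_compose[OF linear_compose[OF linear_of_coords assms] linear_to_coords] by (simp add: o_def)

lemma linear_det_nz_iff_inj:
  assumes "linear f"
  shows "linear_det f \<noteq> 0 \<longleftrightarrow> inj f"
proof -
  have "inj (\<lambda>v. to_coords (f (of_coords v))) \<longleftrightarrow> inj f"
  proof
    assume *: "inj (\<lambda>v. to_coords (f (of_coords v)))"
    show "inj f"
    proof (rule injI)
      fix x y assume "f x = f y"
      have "to_coords x = to_coords y"
        by (rule injD[OF *]) (simp add: \<open>f x = f y\<close>)
      then have "of_coords (to_coords x) = of_coords (to_coords y)"
        by (rule arg_cong)
      then show "x = y" by simp
    qed
  next
    assume *: "inj f"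
    show "inj (\<lambda>v. to_coords (f (of_coords v)))"
    proof (rule injI)
      fix v w assume "to_coords (f (of_coords v)) = to_coords (f (of_coords w))"
      then have "of_coords (to_coords (f (of_coords v))) = (of_coords (to_coords (f (of_coords w))) :: 'a)"
        by (rule arg_cong)
      then have "f (of_coords v) = f (of_coords w)"
        by simp
      from injD[OF * this] have "(of_coords v :: 'a) = of_coords w" .
      then have "to_coords (of_coords v :: 'a) = to_coords (of_coords w :: 'a)"
        by (rule arg_cong)
      then show "v = w" by simp
    qed
  qed
  then show ?thesis
    unfolding linear_det_def using det_nz_iff_inj[OF linear_conj_coords[OF assms]] by simp
qed

text \<open>With \<open>P\<close> sending coordinate vectors to eigenvectors and \<open>D\<close>
  diagonal, A P = P D; as \<open>P\<close> is invertible, \<open>A\<close> and \<open>D\<close> have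
  the same determinant. The eigenvectors may be oblique, as they are when the radial direction joins
  a tangent basis.\<close>

lemma det_eigenbasis_cart:
  fixes A :: "real^'n \<Rightarrow> real^'n" and e :: "'n \<Rightarrow> real^'n"
  assumes "linear A" "inj e" "independent (range e)" "\<And>i. A (e i) = l i *\<^sub>R e i"
  shows "det (matrix A) = prod l UNIV"
proof -
  define P where "P = (\<lambda>x::real^'n. \<Sum>i\<in>UNIV. x $ i *\<^sub>R e i)"
  have "linear P"
    unfolding P_def by (intro linear_compose_sum ballI linearI) (auto simp: algebra_simps)
  have "P x = 0 \<Longrightarrow> x = 0" for x
  proof -
    assume "P x = 0"
    then have "(\<Sum>v\<in>range e. x $ (inv_into UNIV e v) *\<^sub>R v) = 0"
      using assms(2) by (simp add: P_def sum.reindex)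
    then have "\<forall>v\<in>range e. x $ (inv_into UNIV e v) = 0"
      using independentD[OF assms(3), of "range e" "\<lambda>v. x $ (inv_into UNIV e v)"] by auto
    then show "x = 0"
      using assms(2) by (simp add: vec_eq_iff)
  qed
  then have "inj P"
    using linear_injective_0[OF \<open>linear P\<close>] by blast
  then have nz: "det (matrix P) \<noteq> 0"
    using det_nz_iff_inj[OF \<open>linear P\<close>] by simp
  define D where "D = (\<lambda>x::real^'n. \<chi> i. l i * x $ i)"
  have "linear D"
    unfolding D_def by (intro linearI) (auto simp: vec_eq_iff algebra_simps)
  have AP: "A \<circ> P = P \<circ> D"
  proof
    fix x
    show "(A \<circ> P) x = (P \<circ> D) x"
      using assms(1,4) by (simp add: P_def D_def linear_sum linear_cmul mult.commute)
  qed
  have "matrix A ** matrix P = matrix P ** matrix D"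
    using matrix_compose[OF \<open>linear P\<close> assms(1)] matrix_compose[OF \<open>linear D\<close> \<open>linear P\<close>] AP by simp
  then have "det (matrix A) * det (matrix P) = det (matrix P) * det (matrix D)"
    by (metis det_mul)
  then have "det (matrix A) = det (matrix D)"
    using nz by simp
  also have "\<dots> = (\<Prod>i\<in>UNIV. matrix D $ i $ i)"
    by (rule det_diagonal) (simp add: matrix_def D_def axis_def)
  also have "\<dots> = prod l UNIV"
    by (simp add: matrix_def D_def axis_def)
  finally show ?thesis .
qed

lemma linear_det_eigenbasis:
  fixes A :: "'a::euclidean_space \<Rightarrow> 'a"
  assumes "linear A" "independent E" "card E = DIM('a)" "\<And>e. e \<in> E \<Longrightarrow> A e = l e *\<^sub>R e"
  shows "linear_det A = prod l E"
proof -
  have "finite E"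
    using assms(2) finiteI_independent by blast
  then obtain h where h: "bij_betw h (UNIV :: 'a coord set) E"
    using assms(3) finite_same_card_bij[of "UNIV :: 'a coord set" E] CARD_coord[where 'a = 'a] by auto
  have hE: "h i \<in> E" for i
    using h by (auto simp: bij_betw_def)
  have inj_tc: "inj (to_coords :: 'a \<Rightarrow> _)"
    by (metis injI of_to_coords)
  have "det (matrix (\<lambda>v. to_coords (A (of_coords v)))) = prod (l \<circ> h) UNIV"
  proof (rule det_eigenbasis_cart[OF linear_conj_coords[OF assms(1)], where e = "\<lambda>i. to_coords (h i)"])
    show "inj (\<lambda>i. to_coords (h i))"
      using h inj_tc by (auto simp: inj_def bij_betw_def)
    have "range (\<lambda>i. to_coords (h i)) = to_coords ` E"
      using h by (auto simp: bij_betw_def)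
    then show "independent (range (\<lambda>i. to_coords (h i)))"
      using linear_independent_injective_image[OF linear_to_coords assms(2) ] inj_on_subset[OF inj_tc] by auto
    show "to_coords (A (of_coords (to_coords (h i)))) = (l \<circ> h) i *\<^sub>R to_coords (h i)" for i
      using assms(4)[OF hE] by (simp add: linear_cmul[OF linear_to_coords])
  qed
  also have "\<dots> = prod l E"
    using prod.reindex_bij_betw[OF h, of l] by simp
  finally show ?thesis
    by (simp add: linear_det_def)
qed

theorem sum_signs_of_zeros:
  fixes V :: "'a::euclidean_space \<Rightarrow> 'a" and V' :: "'a \<Rightarrow> ('a \<Rightarrow>\<^sub>L 'a)"
  assumes der: "\<And>x. (V has_derivative V' x) (at x)" and cont: "continuous_on UNIV V'"
    and off: "\<And>x. R < norm x \<Longrightarrow> V x = x"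
    and nz: "\<And>x. V x = 0 \<Longrightarrow> inj (V' x)"
  shows "finite {x. V x = 0}" and "(\<Sum>x | V x = 0. sgn (linear_det (V' x))) = 1"
proof -
  let ?T = "to_coords :: 'a \<Rightarrow> real^'a coord" and ?S = "of_coords :: real^'a coord \<Rightarrow> 'a"
  have blT: "bounded_linear ?T" and blS: "bounded_linear ?S"
    using linear_to_coords linear_of_coords linear_conv_bounded_linear by blast+
  define W where "W = (\<lambda>y. ?T (V (?S y)))"
  define W' where "W' = (\<lambda>y. Blinfun ?T o\<^sub>L V' (?S y) o\<^sub>L Blinfun ?S)"
  have W'_apply: "blinfun_apply (W' y) = (\<lambda>v. ?T (V' (?S y) (?S v)))" for y
    by (simp add: W'_def fun_eq_iff bounded_linear_Blinfun_apply[OF blT] bounded_linear_Blinfun_apply[OF blS])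
  have derW: "(W has_derivative W' y) (at y)" for y
    unfolding W_def W'_apply
    by (intro bounded_linear.has_derivative[OF blT] has_derivative_compose[OF _ der]
        bounded_linear.has_derivative[OF blS] has_derivative_ident)
  have contW: "continuous_on UNIV W'"
    unfolding W'_def
    by (intro continuous_intros continuous_on_compose2[OF cont] linear_continuous_on[OF blS] subset_UNIV)
  have offW: "W y = y" if "R < norm y" for y
    using off[of "?S y"] that norm_to_coords[of "?S y"] by (simp add: W_def)
  have Weq: "W (?T x) = ?T (V x)" for x
    by (simp add: W_def)
  have T0: "?T x = 0 \<longleftrightarrow> x = 0" for x
    using norm_to_coords[of x] by (metis norm_eq_zero)
  have det: "det (matrix (W' y)) = linear_det (V' (?S y))" for y
    by (simp add: W'_apply linear_det_def)
  have lin: "linear (V' x)" for x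
    by (rule bounded_linear.linear[OF blinfun.bounded_linear_right])
  have nzW: "det (matrix (W' y)) \<noteq> 0" if "W y = 0" for y
    unfolding det using that nz[of "?S y"] linear_det_nz_iff_inj[OF lin] by (simp add: W_def T0)
  have zeros: "{x. V x = 0} = ?S ` {y. W y = 0}"
  proof (intro Set.set_eqI iffI)
    fix x assume "x \<in> {x. V x = 0}"
    then show "x \<in> ?S ` {y. W y = 0}"
      by (intro image_eqI[of _ _ "?T x"]) (auto simp: Weq T0)
  qed (auto simp: W_def T0)
  have inj: "inj_on ?S A" for A
    by (metis inj_onI to_of_coords)
  show "finite {x. V x = 0}"
    unfolding zeros using finite_zeros[OF derW contW offW nzW] by simp
  have "(\<Sum>x | V x = 0. sgn (linear_det (V' x))) = (\<Sum>y | W y = 0. sgn (det (matrix (W' y))))"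
    unfolding zeros det by (simp add: sum.reindex[OF inj])
  also have "\<dots> = 1"
    by (rule sum_signs_of_zeros_cart[OF derW contW offW nzW])
  finally show "(\<Sum>x | V x = 0. sgn (linear_det (V' x))) = 1" .
qed

section \<open>Self-adjoint maps and the Morse index\<close>

lemma quadratic_nonneg_linear_term:
  fixes b q :: real
  assumes "\<And>t. 0 \<le> 2 * t * b + t\<^sup>2 * q"
  shows "b = 0"
proof (rule ccontr)
  assume b: "b \<noteq> 0"
  \<comment> \<open>The step goes against the sign of \<open>b\<close> and is so short that the
    quadratic term cannot make up for the linear loss; the added 1 covers q = 0.\<close>
  define t where "t = - b / (\<bar>q\<bar> + 1)"
  have bb: "b = - (t * (\<bar>q\<bar> + 1))"
    by (simp add: t_def)
  have "0 < t\<^sup>2"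
    using b by (simp add: t_def)
  have "2 * t * b + t\<^sup>2 * q = - 2 * t\<^sup>2 * (\<bar>q\<bar> + 1) + t\<^sup>2 * q"
    by (subst bb) (simp add: power2_eq_square algebra_simps)
  also have "\<dots> = t\<^sup>2 * (q - 2 * (\<bar>q\<bar> + 1))"
    by (simp add: algebra_simps)
  also have "\<dots> < 0"
    using \<open>0 < t\<^sup>2\<close> by (intro mult_pos_neg) (auto simp: abs_if)
  finally show False
    using assms[of t] by simp
qed

text \<open>A maximiser of the Rayleigh quotient on the unit sphere of \<open>T\<close> is an
  eigenvector: the form l |x|^2 - H x \<bullet> x is nonnegative on \<open>T\<close> and vanishes at
  \<open>e\<close>, so its first variation at \<open>e\<close> vanishes in every direction of
  \<open>T\<close>.\<close>

lemma self_adjoint_eigenvector: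
  fixes H :: "'a::euclidean_space \<Rightarrow> 'a"
  assumes H: "linear H" and T: "subspace T" "T \<noteq> {0}"
    and inv: "\<And>v. v \<in> T \<Longrightarrow> H v \<in> T"
    and sym: "\<And>v w. \<lbrakk>v \<in> T; w \<in> T\<rbrakk> \<Longrightarrow> H v \<bullet> w = v \<bullet> H w"
  obtains e l where "e \<in> T" "norm e = 1" "H e = l *\<^sub>R e"
proof -
  have contH: "continuous_on S H" for S
    using H linear_continuous_on linear_conv_bounded_linear by blast
  let ?S = "sphere 0 1 \<inter> T"
  have "compact ?S"
    using T(1) by (intro compact_Int_closed compact_sphere closed_subspace)
  obtain v where "v \<in> T" "v \<noteq> 0"
    using T subspace_0 by blast
  then have "v /\<^sub>R norm v \<in> ?S"
    using T(1) by (simp add: subspace_scale)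
  then have "?S \<noteq> {}" by blast
  moreover have "continuous_on ?S (\<lambda>x. H x \<bullet> x)"
    by (intro continuous_intros contH)
  ultimately obtain e where e: "e \<in> ?S" "\<And>x. x \<in> ?S \<Longrightarrow> H x \<bullet> x \<le> H e \<bullet> e"
    using continuous_attains_sup[OF \<open>compact ?S\<close>] by blast
  define l where "l = H e \<bullet> e"
  have eT: "e \<in> T" "norm e = 1" "e \<bullet> e = 1"
    using e by (auto simp: norm_eq_1)
  have le: "e \<bullet> H e = l"
    by (simp add: l_def inner_commute)
  have Q: "0 \<le> l * (x \<bullet> x) - H x \<bullet> x" if "x \<in> T" for x
  proof (cases "x = 0")
    case True
    then show ?thesis using linear_0[OF H] by simp
  next
    case False
    then have "x /\<^sub>R norm x \<in> ?S"
      using that T(1) by (simp add: subspace_scale)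
    then have "H (x /\<^sub>R norm x) \<bullet> (x /\<^sub>R norm x) \<le> l"
      unfolding l_def by (rule e(2))
    then have "(H x \<bullet> x) / (norm x * norm x) \<le> l"
      by (simp add: linear_cmul[OF H] divide_inverse algebra_simps)
    then have "H x \<bullet> x \<le> l * (norm x * norm x)"
      using False by (simp add: pos_divide_le_eq)
    then show ?thesis
      by (simp add: dot_square_norm power2_eq_square)
  qed
  have "(l *\<^sub>R e - H e) \<bullet> w = 0" if w: "w \<in> T" for w
  proof (rule quadratic_nonneg_linear_term)
    fix t
    have "e + t *\<^sub>R w \<in> T"
      using w eT(1) T(1) by (simp add: subspace_add subspace_scale)
    from Q[OF this]
    have "0 \<le> l * ((e + t *\<^sub>R w) \<bullet> (e + t *\<^sub>R w)) - (H e + t *\<^sub>R H w) \<bullet> (e + t *\<^sub>R w)"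
      by (simp add: linear_add[OF H] linear_cmul[OF H])
    also have "\<dots> = 2 * t * ((l *\<^sub>R e - H e) \<bullet> w) + t\<^sup>2 * (l * (w \<bullet> w) - H w \<bullet> w)"
      using sym[OF eT(1) w] eT(3)
      by (simp add: inner_commute inner_simps algebra_simps power2_eq_square le)
    finally show "0 \<le> 2 * t * ((l *\<^sub>R e - H e) \<bullet> w) + t\<^sup>2 * (l * (w \<bullet> w) - H w \<bullet> w)" .
  qed
  moreover have "l *\<^sub>R e - H e \<in> T"
    using eT(1) inv T(1) by (simp add: subspace_diff subspace_scale)
  ultimately have "H e = l *\<^sub>R e"
    by (metis eq_iff_diff_eq_0 inner_eq_zero_iff)
  then show thesis
    using that eT by blast
qed

text \<open>Induction on the dimension: one eigenvector is split off, and self-adjointness keeps its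
  orthogonal complement in \<open>T\<close> invariant.\<close>

lemma self_adjoint_eigenbasis:
  fixes H :: "'a::euclidean_space \<Rightarrow> 'a"
  assumes H: "linear H" and T: "subspace T"
    and inv: "\<And>v. v \<in> T \<Longrightarrow> H v \<in> T"
    and sym: "\<And>v w. \<lbrakk>v \<in> T; w \<in> T\<rbrakk> \<Longrightarrow> H v \<bullet> w = v \<bullet> H w"
  shows "\<exists>E l. pairwise orthogonal E \<and> (\<forall>e\<in>E. norm e = 1) \<and> span E = T \<and> (\<forall>e\<in>E. H e = l e *\<^sub>R e)"
  using T inv sym
proof (induction "dim T" arbitrary: T rule: less_induct)
  case less
  show ?case
  proof (cases "T = {0}")
    case True
    then show ?thesis by (intro exI[of _ "{}"]) simp
  next
    case False
    obtain e m where e: "e \<in> T" "norm e = 1" "H e = m *\<^sub>R e"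
      by (rule self_adjoint_eigenvector[OF H less.prems(1) False less.prems(2,3)])
    define T' where "T' = {v \<in> T. e \<bullet> v = 0}"
    have T': "subspace T'"
    proof -
      have "subspace (T \<inter> {v. e \<bullet> v = 0})"
        by (rule subspace_inter) (rule less.prems(1), rule subspace_hyperplane)
      then show ?thesis by (simp add: T'_def Int_def)
    qed
    have "e \<notin> T'"
      using e(2) by (auto simp: T'_def)
    then have "T' \<noteq> T" using e(1) by blast
    moreover have "T' \<subseteq> T" by (auto simp: T'_def)
    ultimately have "span T' \<subset> span T"
      using T' less.prems(1) by (simp add: psubset_eq span_eq_iff[THEN iffD2])
    then have "dim T' < dim T"
      by (rule dim_psubset)
    moreover have "H v \<in> T'" if "v \<in> T'" for v
      using that less.prems(2)[of v] less.prems(3)[OF e(1), of v] e(3) by (auto simp: T'_def)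
    moreover have "H v \<bullet> w = v \<bullet> H w" if "v \<in> T'" "w \<in> T'" for v w
      using that less.prems(3) by (auto simp: T'_def)
    ultimately obtain E l where E: "pairwise orthogonal E" "\<forall>e\<in>E. norm e = 1" "span E = T'"
      "\<forall>e\<in>E. H e = l e *\<^sub>R e"
      using less.hyps[OF _ T'] by blast
    have ET': "E \<subseteq> T'"
      using E(3) span_superset by blast
    have "e \<notin> E"
      using ET' \<open>e \<notin> T'\<close> by blast
    have "span (insert e E) = T"
    proof
      show "span (insert e E) \<subseteq> T"
        using ET' e(1) less.prems(1) by (intro span_minimal) (auto simp: T'_def)
      show "T \<subseteq> span (insert e E)"
      proof
        fix v assume "v \<in> T"
        then have "v - (e \<bullet> v) *\<^sub>R e \<in> span E"
          using e less.prems(1)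
          by (simp add: E(3) T'_def subspace_diff subspace_scale inner_diff_right norm_eq_1)
        then show "v \<in> span (insert e E)"
          unfolding span_insert by blast
      qed
    qed
    moreover have "pairwise orthogonal (insert e E)"
      using E(1) ET' by (auto simp: pairwise_insert orthogonal_def T'_def inner_commute)
    ultimately show ?thesis
      using E(2,4) e(2,3) \<open>e \<notin> E\<close>
      by (intro exI[of _ "insert e E"] exI[of _ "l(e := m)"]) auto
  qed
qed

lemma orthonormal_independent:
  fixes E :: "'a::euclidean_space set"
  assumes "pairwise orthogonal E" "\<And>e. e \<in> E \<Longrightarrow> norm e = 1"
  shows "independent E" "finite E"
proof -
  have "0 \<notin> E"
    using assms(2) by force
  then show "independent E"
    using assms(1) by (simp add: pairwise_orthogonal_independent)
  then show "finite E"
    using independent_imp_finite by blast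
qed

text \<open>Pairing H v = m v with a basis vector \<open>e\<close> gives (v \<bullet> e) (l e - m) =
  0, so only the components with eigenvalue \<open>m\<close> survive.\<close>

lemma eigenspace_eq_span:
  fixes H :: "'a::euclidean_space \<Rightarrow> 'a"
  assumes H: "linear H" and E: "pairwise orthogonal E" "\<And>e. e \<in> E \<Longrightarrow> norm e = 1"
    and eig: "\<And>e. e \<in> E \<Longrightarrow> H e = l e *\<^sub>R e"
  shows "{v \<in> span E. H v = m *\<^sub>R v} = span {e \<in> E. l e = m}"
proof
  note fin = orthonormal_independent(2)[OF E]
  have one: "e \<bullet> e = 1" if "e \<in> E" for e
    using E(2)[OF that] by (simp add: norm_eq_1)
  show "span {e \<in> E. l e = m} \<subseteq> {v \<in> span E. H v = m *\<^sub>R v}"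
  proof (rule span_minimal)
    show "{e \<in> E. l e = m} \<subseteq> {v \<in> span E. H v = m *\<^sub>R v}"
      using eig by (auto intro: span_base)
    show "subspace {v \<in> span E. H v = m *\<^sub>R v}"
      unfolding subspace_def using H
      by (auto simp: span_zero span_add span_scale linear_0 linear_add linear_cmul scaleR_add_right)
  qed
  show "{v \<in> span E. H v = m *\<^sub>R v} \<subseteq> span {e \<in> E. l e = m}"
  proof
    fix v assume "v \<in> {v \<in> span E. H v = m *\<^sub>R v}"
    then have v: "v \<in> span E" "H v = m *\<^sub>R v" by auto
    have exp: "v = (\<Sum>e\<in>E. (v \<bullet> e) *\<^sub>R e)"
      using orthonormal_basis_expand[OF E v(1) fin] by simp
    have "(v \<bullet> e) * (l e) = (v \<bullet> e) * m" if e: "e \<in> E" for e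
    proof -
      have "H v = (\<Sum>x\<in>E. ((v \<bullet> x) * l x) *\<^sub>R x)"
        using eig by (subst exp) (simp add: linear_sum[OF H] linear_cmul[OF H])
      then have "H v \<bullet> e = (\<Sum>x\<in>E. (v \<bullet> x) * l x * (x \<bullet> e))"
        by (simp add: inner_sum_left)
      also have "\<dots> = (\<Sum>x\<in>E. if x = e then (v \<bullet> x) * l x else 0)"
        using E(1) e one by (intro sum.cong) (auto simp: pairwise_def orthogonal_def)
      also have "\<dots> = (v \<bullet> e) * l e"
        using fin e by simp
      finally show ?thesis
        using v(2) by (metis inner_scaleR_left mult.commute)
    qed
    then have z: "v \<bullet> e = 0" if "e \<in> E" "l e \<noteq> m" for e
      using that by fastforce
    have "v = (\<Sum>e\<in>{e \<in> E. l e = m}. (v \<bullet> e) *\<^sub>R e)"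
      by (subst exp, rule sum.mono_neutral_right) (use fin z in auto)
    moreover have "(\<Sum>e\<in>{e \<in> E. l e = m}. (v \<bullet> e) *\<^sub>R e) \<in> span {e \<in> E. l e = m}"
      by (intro span_sum span_scale span_base)
    ultimately show "v \<in> span {e \<in> E. l e = m}" by simp
  qed
qed

text \<open>Links the definition of the Morse index, which runs over distinct eigenvalues, to a
  count of basis vectors: the eigenspace for \<open>m\<close> is spanned by the fibre of
  \<open>l\<close> over \<open>m\<close>.\<close>

lemma sum_dim_negative_eigenspaces:
  fixes H :: "'a::euclidean_space \<Rightarrow> 'a"
  assumes H: "linear H" and E: "pairwise orthogonal E" "\<And>e. e \<in> E \<Longrightarrow> norm e = 1"
    and eig: "\<And>e. e \<in> E \<Longrightarrow> H e = l e *\<^sub>R e"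
  shows "(\<Sum>m | m < 0 \<and> (\<exists>v\<in>{v \<in> span E. H v = m *\<^sub>R v}. v \<noteq> 0). dim {v \<in> span E. H v = m *\<^sub>R v})
           = card {e \<in> E. l e < 0}"
proof -
  note ind = orthonormal_independent[OF E]
  have ex_iff: "(\<exists>v\<in>span {e \<in> E. l e = m}. v \<noteq> 0) \<longleftrightarrow> m \<in> l ` E" for m
  proof
    assume "\<exists>v\<in>span {e \<in> E. l e = m}. v \<noteq> 0"
    then have "{e \<in> E. l e = m} \<noteq> {}"
      by (metis span_empty singletonD)
    then show "m \<in> l ` E" by blast
  next
    assume "m \<in> l ` E"
    then obtain e where e: "e \<in> E" "m = l e" by blast
    then have "e \<noteq> 0" using E(2) by force
    moreover have "e \<in> span {e \<in> E. l e = m}"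
      using e by (intro span_base) simp
    ultimately show "\<exists>v\<in>span {e \<in> E. l e = m}. v \<noteq> 0" by blast
  qed
  have set: "{m. m < 0 \<and> (\<exists>v\<in>span {e \<in> E. l e = m}. v \<noteq> 0)} = l ` {e \<in> E. l e < 0}"
    unfolding ex_iff by auto
  have dim: "dim (span {e \<in> E. l e = m}) = card {e \<in> E. l e = m}" for m
    using independent_mono[OF ind(1), of "{e \<in> E. l e = m}"] by (simp add: dim_eq_card_independent)
  have "card {e \<in> E. l e < 0} = (\<Sum>m\<in>l ` {e \<in> E. l e < 0}. card {x \<in> {e \<in> E. l e < 0}. l x = m})"
    using sum.image_gen[of "{e \<in> E. l e < 0}" "\<lambda>_. 1::nat" l] ind(2) by simp
  also have "\<dots> = (\<Sum>m\<in>l ` {e \<in> E. l e < 0}. card {e \<in> E. l e = m})"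
    by (intro sum.cong refl arg_cong[where f = card]) auto
  finally have card: "card {e \<in> E. l e < 0} = (\<Sum>m\<in>l ` {e \<in> E. l e < 0}. card {e \<in> E. l e = m})" .
  have es: "{v \<in> span E. H v = m *\<^sub>R v} = span {e \<in> E. l e = m}" for m
    by (rule eigenspace_eq_span[OF H E eig])
  show ?thesis
    by (simp only: es set dim card)
qed

text \<open>An orthonormal eigenbasis of \<open>H\<close> on the hyperplane together with the
  transverse, in general oblique, vector \<open>p\<close> is an eigenbasis of \<open>A\<close>. The
  determinant is \<open>k\<close> times the product of the eigenvalues of \<open>H\<close>, so its
  sign is the parity of the number of negative ones. In the application \<open>T\<close> is the
  tangent space, \<open>H\<close> the Hessian and \<open>p\<close> the radial direction.\<close>

lemma sgn_det_eq_parity: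
  fixes A H :: "'a::euclidean_space \<Rightarrow> 'a"
  assumes A: "linear A" "\<And>v. n \<bullet> v = 0 \<Longrightarrow> A v = H v" "A p = k *\<^sub>R p" "0 < k" and p: "n \<bullet> p \<noteq> 0"
    and H: "linear H" "\<And>v. n \<bullet> v = 0 \<Longrightarrow> n \<bullet> H v = 0"
      "\<And>v w. \<lbrakk>n \<bullet> v = 0; n \<bullet> w = 0\<rbrakk> \<Longrightarrow> H v \<bullet> w = v \<bullet> H w"
      "\<And>v. \<lbrakk>n \<bullet> v = 0; H v = 0\<rbrakk> \<Longrightarrow> v = 0"
  defines "T \<equiv> {v. n \<bullet> v = 0}"
  shows "inj A"
    and "sgn (linear_det A) =
      (- 1) ^ (\<Sum>m | m < 0 \<and> (\<exists>v\<in>{v \<in> T. H v = m *\<^sub>R v}. v \<noteq> 0). dim {v \<in> T. H v = m *\<^sub>R v})"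
proof -
  have "subspace T"
    unfolding T_def by (rule subspace_hyperplane)
  then obtain E l where E: "pairwise orthogonal E" "\<And>e. e \<in> E \<Longrightarrow> norm e = 1" "span E = T"
      and eig: "\<And>e. e \<in> E \<Longrightarrow> H e = l e *\<^sub>R e"
    using self_adjoint_eigenbasis[OF H(1), of T] H(2,3) unfolding T_def by blast
  note ind = orthonormal_independent[OF E(1,2)]
  have "n \<noteq> 0" using p by auto
  have ET: "n \<bullet> e = 0" if "e \<in> E" for e
    using that E(3) span_base unfolding T_def by blast
  have "p \<notin> E" using ET p by blast
  have "p \<notin> span E"
    using p by (simp add: E(3) T_def)
  then have indp: "independent (insert p E)"
    using ind(1) by (simp add: independent_insertI)
  have "dim T = DIM('a) - 1"
    unfolding T_def using \<open>n \<noteq> 0\<close> by (rule dim_hyperplane)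
  then have card: "card (insert p E) = DIM('a)"
  proof -
    have "dim T = card E"
      using ind(1) by (simp add: dim_eq_card_independent flip: E(3))
    then show ?thesis
      using \<open>dim T = DIM('a) - 1\<close> ind(2) \<open>p \<notin> E\<close> DIM_positive[where 'a = 'a]
      by (simp del: DIM_positive)
  qed
  have lnz: "l e \<noteq> 0" if "e \<in> E" for e
  proof
    assume "l e = 0"
    then have "e = 0"
      using H(4)[OF ET[OF that]] eig[OF that] by simp
    then show False using E(2)[OF that] by simp
  qed
  have det: "linear_det A = prod (l(p := k)) (insert p E)"
  proof (rule linear_det_eigenbasis[OF A(1) indp card])
    fix e assume "e \<in> insert p E"
    then show "A e = (l(p := k)) e *\<^sub>R e"
      using A(2,3) eig ET \<open>p \<notin> E\<close> by auto
  qed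
  also have "\<dots> = k * prod l E"
    using ind(2) \<open>p \<notin> E\<close> by (simp add: prod.insert) (intro disjI2 prod.cong; auto)
  finally have detA: "linear_det A = k * prod l E" .
  then have "linear_det A \<noteq> 0"
    using lnz A(4) ind(2) by simp
  then show "inj A"
    using linear_det_nz_iff_inj[OF A(1)] by simp
  have "sgn (prod l E) = (\<Prod>e\<in>E. sgn (l e))"
    using ind(2) by (induction E rule: finite_induct) (auto simp: sgn_mult)
  then have "sgn (linear_det A) = (\<Prod>e\<in>E. sgn (l e))"
    using A(4) by (simp add: detA sgn_mult)
  also have "\<dots> = (\<Prod>e\<in>E. if e \<in> {e \<in> E. l e < 0} then - 1 else 1)"
    using lnz by (intro prod.cong) (auto simp: sgn_if)
  also have "\<dots> = (\<Prod>e\<in>{e \<in> E. l e < 0}. - 1)"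
    using ind(2) by (subst prod.inter_filter[symmetric]) auto
  also have "\<dots> = (- 1) ^ card {e \<in> E. l e < 0}"
    by simp
  also have "card {e \<in> E. l e < 0} =
      (\<Sum>m | m < 0 \<and> (\<exists>v\<in>{v \<in> T. H v = m *\<^sub>R v}. v \<noteq> 0). dim {v \<in> T. H v = m *\<^sub>R v})"
    using sum_dim_negative_eigenspaces[OF H(1) E(1,2) eig] unfolding E(3) by simp
  finally show "sgn (linear_det A) =
      (- 1) ^ (\<Sum>m | m < 0 \<and> (\<exists>v\<in>{v \<in> T. H v = m *\<^sub>R v}. v \<noteq> 0). dim {v \<in> T. H v = m *\<^sub>R v})" .
qed

section \<open>The Morse sum\<close>

text \<open>Shifts of this truncated square are the C1 building blocks of a quadratic spline with
  piecewise linear derivative.\<close>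

definition pos_square :: "real \<Rightarrow> real" where
  "pos_square s = (max 0 s)\<^sup>2"

lemma has_real_derivative_pos_square: "(pos_square has_real_derivative (2 * max 0 s)) (at s)"
proof -
  consider "s < 0" | "s = 0" | "0 < s" by linarith
  then show ?thesis
  proof cases
    case 1
    have "((\<lambda>s. 0) has_real_derivative (2 * max 0 s)) (at s)"
      using 1 by simp
    then show ?thesis
      by (rule has_field_derivative_transform_within_open[of _ _ _ "{..<0}"])
        (use 1 in \<open>auto simp: pos_square_def\<close>)
  next
    case 2
    have "(pos_square has_derivative (\<lambda>h. 0)) (at 0)"
      unfolding has_derivative_at_alt
    proof (intro conjI allI impI)
      fix e :: real assume "0 < e"
      show "\<exists>d>0. \<forall>y. norm (y - 0) < d \<longrightarrow> norm (pos_square y - pos_square 0 - 0) \<le> e * norm (y - 0)"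
      proof (intro exI[of _ e] conjI allI impI)
        fix y :: real assume "norm (y - 0) < e"
        have "pos_square y \<le> \<bar>y\<bar> * \<bar>y\<bar>"
          by (auto simp: pos_square_def power2_eq_square max_def)
        also have "\<dots> \<le> e * \<bar>y\<bar>"
          using \<open>norm (y - 0) < e\<close> by (intro mult_right_mono) auto
        finally show "norm (pos_square y - pos_square 0 - 0) \<le> e * norm (y - 0)"
          by (simp add: pos_square_def)
      qed fact
    qed simp
    then show ?thesis
      using 2 by (simp add: has_field_derivative_def mult_zero_left[abs_def])
  next
    case 3
    have "((\<lambda>s. s\<^sup>2) has_real_derivative (2 * max 0 s)) (at s)"
      using 3 by (auto intro!: derivative_eq_intros)
    then show ?thesis
      by (rule has_field_derivative_transform_within_open[of _ _ _ "{0<..}"])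
        (use 3 in \<open>auto simp: pos_square_def\<close>)
  qed
qed

text \<open>The integral of a hat function: a step of class C1 from \<open>-1\<close> (for \<open>t \<le> 1/2\<close>) to \<open>1\<close> (for
  \<open>t \<ge> 3/2\<close>) whose only zero is \<open>t = 1\<close>.\<close>

definition ramp :: "real \<Rightarrow> real" where
  "ramp t = pos_square (2 * t - 1) - 2 * pos_square (2 * t - 2) + pos_square (2 * t - 3) - 1"

lemma has_real_derivative_ramp:
  "(ramp has_real_derivative
     (4 * max 0 (2 * t - 1) - 8 * max 0 (2 * t - 2) + 4 * max 0 (2 * t - 3))) (at t)"
proof -
  have "((\<lambda>t. pos_square (2 * t - k)) has_real_derivative (2 * max 0 (2 * t - k) * 2)) (at t)" for k
    by (rule DERIV_chain2[OF has_real_derivative_pos_square]) (auto intro!: derivative_eq_intros)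
  note this[of 1] this[of 2] this[of 3]
  then show ?thesis
    unfolding ramp_def by (auto intro!: derivative_eq_intros)
qed

lemma C1_map_on_ramp: "C1_map_on UNIV ramp"
  by (rule C1_map_on_real[OF has_real_derivative_ramp]) (intro continuous_intros)

lemma ramp_values:
  shows "t \<le> 1/2 \<Longrightarrow> ramp t = - 1" and "3/2 \<le> t \<Longrightarrow> ramp t = 1" and "ramp 1 = 0"
    and "ramp t = 0 \<Longrightarrow> t = 1"
proof -
  show low: "t \<le> 1/2 \<Longrightarrow> ramp t = - 1" for t
    by (auto simp: ramp_def pos_square_def max_def)
  show "ramp 1 = 0"
    by (auto simp: ramp_def pos_square_def max_def)
  show "3/2 \<le> t \<Longrightarrow> ramp t = 1"
    by (auto simp: ramp_def pos_square_def max_def power2_eq_square algebra_simps)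
  assume 0: "ramp t = 0"
  consider "t \<le> 1/2" | "1/2 < t" "t \<le> 1" | "1 < t" "t \<le> 3/2" | "3/2 < t" by linarith
  then show "t = 1"
  proof cases
    case 1
    then show ?thesis using 0 low[OF 1] by simp
  next
    case 2
    then have "(2 * t - 1)\<^sup>2 = 1"
      using 0 by (simp add: ramp_def pos_square_def)
    then show ?thesis using 2 by (auto simp: power2_eq_1_iff)
  next
    case 3
    then have "(2 * t - 1)\<^sup>2 - 2 * (2 * t - 2)\<^sup>2 = 1"
      using 0 by (simp add: ramp_def pos_square_def)
    then have "(t - 1) * (2 - t) = 0"
      by (simp add: power2_eq_square algebra_simps)
    then show ?thesis using 3 by simp
  next
    case 4
    then have "(2 * t - 1)\<^sup>2 - 2 * (2 * t - 2)\<^sup>2 + (2 * t - 3)\<^sup>2 = 1"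
      using 0 by (simp add: ramp_def pos_square_def)
    then show ?thesis by (simp add: power2_eq_square algebra_simps)
  qed
qed

section \<open>The extended gradient field\<close>

context smooth_function
begin

text \<open>The factor 1 - ramp^2 switches the gradient term off where the field has to be -y or y,
  and it is 1 on the boundary, where \<open>minkowski\<close> is 1. The origin is treated separately
  because no boundary point is attached to it.\<close>

definition field :: "'a \<Rightarrow> 'a" where
  "field y = (if y = 0 then 0
     else (1 - (ramp (minkowski y))\<^sup>2) *\<^sub>R G (radial y) + ramp (minkowski y) *\<^sub>R y)"

lemma field_near_0:
  obtains U where "open U" "0 \<in> U" "\<And>y. y \<in> U \<Longrightarrow> field y = - y"
proof -
  obtain r where r: "0 < r" "\<And>y. y \<noteq> 0 \<Longrightarrow> minkowski y \<le> norm y / r"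
    by (rule minkowski_bounds) (rule that)
  show thesis
  proof (rule that[of "ball 0 (r / 2)"])
    fix y :: 'a assume y: "y \<in> ball 0 (r / 2)"
    show "field y = - y"
    proof (cases "y = 0")
      case False
      have "norm y / r \<le> 1/2"
        using y r(1) by (simp add: field_simps)
      then have "ramp (minkowski y) = - 1"
        using r(2)[OF False] by (intro ramp_values(1)) linarith
      then show ?thesis using False by (simp add: field_def)
    qed (simp add: field_def)
  qed (use r(1) in auto)
qed

lemma field_far:
  obtains R where "\<And>y. R < norm y \<Longrightarrow> field y = y"
proof -
  obtain R where R: "0 < R" "\<And>y. y \<noteq> 0 \<Longrightarrow> norm y / R \<le> minkowski y"
    by (rule minkowski_bounds) (rule that)
  show thesis
  proof (rule that[of "3/2 * R"])
    fix y :: 'a assume y: "3/2 * R < norm y"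
    have "y \<noteq> 0" using y R(1) by auto
    have "3/2 \<le> norm y / R"
      using y R(1) by (simp add: field_simps)
    then have "ramp (minkowski y) = 1"
      using R(2)[OF \<open>y \<noteq> 0\<close>] by (intro ramp_values(2)) linarith
    then show "field y = y" using \<open>y \<noteq> 0\<close> by (simp add: field_def)
  qed
qed

lemma C1_map_on_ramp_minkowski: "C1_map_on (- {0}) (\<lambda>y. ramp (minkowski y))"
  by (rule C1_map_on_compose[OF C1_map_on_minkowski C1_map_on_ramp]) simp

lemma C1_map_on_field: "C1_map_on UNIV field"
proof (rule C1_map_on_local)
  fix y :: 'a
  show "\<exists>U. open U \<and> y \<in> U \<and> C1_map_on U field"
  proof (cases "y = 0")
    case True
    obtain U where U: "open U" "0 \<in> U" "\<And>y. y \<in> U \<Longrightarrow> field y = - y"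
      by (rule field_near_0) (rule that)
    have "C1_map_on U field"
      by (rule C1_map_on_cong[OF C1_map_on_minus[OF C1_map_on_ident] U(1)]) (simp add: U(3))
    then show ?thesis using U True by blast
  next
    case False
    obtain U E where U: "open U" "radial y \<in> U" "C1_map_on U E" "\<And>z. \<lbrakk>z \<in> U; z \<in> M\<rbrakk> \<Longrightarrow> G z = E z"
      by (rule local_gradient_field[OF radial_in_frontier[OF False]]) (rule that)
    \<comment> \<open>\<open>G\<close> is meaningful along \<open>M\<close> only, so smoothness of
      the field is checked with a local extension \<open>E\<close> of \<open>G\<close>; on
      \<open>W\<close> the point \<open>radial y\<close> stays in the domain of
      \<open>E\<close>.\<close>
    define W where "W = - {0} \<inter> radial -` U"
    have "open W"
      unfolding W_def
      by (rule continuous_open_preimage[OF continuous_on_radial _ U(1)]) (simp add: open_Compl)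
    have "y \<in> W" using False U(2) by (simp add: W_def)
    have W0: "W \<subseteq> - {0}" by (auto simp: W_def)
    have Er: "C1_map_on W (\<lambda>y. E (radial y))"
      by (rule C1_map_on_compose[OF C1_map_on_subset[OF C1_map_on_radial W0] U(3)]) (simp add: W_def)
    have r: "C1_map_on W (\<lambda>y. ramp (minkowski y))"
      by (rule C1_map_on_subset[OF C1_map_on_ramp_minkowski W0])
    have "C1_map_on W (\<lambda>y. (1 - ramp (minkowski y) * ramp (minkowski y)) *\<^sub>R E (radial y) + ramp (minkowski y) *\<^sub>R y)"
      by (intro C1_map_on_add C1_map_on_scaleR C1_map_on_diff C1_map_on_mult C1_map_on_const C1_map_on_ident Er r)
    then have "C1_map_on W field"
    proof (rule C1_map_on_cong[OF _ \<open>open W\<close>])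
      fix z assume "z \<in> W"
      then have "z \<noteq> 0" "radial z \<in> U" by (auto simp: W_def)
      then show "(1 - ramp (minkowski z) * ramp (minkowski z)) *\<^sub>R E (radial z) + ramp (minkowski z) *\<^sub>R z = field z"
        using U(4) radial_in_frontier by (simp add: field_def power2_eq_square)
    qed
    then show ?thesis using \<open>open W\<close> \<open>y \<in> W\<close> by blast
  qed
qed

lemma field_zero_iff: "field y = 0 \<longleftrightarrow> y = 0 \<or> (\<exists>c\<in>M. G c = 0 \<and> y = c - x0)"
proof (cases "y = 0")
  case False
  have p: "radial y \<in> M" by (rule radial_in_frontier[OF False])
  show ?thesis
  proof
    assume 0: "field y = 0"
    \<comment> \<open>Pairing with the conormal separates the two terms of the field: the gradient
      is tangent and drops out, which leaves
      \<open>ramp (minkowski y) * minkowski y\<close>.\<close>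
    have "conormal (radial y) \<bullet> G (radial y) = 0"
      using nu_inner_gradient[OF p] by (simp add: conormal_def)
    then have "conormal (radial y) \<bullet> field y = ramp (minkowski y) * minkowski y"
      using False by (simp add: field_def inner_add_right conormal_radial_inner[OF False])
    then have "ramp (minkowski y) * minkowski y = 0"
      by (simp add: 0)
    then have r: "ramp (minkowski y) = 0"
      using minkowski_pos[OF False] by simp
    then have "minkowski y = 1" by (rule ramp_values(4))
    then have "y = radial y - x0" by (simp add: radial_def)
    moreover have "G (radial y) = 0"
      using 0 r False by (simp add: field_def)
    ultimately show "y = 0 \<or> (\<exists>c\<in>M. G c = 0 \<and> y = c - x0)"
      using p by blast
  next
    assume "y = 0 \<or> (\<exists>c\<in>M. G c = 0 \<and> y = c - x0)"
    then obtain c where c: "c \<in> M" "G c = 0" "y = c - x0"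
      using False by blast
    then show "field y = 0"
      using minkowski_frontier[OF c(1)] radial_frontier[OF c(1)] by (simp add: field_def ramp_values(3))
  qed
qed (simp add: field_def)

text \<open>Since \<open>ramp\<close> vanishes at 1 and \<open>E c = 0\<close>, the product rule
  leaves \<open>D\<close> composed with the derivative of \<open>radial\<close>, plus the radial
  term. The factor 4 is the slope of \<open>ramp\<close> at 1. Tangent vectors are mapped by
  \<open>D\<close>, and c - x0 is stretched by 4.\<close>

lemma has_derivative_field_critical:
  assumes c: "c \<in> M" "G c = 0" and U: "open U" "c \<in> U" "\<And>z. \<lbrakk>z \<in> U; z \<in> M\<rbrakk> \<Longrightarrow> G z = E z"
    and D: "(E has_derivative D) (at c)"
  shows "(field has_derivative (\<lambda>h. D (h - (conormal c \<bullet> h) *\<^sub>R (c - x0)) + (4 * (conormal c \<bullet> h)) *\<^sub>R (c - x0)))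
    (at (c - x0))"
proof -
  let ?y = "c - x0"
  have nz: "?y \<noteq> 0"
    using frontier_not_x0[OF c(1)] by simp
  have m: "minkowski ?y = 1" and p: "radial ?y = c"
    using minkowski_frontier radial_frontier c(1) by auto
  have Ec: "E c = 0"
    using U c by metis
  define W where "W = - {0} \<inter> radial -` U"
  have "open W"
    unfolding W_def
    by (rule continuous_open_preimage[OF continuous_on_radial _ U(1)]) (simp add: open_Compl)
  have "?y \<in> W" using nz U(2) p by (simp add: W_def)
  have Er: "((\<lambda>y. E (radial y)) has_derivative (\<lambda>h. D (h - (conormal c \<bullet> h) *\<^sub>R (c - x0)))) (at ?y)"
    by (rule has_derivative_compose[OF has_derivative_radial[OF c(1)]]) (simp add: p D)
  have r: "((\<lambda>y. ramp (minkowski y)) has_derivative (\<lambda>h. 4 * (conormal c \<bullet> h))) (at ?y)"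
  proof -
    have "(ramp has_derivative (\<lambda>h. 4 * h)) (at (minkowski ?y))"
      using has_real_derivative_ramp[of 1] by (simp add: m has_field_derivative_def)
    from has_derivative_compose[OF has_derivative_minkowski[OF nz] this] show ?thesis
      by (simp add: p)
  qed
  have "((\<lambda>y. (1 - ramp (minkowski y) * ramp (minkowski y)) *\<^sub>R E (radial y) + ramp (minkowski y) *\<^sub>R y) has_derivative
      (\<lambda>h. ((1 - ramp (minkowski ?y) * ramp (minkowski ?y)) *\<^sub>R D (h - (conormal c \<bullet> h) *\<^sub>R ?y) +
         (0 - (ramp (minkowski ?y) * (4 * (conormal c \<bullet> h)) + 4 * (conormal c \<bullet> h) * ramp (minkowski ?y))) *\<^sub>R E (radial ?y)) +
        (ramp (minkowski ?y) *\<^sub>R h + (4 * (conormal c \<bullet> h)) *\<^sub>R ?y))) (at ?y)"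
    by (intro has_derivative_add has_derivative_scaleR has_derivative_diff has_derivative_const
        has_derivative_mult Er r has_derivative_ident)
  then have "((\<lambda>y. (1 - ramp (minkowski y) * ramp (minkowski y)) *\<^sub>R E (radial y) + ramp (minkowski y) *\<^sub>R y) has_derivative
      (\<lambda>h. D (h - (conormal c \<bullet> h) *\<^sub>R ?y) + (4 * (conormal c \<bullet> h)) *\<^sub>R ?y)) (at ?y)"
    by (simp add: m p Ec ramp_values(3))
  then show ?thesis
  proof (rule has_derivative_transform_within_open[OF _ \<open>open W\<close> \<open>?y \<in> W\<close>])
    fix z assume "z \<in> W"
    then have "z \<noteq> 0" "radial z \<in> U" by (auto simp: W_def)
    then show "(1 - ramp (minkowski z) * ramp (minkowski z)) *\<^sub>R E (radial z) + ramp (minkowski z) *\<^sub>R z = field z"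
      using U(3) radial_in_frontier by (simp add: field_def power2_eq_square)
  qed
qed

lemma critical_sign:
  assumes Morse: "Morse_function_on M f" and c: "c \<in> M" "G c = 0"
    and V': "(field has_derivative V') (at (c - x0))"
  shows "inj V'" and "sgn (linear_det V') = (- 1) ^ Morse_index M f c"
proof -
  obtain U E where U: "open U" "c \<in> U" "C1_map_on U E" "\<And>z. \<lbrakk>z \<in> U; z \<in> M\<rbrakk> \<Longrightarrow> G z = E z"
    and Dnu: "\<And>D v. \<lbrakk>G c = 0; (E has_derivative D) (at c)\<rbrakk> \<Longrightarrow> nu c \<bullet> D v = 0"
    and Dsym: "\<And>D v w. \<lbrakk>G c = 0; (E has_derivative D) (at c); nu c \<bullet> v = 0; nu c \<bullet> w = 0\<rbrakk> \<Longrightarrow> D v \<bullet> w = v \<bullet> D w"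
    by (rule local_gradient_field[OF c(1)]) (rule that)
  obtain D where D: "(E has_derivative D) (at c)"
    using U(2,3) by (elim C1_map_onE) blast
  have hess: "surface_hessian M f c v = D v" if "nu c \<bullet> v = 0" for v
    by (rule surface_hessian_eq[OF c(1) U(1,2,4) D Dnu[OF c(2) D] that])
  have linD: "linear D"
    using D by (rule has_derivative_linear)
  have linV: "linear V'"
    using V' by (rule has_derivative_linear)
  have V'_eq: "V' h = D (h - (conormal c \<bullet> h) *\<^sub>R (c - x0)) + (4 * (conormal c \<bullet> h)) *\<^sub>R (c - x0)" for h
    using has_derivative_unique[OF V' has_derivative_field_critical[OF c U(1,2,4) D]] by simp
  have A: "V' v = D v" if "nu c \<bullet> v = 0" for v
    using that by (simp add: V'_eq conormal_def)
  have B: "V' (c - x0) = 4 *\<^sub>R (c - x0)"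
    using conormal_inner_self[OF c(1)] linear_0[OF linD] by (simp add: V'_eq)
  have nz: "nu c \<bullet> (c - x0) \<noteq> 0"
    using nu_inner_pos[OF c(1)] by simp
  \<comment> \<open>The Morse condition enters here, as injectivity of
    \<open>surface_hessian\<close> on the tangent space, where it agrees with
    \<open>D\<close>.\<close>
  have ker: "v = 0" if v: "nu c \<bullet> v = 0" "D v = 0" for v
  proof -
    have "critical_point M f c"
      using c by (simp add: critical_point_def)
    then have "bij_betw (surface_hessian M f c) (tangent_space M c) (tangent_space M c)"
      using Morse unfolding Morse_function_on_def by blast
    then have "inj_on (surface_hessian M f c) {v. nu c \<bullet> v = 0}"
      unfolding tangent_space_eq[OF c(1)] by (rule bij_betw_imp_inj_on)
    moreover have "surface_hessian M f c v = surface_hessian M f c 0"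
      using hess[of v] hess[of 0] v linear_0[OF linD] by simp
    ultimately show ?thesis
      using v(1) by (auto dest: inj_onD)
  qed
  show "inj V'"
    by (rule sgn_det_eq_parity(1)[OF linV A B _ nz linD Dnu[OF c(2) D] Dsym[OF c(2) D] ker]) simp_all
  show "sgn (linear_det V') = (- 1) ^ Morse_index M f c"
    by (subst Morse_index_eq[OF c(1) hess], assumption, rule sgn_det_eq_parity(2)[OF linV A B _ nz linD Dnu[OF c(2) D] Dsym[OF c(2) D] ker]) simp_all
qed

lemma linear_det_uminus: "linear_det (\<lambda>v::'a. - v) = (- 1) ^ DIM('a)"
proof -
  have "linear_det (\<lambda>v::'a. - v) = (\<Prod>b\<in>(Basis :: 'a set). - 1)"
    by (rule linear_det_eigenbasis)
      (auto intro!: linear_compose_neg linear_id[unfolded id_def] independent_Basis)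
  then show ?thesis by simp
qed

theorem Morse_sum:
  assumes Morse: "Morse_function_on M f"
  shows "finite {c \<in> M. G c = 0}"
    and "(\<Sum>c | c \<in> M \<and> G c = 0. (- 1 :: int) ^ Morse_index M f c) = 1 - (- 1) ^ DIM('a)"
proof -
  let ?K = "{c \<in> M. G c = 0}"
  obtain V' where V': "\<And>x. (field has_derivative blinfun_apply (V' x)) (at x)" and cont: "continuous_on UNIV V'"
    by (rule C1_map_on_blinfun[OF C1_map_on_field]) (rule that, auto)
  obtain R where R: "\<And>y. R < norm y \<Longrightarrow> field y = y"
    by (rule field_far) (rule that)
  have V'0: "blinfun_apply (V' 0) = (\<lambda>v. - v)"
  proof -
    obtain U where U: "open U" "0 \<in> U" "\<And>y. y \<in> U \<Longrightarrow> field y = - y"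
      by (rule field_near_0) (rule that)
    have "(field has_derivative (\<lambda>v. - v)) (at 0)"
      by (rule has_derivative_transform_within_open[OF has_derivative_minus[OF has_derivative_ident] U(1,2)])
        (simp add: U(3))
    then show ?thesis
      using V' has_derivative_unique by blast
  qed
  have inj: "inj (V' y)" if "field y = 0" for y
  proof (cases "y = 0")
    case True
    then show ?thesis by (simp add: V'0 inj_def)
  next
    case False
    then obtain c where c: "c \<in> M" "G c = 0" "y = c - x0"
      using \<open>field y = 0\<close> unfolding field_zero_iff by blast
    show ?thesis
      unfolding c(3) by (rule critical_sign(1)[OF Morse c(1,2) V'])
  qed
  have zeros: "{y. field y = 0} = insert 0 ((\<lambda>c. c - x0) ` ?K)"
    using field_zero_iff by auto
  note deg = sum_signs_of_zeros[OF V' cont R inj]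
  have injx: "inj_on (\<lambda>c. c - x0) A" for A
    by (simp add: inj_on_def)
  have "finite ((\<lambda>c. c - x0) ` ?K)"
    by (rule finite_subset[OF _ deg(1)]) (simp add: zeros subset_insertI)
  then show fin: "finite ?K"
    by (rule finite_imageD[OF _ injx])
  have "0 \<notin> (\<lambda>c. c - x0) ` ?K"
    using frontier_not_x0 by auto
  then have "1 = sgn (linear_det (V' 0)) + (\<Sum>y\<in>(\<lambda>c. c - x0) ` ?K. sgn (linear_det (V' y)))"
    using deg(2) fin unfolding zeros by simp
  also have "sgn (linear_det (V' 0)) = (- 1) ^ DIM('a)"
    unfolding V'0 linear_det_uminus by (cases "even DIM('a)") simp_all
  also have "(\<Sum>y\<in>(\<lambda>c. c - x0) ` ?K. sgn (linear_det (V' y))) = (\<Sum>c\<in>?K. sgn (linear_det (V' (c - x0))))"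
    by (simp add: sum.reindex[OF injx])
  also have "\<dots> = (\<Sum>c\<in>?K. (- 1) ^ Morse_index M f c)"
    by (intro sum.cong refl critical_sign(2)[OF Morse _ _ V']) auto
  finally have "(\<Sum>c\<in>?K. (- 1) ^ Morse_index M f c) = (1 :: real) - (- 1) ^ DIM('a)"
    by simp
  then have "real_of_int (\<Sum>c\<in>?K. (- 1) ^ Morse_index M f c) = real_of_int (1 - (- 1) ^ DIM('a))"
    by simp
  then show "(\<Sum>c | c \<in> M \<and> G c = 0. (- 1 :: int) ^ Morse_index M f c) = 1 - (- 1) ^ DIM('a)"
    using of_int_eq_iff by blast
qed

end

section \<open>Return map and critical points\<close>

text \<open>The direction n - m lies in the cone around \<open>n\<close>, which is locally inside
  \<open>S\<close>, and in the cone opposite to \<open>m\<close>, which is locally outside.\<close>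

lemma inward_normal_unique:
  assumes "is_inward_normal S x n" "is_inward_normal S x m"
  shows "n = m"
proof (rule ccontr)
  assume "n \<noteq> m"
  have n: "norm n = 1" "n \<bullet> n = 1" and m: "norm m = 1" "m \<bullet> m = 1"
    using assms by (auto simp: is_inward_normal_def norm_eq_1)
  define w where "w = n - m"
  have "w \<noteq> 0" using \<open>n \<noteq> m\<close> by (simp add: w_def)
  have "0 < w \<bullet> w" using \<open>w \<noteq> 0\<close> by simp
  then have nm: "n \<bullet> m < 1"
    using n m by (simp add: w_def inner_simps inner_commute)
  \<comment> \<open>Along \<open>w\<close> the slopes of \<open>n\<close> and \<open>m\<close> are
    plus and minus 1 - n \<bullet> m; half of this relative to |w| is an aperture for which
    \<open>w\<close> lies strictly inside both cones.\<close>
  define \<epsilon> where "\<epsilon> = (1 - n \<bullet> m) / (2 * norm w)"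
  have "0 < \<epsilon>" using nm \<open>w \<noteq> 0\<close> by (simp add: \<epsilon>_def)
  have \<epsilon>w: "\<epsilon> * norm w < 1 - n \<bullet> m"
    using nm \<open>w \<noteq> 0\<close> by (simp add: \<epsilon>_def)
  have "\<forall>\<^sub>F y in at x. n \<bullet> (y - x) > \<epsilon> * norm (y - x) \<longrightarrow> y \<in> S"
    using assms(1) \<open>0 < \<epsilon>\<close> unfolding is_inward_normal_def by (blast intro: eventually_mono)
  moreover have "\<forall>\<^sub>F y in at x. m \<bullet> (y - x) < - \<epsilon> * norm (y - x) \<longrightarrow> y \<notin> S"
    using assms(2) \<open>0 < \<epsilon>\<close> unfolding is_inward_normal_def by (blast intro: eventually_mono)
  ultimately have "\<forall>\<^sub>F y in at x. (n \<bullet> (y - x) > \<epsilon> * norm (y - x) \<longrightarrow> y \<in> S) \<and>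
      (m \<bullet> (y - x) < - \<epsilon> * norm (y - x) \<longrightarrow> y \<notin> S)"
    by (rule eventually_conj)
  then obtain d where d: "0 < d" "\<And>y. \<lbrakk>y \<noteq> x; dist y x < d\<rbrakk> \<Longrightarrow> (n \<bullet> (y - x) > \<epsilon> * norm (y - x) \<longrightarrow> y \<in> S) \<and>
      (m \<bullet> (y - x) < - \<epsilon> * norm (y - x) \<longrightarrow> y \<notin> S)"
    unfolding eventually_at by auto
  define t where "t = d / (2 * norm w)"
  have t: "0 < t" "t * norm w < d"
    using d(1) \<open>w \<noteq> 0\<close> by (auto simp: t_def)
  let ?y = "x + t *\<^sub>R w"
  have yx: "?y - x = t *\<^sub>R w" by simp
  have nw: "n \<bullet> w = 1 - n \<bullet> m" "m \<bullet> w = - (1 - n \<bullet> m)"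
    using n(2) m(2) by (simp_all add: w_def inner_diff_right inner_commute)
  have lt: "\<epsilon> * norm (?y - x) < t * (1 - n \<bullet> m)"
    unfolding yx using mult_strict_left_mono[OF \<epsilon>w t(1)] t(1) by (simp add: mult_ac)
  have "n \<bullet> (?y - x) > \<epsilon> * norm (?y - x)"
    using lt unfolding yx inner_scaleR_right nw .
  moreover have "m \<bullet> (?y - x) < - \<epsilon> * norm (?y - x)"
    using lt unfolding yx inner_scaleR_right nw
    by (simp only: mult_minus_right mult_minus_left neg_less_iff_less)
  ultimately show False
    using d(2)[of ?y] t \<open>w \<noteq> 0\<close> by (simp add: dist_norm)
qed

lemma inward_normal_eqI:
  assumes "is_inward_normal S x n"
  shows "inward_normal S x = n"
  unfolding inward_normal_def using assms inward_normal_unique by blast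

text \<open>Inside a cone about the gradient direction the linear part of \<open>u\<close> exceeds
  the remainder and decides the sign of \<open>u\<close>. The normal points against the gradient
  because \<open>S\<close> is where \<open>u\<close> is negative.\<close>

lemma is_inward_normal_sublevel:
  fixes u :: "'a::euclidean_space \<Rightarrow> real"
  assumes u: "(u has_derivative (\<lambda>h. g \<bullet> h)) (at x)" "u x = 0" "g \<noteq> 0"
    and S: "\<forall>\<^sub>F y in at x. y \<in> S \<longleftrightarrow> u y < 0"
  shows "is_inward_normal S x (- g /\<^sub>R norm g)"
  unfolding is_inward_normal_def
proof (intro conjI allI impI)
  show "norm (- g /\<^sub>R norm g) = 1" using u(3) by simp
  fix \<epsilon> :: real assume "0 < \<epsilon>"
  define e where "e = \<epsilon> * norm g"
  have "0 < e" using \<open>0 < \<epsilon>\<close> u(3) by (simp add: e_def)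
  then obtain d where d: "0 < d" "\<And>y. norm (y - x) < d \<Longrightarrow> norm (u y - u x - g \<bullet> (y - x)) \<le> e * norm (y - x)"
    using u(1) unfolding has_derivative_at_alt by blast
  have "\<forall>\<^sub>F y in at x. norm (y - x) < d"
    unfolding eventually_at using d(1) by (auto simp: dist_norm)
  with S show "\<forall>\<^sub>F y in at x. ((- g /\<^sub>R norm g) \<bullet> (y - x) > \<epsilon> * norm (y - x) \<longrightarrow> y \<in> S) \<and>
      ((- g /\<^sub>R norm g) \<bullet> (y - x) < - \<epsilon> * norm (y - x) \<longrightarrow> y \<notin> S)"
  proof eventually_elim
    case (elim y)
    have bound: "\<bar>u y - g \<bullet> (y - x)\<bar> \<le> e * norm (y - x)"
      using d(2)[OF elim(2)] u(2) by simp
    have scale: "norm g * ((- g /\<^sub>R norm g) \<bullet> (y - x)) = - (g \<bullet> (y - x))"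
      using u(3) by simp
    show ?case
    proof (intro conjI impI)
      assume "(- g /\<^sub>R norm g) \<bullet> (y - x) > \<epsilon> * norm (y - x)"
      then have "norm g * (\<epsilon> * norm (y - x)) < norm g * ((- g /\<^sub>R norm g) \<bullet> (y - x))"
        using u(3) by (intro mult_strict_left_mono) auto
      then have "e * norm (y - x) < - (g \<bullet> (y - x))"
        unfolding scale by (simp add: e_def mult_ac)
      then show "y \<in> S"
        using bound elim(1) by linarith
    next
      assume "(- g /\<^sub>R norm g) \<bullet> (y - x) < - \<epsilon> * norm (y - x)"
      then have "norm g * ((- g /\<^sub>R norm g) \<bullet> (y - x)) < norm g * (- \<epsilon> * norm (y - x))"
        using u(3) by (intro mult_strict_left_mono) auto
      then have "e * norm (y - x) < g \<bullet> (y - x)"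
        unfolding scale by (simp add: e_def mult_ac)
      then show "y \<notin> S"
        using bound elim(1) by linarith
    qed
  qed
qed

section \<open>Normal coordinates outside the body\<close>

context smooth_convex_body
begin

abbreviation proj :: "'a \<Rightarrow> 'a" where "proj \<equiv> closest_point C"

definition height :: "'a \<Rightarrow> real" where
  "height y = norm (y - proj y)"

lemma C_ne: "C \<noteq> {}"
  using x0 interior_subset by blast

lemma proj_in_C: "proj y \<in> C"
  by (rule closest_point_in_set[OF closed C_ne])

text \<open>By the obtuse angle property of the nearest point, y - proj y normalised is a supporting
  normal at \<open>proj y\<close>, and supporting normals are unique. Hence every exterior point has
  normal coordinates \<open>proj y\<close> and \<open>height y\<close>.\<close>

lemma
  assumes y: "y \<notin> C"
  shows proj_in_frontier: "proj y \<in> M" and height_pos: "0 < height y"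
    and eq_proj_plus_normal: "y = proj y + height y *\<^sub>R nu (proj y)"
proof -
  show "proj y \<in> M"
  proof -
    have int: "interior C \<noteq> {}" using x0 by blast
    have "y \<in> affine hull C - rel_interior C"
      using y interior_subset[of C]
      by (auto simp: affine_hull_nonempty_interior[OF int] rel_interior_nonempty_interior[OF int])
    then have "proj y \<in> rel_frontier C"
      by (rule closest_point_in_rel_frontier[OF closed C_ne])
    then show ?thesis by (simp add: rel_frontier_nonempty_interior[OF int])
  qed
  have ne: "y - proj y \<noteq> 0"
    using proj_in_C[of y] y by (metis eq_iff_diff_eq_0)
  then show h: "0 < height y"
    by (simp add: height_def)
  have "nu (proj y) = (y - proj y) /\<^sub>R norm (y - proj y)"
  proof (rule nu_eqI[OF \<open>proj y \<in> M\<close>])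
    fix z assume "z \<in> C"
    then have "(y - proj y) \<bullet> (z - proj y) \<le> 0"
      using closest_point_dot[OF convex closed] by blast
    then show "((y - proj y) /\<^sub>R norm (y - proj y)) \<bullet> (z - proj y) \<le> 0"
      by (simp add: mult_nonneg_nonpos)
  qed (use ne in simp)
  then show "y = proj y + height y *\<^sub>R nu (proj y)"
    using ne by (simp add: height_def)
qed

lemma
  assumes c: "c \<in> M" and t: "0 \<le> t"
  shows proj_normal: "proj (c + t *\<^sub>R nu c) = c" and height_normal: "height (c + t *\<^sub>R nu c) = t"
proof -
  show "proj (c + t *\<^sub>R nu c) = c"
  proof (rule closest_point_unique[OF convex closed frontier_subset[OF c], symmetric])
    show "\<forall>z\<in>C. dist (c + t *\<^sub>R nu c) c \<le> dist (c + t *\<^sub>R nu c) z"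
    proof
      fix z assume z: "z \<in> C"
      have "t \<le> nu c \<bullet> (c + t *\<^sub>R nu c - z)"
        using nu_support[OF c z] nu_inner_nu[OF c] by (simp add: inner_simps)
      also have "\<dots> \<le> norm (nu c) * norm (c + t *\<^sub>R nu c - z)"
        by (rule norm_cauchy_schwarz)
      finally show "dist (c + t *\<^sub>R nu c) c \<le> dist (c + t *\<^sub>R nu c) z"
        using t norm_nu[OF c] by (simp add: dist_norm)
    qed
  qed
  then show "height (c + t *\<^sub>R nu c) = t"
    using t norm_nu[OF c] by (simp add: height_def)
qed

lemma not_in_C_normal:
  assumes "c \<in> M" "0 < t"
  shows "c + t *\<^sub>R nu c \<notin> C"
  using nu_support[OF assms(1), of "c + t *\<^sub>R nu c"] nu_inner_nu[OF assms(1)] assms(2) by auto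

text \<open>Points of the outer cone violate the supporting inequality. A point \<open>y\<close> of
  the inner cone outside \<open>C\<close> would be its foot m plus a positive multiple of
  \<open>nu m\<close>. Near \<open>c\<close> the product of \<open>nu m\<close> with
  \<open>nu c\<close> is nonnegative, and m deviates from the tangent plane by at most \<epsilon> |m
  - c| \<le> \<epsilon> |y - c|, so \<open>y\<close> could not lie that deep below the
  plane.\<close>

lemma inward_normal_C:
  assumes c: "c \<in> M"
  shows "is_inward_normal C c (- nu c)"
  unfolding is_inward_normal_def
proof (intro conjI allI impI)
  show "norm (- nu c) = 1" using norm_nu[OF c] by simp
  fix \<epsilon> :: real assume "0 < \<epsilon>"
  have "((\<lambda>z. nu c \<bullet> (z - c)) has_derivative (\<lambda>h. 0)) (at c within M)"
    by (rule local_normal_field[OF c]) assumption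
  then obtain d1 where d1: "0 < d1" "\<And>z. \<lbrakk>z \<in> M; norm (z - c) < d1\<rbrakk> \<Longrightarrow> \<bar>nu c \<bullet> (z - c)\<bar> \<le> \<epsilon> * norm (z - c)"
    using \<open>0 < \<epsilon>\<close> unfolding has_derivative_within_alt by fastforce
  obtain d2 where d2: "0 < d2" "\<And>z. \<lbrakk>z \<in> M; dist z c < d2\<rbrakk> \<Longrightarrow> dist (nu z) (nu c) < 1"
    using continuous_on_nu c unfolding continuous_on_iff by (metis zero_less_one)
  have "\<forall>\<^sub>F y in at c. dist y c < min d1 d2"
    unfolding eventually_at using d1(1) d2(1) by (intro exI[of _ "min d1 d2"]) auto
  then show "\<forall>\<^sub>F y in at c. (- nu c \<bullet> (y - c) > \<epsilon> * norm (y - c) \<longrightarrow> y \<in> C) \<and>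
      (- nu c \<bullet> (y - c) < - \<epsilon> * norm (y - c) \<longrightarrow> y \<notin> C)"
  proof eventually_elim
    case (elim y)
    show ?case
    proof (intro conjI impI)
      assume "- nu c \<bullet> (y - c) < - \<epsilon> * norm (y - c)"
      then have "\<epsilon> * norm (y - c) < nu c \<bullet> (y - c)" by simp
      moreover have "0 \<le> \<epsilon> * norm (y - c)" using \<open>0 < \<epsilon>\<close> by simp
      ultimately show "y \<notin> C"
        using nu_support[OF c, of y] by linarith
    next
      assume *: "- nu c \<bullet> (y - c) > \<epsilon> * norm (y - c)"
      show "y \<in> C"
      proof (rule ccontr)
        assume y: "y \<notin> C"
        let ?m = "proj y"
        have m: "?m \<in> M" by (rule proj_in_frontier[OF y])
        have "dist ?m (proj c) \<le> dist y c"
          by (rule closest_point_lipschitz[OF convex closed C_ne])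
        then have le: "norm (?m - c) \<le> norm (y - c)"
          using closest_point_self[OF frontier_subset[OF c]] by (simp add: dist_norm)
        then have near: "norm (?m - c) < d1" "dist ?m c < d2"
          using elim by (auto simp: dist_norm)
        have "0 \<le> nu c \<bullet> nu ?m"
        proof -
          have "norm (nu ?m - nu c) < 1"
            using d2(2)[OF m near(2)] by (simp add: dist_norm)
          then have "(nu ?m - nu c) \<bullet> (nu ?m - nu c) \<le> 1"
            by (simp add: dot_square_norm power_le_one)
          then show ?thesis
            using nu_inner_nu[OF c] nu_inner_nu[OF m] by (simp add: inner_simps inner_commute)
        qed
        then have "0 \<le> height y * (nu c \<bullet> nu ?m)"
          using height_pos[OF y] by simp
        moreover have "nu c \<bullet> (y - c) = nu c \<bullet> (?m - c) + height y * (nu c \<bullet> nu ?m)"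
          by (subst (1) eq_proj_plus_normal[OF y]) (simp add: inner_simps)
        moreover have "\<bar>nu c \<bullet> (?m - c)\<bar> \<le> \<epsilon> * norm (?m - c)"
          by (rule d1(2)[OF m near(1)])
        moreover have "\<epsilon> * norm (?m - c) \<le> \<epsilon> * norm (y - c)"
          using le \<open>0 < \<epsilon>\<close> by simp
        ultimately show False using * by simp
      qed
    qed
  qed
qed

lemma outward_normal_C: "c \<in> M \<Longrightarrow> outward_normal C c = nu c"
  using inward_normal_eqI[OF inward_normal_C] by (simp add: outward_normal_def)

end

section \<open>Differentiability of distance and nearest point\<close>

lemma has_derivative_squeeze:
  fixes f :: "'a::real_normed_vector \<Rightarrow> real"
  assumes "(l has_derivative D) (at x)" "(u has_derivative D) (at x)"
    and "\<And>y. l y \<le> f y" "\<And>y. f y \<le> u y" "l x = f x" "u x = f x"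
  shows "(f has_derivative D) (at x)"
  unfolding has_derivative_at_alt
proof (intro conjI allI impI)
  show "bounded_linear D" using assms(1) by (rule has_derivative_bounded_linear)
  fix e :: real assume "0 < e"
  obtain d1 where d1: "0 < d1" "\<And>y. norm (y - x) < d1 \<Longrightarrow> norm (l y - l x - D (y - x)) \<le> e * norm (y - x)"
    using assms(1) \<open>0 < e\<close> unfolding has_derivative_at_alt by blast
  obtain d2 where d2: "0 < d2" "\<And>y. norm (y - x) < d2 \<Longrightarrow> norm (u y - u x - D (y - x)) \<le> e * norm (y - x)"
    using assms(2) \<open>0 < e\<close> unfolding has_derivative_at_alt by blast
  show "\<exists>d>0. \<forall>y. norm (y - x) < d \<longrightarrow> norm (f y - f x - D (y - x)) \<le> e * norm (y - x)"
  proof (intro exI[of _ "min d1 d2"] conjI allI impI)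
    fix y assume "norm (y - x) < min d1 d2"
    then show "norm (f y - f x - D (y - x)) \<le> e * norm (y - x)"
      using d1(2)[of y] d2(2)[of y] assms(3)[of y] assms(4)[of y] assms(5,6) by auto
  qed (use d1 d2 in simp)
qed

lemma has_derivative_eventually_bound:
  fixes f :: "'a::real_normed_vector \<Rightarrow> 'b::real_normed_vector"
  assumes "(f has_derivative D) (at x within S)" "0 < e"
  obtains d where "0 < d" "\<And>y. \<lbrakk>y \<in> S; norm (y - x) < d\<rbrakk> \<Longrightarrow> norm (f y - f x - D (y - x)) \<le> e * norm (y - x)"
  using assms unfolding has_derivative_within_alt by blast

lemma difference_quotient_tendsto:
  fixes f :: "real \<Rightarrow> 'a::real_normed_vector"
  assumes "(f has_derivative (\<lambda>h. h *\<^sub>R D)) (at 0)"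
  shows "((\<lambda>s. (f s - f 0) /\<^sub>R s) \<longlongrightarrow> D) (at 0)"
proof -
  have "((\<lambda>s. norm (f (0 + s) - f 0 - s *\<^sub>R D) / norm s) \<longlongrightarrow> 0) (at 0)"
    using assms unfolding has_derivative_at by blast
  moreover have "\<forall>\<^sub>F s in at 0. norm (f (0 + s) - f 0 - s *\<^sub>R D) / norm s = norm ((f s - f 0) /\<^sub>R s - D)"
    unfolding eventually_at_filter
  proof (rule always_eventually, intro allI impI)
    fix s :: real assume "s \<noteq> 0"
    then have "(f s - f 0) /\<^sub>R s - D = (f (0 + s) - f 0 - s *\<^sub>R D) /\<^sub>R s"
      by (simp add: scaleR_diff_right)
    then show "norm (f (0 + s) - f 0 - s *\<^sub>R D) / norm s = norm ((f s - f 0) /\<^sub>R s - D)"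
      by (simp add: divide_inverse mult.commute)
  qed
  ultimately have "((\<lambda>s. norm ((f s - f 0) /\<^sub>R s - D)) \<longlongrightarrow> 0) (at 0)"
    by (rule Lim_transform_eventually)
  then have "((\<lambda>s. (f s - f 0) /\<^sub>R s - D) \<longlongrightarrow> 0) (at 0)"
    by (rule tendsto_norm_zero_cancel)
  then show ?thesis by (rule LIM_zero_cancel)
qed

context smooth_convex_body
begin

lemma proj_dist_le:
  assumes c: "c \<in> M" and t: "0 \<le> t"
  shows "norm (proj y - c) \<le> norm (y - (c + t *\<^sub>R nu c))"
  using closest_point_lipschitz[OF convex closed C_ne, of y "c + t *\<^sub>R nu c"]
  by (simp add: proj_normal[OF c t] dist_norm)

text \<open>The height lies between the signed distance to the tangent hyperplane at
  \<open>c\<close> and the distance to the point \<open>c\<close>; these bounds touch at c + t nu c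
  and have the same gradient \<open>nu c\<close> there.\<close>

lemma has_derivative_height:
  assumes c: "c \<in> M" and t: "0 < t"
  shows "(height has_derivative (\<lambda>h. nu c \<bullet> h)) (at (c + t *\<^sub>R nu c))"
proof (rule has_derivative_squeeze)
  let ?x = "c + t *\<^sub>R nu c"
  show "((\<lambda>y. nu c \<bullet> (y - c)) has_derivative (\<lambda>h. nu c \<bullet> h)) (at ?x)"
    by (auto intro!: derivative_eq_intros)
  have "?x - c \<noteq> 0"
    using t norm_nu[OF c] by auto
  then have "(norm has_derivative (\<lambda>h. h \<bullet> sgn (?x - c))) (at (?x - c))"
    by (rule has_derivative_norm)
  moreover have "sgn (?x - c) = nu c"
    using t norm_nu[OF c] by (simp add: sgn_div_norm)
  ultimately have "(norm has_derivative (\<lambda>h. nu c \<bullet> h)) (at (?x - c))"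
    by (simp add: inner_commute)
  moreover have "((\<lambda>y. y - c) has_derivative (\<lambda>h. h)) (at ?x)"
    by (auto intro!: derivative_eq_intros)
  ultimately show "((\<lambda>y. norm (y - c)) has_derivative (\<lambda>h. nu c \<bullet> h)) (at ?x)"
    by (rule has_derivative_compose[rotated])
  show "nu c \<bullet> (y - c) \<le> height y" for y
  proof -
    have "nu c \<bullet> (y - c) = nu c \<bullet> (y - proj y) + nu c \<bullet> (proj y - c)"
      by (simp add: inner_diff_right)
    also have "\<dots> \<le> norm (nu c) * norm (y - proj y) + 0"
      using norm_cauchy_schwarz nu_support[OF c proj_in_C] by (intro add_mono) auto
    finally show ?thesis
      using norm_nu[OF c] by (simp add: height_def)
  qed
  show "height y \<le> norm (y - c)" for y
    using closest_point_le[OF closed frontier_subset[OF c], of y] by (simp add: height_def dist_norm)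
  show "nu c \<bullet> (?x - c) = height ?x"
    using t nu_inner_nu[OF c] by (simp add: height_normal[OF c])
  show "norm (?x - c) = height ?x"
    using t norm_nu[OF c] by (simp add: height_normal[OF c])
qed

text \<open>Convexity makes the normal a monotone map, so the shape operator is positive semidefinite.\<close>

lemma shape_nonneg:
  assumes c: "c \<in> M" and N: "(N has_derivative N') (at c)" and U: "open U" "c \<in> U"
    and Nnu: "\<And>z. \<lbrakk>z \<in> U; z \<in> M\<rbrakk> \<Longrightarrow> N z = nu z" and v: "nu c \<bullet> v = 0"
  shows "0 \<le> N' v \<bullet> v"
proof -
  have "v \<in> tangent_space M c"
    using v by (simp add: tangent_space_eq[OF c])
  then obtain \<beta> and e :: real where \<beta>: "0 < e" "\<beta> ` {-e<..<e} \<subseteq> M" "\<beta> 0 = c"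
    "(\<beta> has_vector_derivative v) (at 0)"
    unfolding tangent_space_def by blast
  have \<beta>': "(\<beta> has_derivative (\<lambda>h. h *\<^sub>R v)) (at 0)"
    using \<beta>(4) by (simp add: has_vector_derivative_def)
  have linN: "linear N'"
    using N by (rule has_derivative_linear)
  have "((\<lambda>s. N (\<beta> s)) has_derivative (\<lambda>h. N' (h *\<^sub>R v))) (at 0)"
    by (rule has_derivative_compose[OF \<beta>']) (simp add: \<beta>(3) N)
  then have N\<beta>': "((\<lambda>s. N (\<beta> s)) has_derivative (\<lambda>h. h *\<^sub>R N' v)) (at 0)"
    by (simp add: linear_cmul[OF linN])
  have lim: "((\<lambda>s. ((N (\<beta> s) - N (\<beta> 0)) /\<^sub>R s) \<bullet> ((\<beta> s - \<beta> 0) /\<^sub>R s)) \<longlongrightarrow> N' v \<bullet> v) (at 0)"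
    by (intro tendsto_inner difference_quotient_tendsto N\<beta>' \<beta>')
  have "isCont \<beta> 0"
    using \<beta>' by (rule has_derivative_continuous)
  then have "\<forall>\<^sub>F s in at 0. \<beta> s \<in> U"
    using U \<beta>(3) unfolding isCont_def by (metis topological_tendstoD)
  moreover have "\<forall>\<^sub>F s in at (0::real). s \<in> {-e<..<e}"
    using \<beta>(1) by (intro eventually_at_in_open') auto
  ultimately have "\<forall>\<^sub>F s in at 0. 0 \<le> ((N (\<beta> s) - N (\<beta> 0)) /\<^sub>R s) \<bullet> ((\<beta> s - \<beta> 0) /\<^sub>R s)"
  proof eventually_elim
    case (elim s)
    have z: "\<beta> s \<in> M" using elim(2) \<beta>(2) by blast
    have "N (\<beta> s) = nu (\<beta> s)" "N (\<beta> 0) = nu c"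
      using Nnu elim(1) z U(2) c \<beta>(3) by auto
    \<comment> \<open>The supporting inequalities at the two points add up to monotonicity of the
      normal.\<close>
    moreover have "nu (\<beta> s) \<bullet> (c - \<beta> s) \<le> 0" "nu c \<bullet> (\<beta> s - c) \<le> 0"
      using nu_support z c frontier_subset by auto
    ultimately have "0 \<le> (N (\<beta> s) - N (\<beta> 0)) \<bullet> (\<beta> s - \<beta> 0)"
      by (simp add: \<beta>(3) inner_simps)
    then have "0 \<le> (inverse s)\<^sup>2 * ((N (\<beta> s) - N (\<beta> 0)) \<bullet> (\<beta> s - \<beta> 0))"
      by (intro mult_nonneg_nonneg) auto
    then show ?case
      by (simp add: power2_eq_square mult.assoc)
  qed
  then show ?thesis
    by (intro tendsto_lowerbound[OF lim]) auto
qed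

text \<open>\<open>L\<close> is the differential of z + t nu z on tangent vectors, extended by the
  identity along the normal. A kernel vector is tangent and satisfies v \<bullet> v + t (N' v
  \<bullet> v) = 0, which forces v = 0 as the shape operator is nonnegative: a convex body has no
  focal points outside.\<close>

lemma proj_derivative_kernel:
  assumes c: "c \<in> M" and N: "(N has_derivative N') (at c)" and U: "open U" "c \<in> U"
    and Nnu: "\<And>z. \<lbrakk>z \<in> U; z \<in> M\<rbrakk> \<Longrightarrow> N z = nu z" and Nunit: "\<And>z. z \<in> U \<Longrightarrow> norm (N z) = 1"
    and t: "0 < t"
  defines "L \<equiv> \<lambda>v. v + t *\<^sub>R N' (v - (nu c \<bullet> v) *\<^sub>R nu c)"
  shows "linear L" and "nu c \<bullet> L v = nu c \<bullet> v" and "inj L"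
proof -
  have linN: "linear N'"
    using N by (rule has_derivative_linear)
  have Nc: "N c = nu c" using Nnu U(2) c by blast
  have NN: "nu c \<bullet> N' w = 0" for w
  proof -
    have "((\<lambda>z. N z \<bullet> N z) has_derivative (\<lambda>w. N c \<bullet> N' w + N' w \<bullet> N c)) (at c)"
      by (rule has_derivative_inner[OF N N])
    moreover have "((\<lambda>z. N z \<bullet> N z) has_derivative (\<lambda>w. 0)) (at c)"
      by (rule has_derivative_transform_within_open[OF has_derivative_const U]) (use Nunit in \<open>simp add: norm_eq_1\<close>)
    ultimately have "(\<lambda>w. N c \<bullet> N' w + N' w \<bullet> N c) = (\<lambda>w. 0)"
      by (rule has_derivative_unique)
    from fun_cong[OF this, of w] show ?thesis by (simp add: Nc inner_commute)
  qed
  show "linear L"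
    unfolding L_def
    by (rule linearI)
      (simp_all add: linear_add[OF linN] linear_diff[OF linN] linear_cmul[OF linN] inner_simps algebra_simps)
  show L_nu: "nu c \<bullet> L v = nu c \<bullet> v" for v
    by (simp add: L_def inner_add_right NN)
  have "v = 0" if "L v = 0" for v
  proof -
    have "nu c \<bullet> v = 0"
      using L_nu[of v] that by simp
    moreover from this have "v \<bullet> v + t * (N' v \<bullet> v) = 0"
      using that by (metis L_def diff_zero inner_add_left inner_scaleR_left inner_zero_left scaleR_zero_left)
    moreover have "0 \<le> N' v \<bullet> v"
      by (rule shape_nonneg[OF c N U Nnu \<open>nu c \<bullet> v = 0\<close>])
    ultimately have "v \<bullet> v \<le> 0"
      using t by (smt (verit) mult_nonneg_nonneg)
    then show ?thesis
      using inner_ge_zero[of v] by (metis antisym inner_eq_zero_iff)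
  qed
  then show "inj L"
    using linear_injective_0[OF \<open>linear L\<close>] by blast
qed

text \<open>Write \<open>y = z + height y \<cdot> nu z\<close> with \<open>z = proj y\<close>. Linearising at \<open>x = c + t \<cdot> nu c\<close> gives
  \<open>L (z - c) = h - (nu c \<bullet> h) nu c + o(h)\<close> for \<open>h = y - x\<close>, and \<open>L\<close> is invertible.\<close>

lemma has_derivative_proj:
  assumes c: "c \<in> M" and t: "0 < t"
  obtains L K where "linear L" "linear K" "\<And>v. K (L v) = v" "\<And>v. nu c \<bullet> L v = nu c \<bullet> v"
    "(proj has_derivative (\<lambda>h. K (h - (nu c \<bullet> h) *\<^sub>R nu c))) (at (c + t *\<^sub>R nu c))"
proof -
  obtain U N where U: "open U" "c \<in> U" and N1: "C1_map_on U N" and Nunit: "\<And>z. z \<in> U \<Longrightarrow> norm (N z) = 1"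
    and Nnu: "\<And>z. \<lbrakk>z \<in> U; z \<in> M\<rbrakk> \<Longrightarrow> N z = nu z"
    and flat: "((\<lambda>z. nu c \<bullet> (z - c)) has_derivative (\<lambda>h. 0)) (at c within M)"
    by (rule local_normal_field[OF c]) (rule that)
  obtain N' where N: "(N has_derivative N') (at c)"
    using N1 U(2) by (elim C1_map_onE) blast
  have linN: "linear N'"
    using N by (rule has_derivative_linear)
  define n where "n = nu c"
  have Nc: "N c = n" using Nnu U(2) c by (simp add: n_def)
  define L where "L = (\<lambda>v. v + t *\<^sub>R N' (v - (n \<bullet> v) *\<^sub>R n))"
  have L: "linear L" "\<And>v. n \<bullet> L v = n \<bullet> v" "inj L"
    unfolding L_def n_def using proj_derivative_kernel[OF c N U Nnu Nunit t] by blast+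
  obtain K where K: "linear K" "K \<circ> L = id"
    using linear_injective_left_inverse[OF L(1,3)] by blast
  have KL: "K (L v) = v" for v
    using K(2) by (metis comp_apply id_apply)
  let ?x = "c + t *\<^sub>R n"
  have projx: "proj ?x = c" and heightx: "height ?x = t"
    using proj_normal height_normal c t by (auto simp: n_def)
  have nn: "n \<bullet> n = 1" "norm n = 1"
    using nu_inner_nu norm_nu c by (auto simp: n_def)
  have "(proj has_derivative (\<lambda>h. K (h - (n \<bullet> h) *\<^sub>R n))) (at ?x)"
    unfolding has_derivative_at_alt
  proof (intro conjI allI impI)
    have "linear (\<lambda>h. K (h - (n \<bullet> h) *\<^sub>R n))"
      by (rule linearI)
        (simp_all add: linear_add[OF K(1)] linear_diff[OF K(1)] linear_cmul[OF K(1)] inner_simps algebra_simps)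
    then show "bounded_linear (\<lambda>h. K (h - (n \<bullet> h) *\<^sub>R n))"
      by (simp add: linear_conv_bounded_linear)
    fix e :: real assume "0 < e"
    obtain B where B: "0 < B" "\<And>v. norm (K v) \<le> B * norm v"
      using linear_bounded_pos[OF K(1)] by blast
    \<comment> \<open>The error terms below add up to (t + t |N' n| + 2) k |h|, and applying
      \<open>K\<close> costs the factor \<open>B\<close>; this choice makes the total e |h|.\<close>
    define k where "k = e / (B * (t + t * norm (N' n) + 2))"
    have kpos: "0 < t + t * norm (N' n) + 2" using t by (simp add: add_nonneg_pos)
    have "0 < k" using \<open>0 < e\<close> B(1) kpos by (simp add: k_def)
    obtain d1 where d1: "0 < d1" "\<And>z. norm (z - c) < d1 \<Longrightarrow> norm (N z - N c - N' (z - c)) \<le> k * norm (z - c)"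
      using N \<open>0 < k\<close> unfolding has_derivative_at_alt by blast
    obtain d2 where d2: "0 < d2" "\<And>z. \<lbrakk>z \<in> M; norm (z - c) < d2\<rbrakk> \<Longrightarrow>
        norm (nu c \<bullet> (z - c) - nu c \<bullet> (c - c) - 0) \<le> k * norm (z - c)"
      by (rule has_derivative_eventually_bound[OF flat \<open>0 < k\<close>]) (rule that)
    obtain d3 where d3: "0 < d3" "\<And>y. norm (y - ?x) < d3 \<Longrightarrow> norm (height y - height ?x - n \<bullet> (y - ?x)) \<le> k * norm (y - ?x)"
      using has_derivative_height[OF c t] \<open>0 < k\<close> unfolding has_derivative_at_alt n_def by blast
    \<comment> \<open>The tolerance k / (1 + k) is meant for the product of the height change, at
      most (1 + k) |h|, with the change of the normal.\<close>
    have "isCont N c"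
      using N by (rule has_derivative_continuous)
    then obtain d4 where d4: "0 < d4" "\<And>z. dist z c < d4 \<Longrightarrow> dist (N z) (N c) < k / (1 + k)"
      using \<open>0 < k\<close> unfolding continuous_at_eps_delta by (metis add_pos_pos divide_pos_pos zero_less_one)
    obtain d5 where d5: "0 < d5" "ball c d5 \<subseteq> U"
      using U open_contains_ball by blast
    have "?x \<notin> C"
      using not_in_C_normal[OF c t] by (simp add: n_def)
    then obtain d6 where d6: "0 < d6" "ball ?x d6 \<subseteq> - C"
      using closed open_contains_ball[of "- C"] by (auto simp: open_Compl)
    define d where "d = min (min (min d1 d2) (min d3 d4)) (min d5 d6)"
    show "\<exists>d>0. \<forall>y. norm (y - ?x) < d \<longrightarrow>
        norm (proj y - proj ?x - K (y - ?x - (n \<bullet> (y - ?x)) *\<^sub>R n)) \<le> e * norm (y - ?x)"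
    proof (intro exI[of _ d] conjI allI impI)
      show "0 < d" using d1 d2 d3 d4 d5 d6 by (simp add: d_def)
      fix y assume y: "norm (y - ?x) < d"
      define z where "z = proj y"
      define h where "h = y - ?x"
      define r where "r = height y"
      have "y \<notin> C"
        using y d6(2) by (auto simp: d_def subset_iff dist_norm norm_minus_commute)
      have z: "z \<in> M" and yz: "y = z + r *\<^sub>R nu z"
        using proj_in_frontier[OF \<open>y \<notin> C\<close>] eq_proj_plus_normal[OF \<open>y \<notin> C\<close>] by (simp_all add: z_def r_def)
      have zc: "norm (z - c) \<le> norm h"
        using proj_dist_le[OF c, of t y] t by (simp add: z_def h_def n_def)
      have near: "norm h < d1" "norm h < d2" "norm h < d3" "norm h < d4" "norm h < d5"
        using y by (simp_all add: d_def h_def)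
      have "z \<in> U"
        using zc near(5) d5(2) by (auto simp: subset_iff dist_norm norm_minus_commute)
      then have Nz: "N z = nu z" using Nnu z by blast
      define a where "a = N z - n - N' (z - c)"
      define b where "b = n \<bullet> (z - c)"
      define q where "q = r - t - n \<bullet> h"
      have "norm a \<le> k * norm (z - c)"
        using d1(2)[of z] zc near(1) by (simp add: a_def Nc)
      then have a: "norm a \<le> k * norm h"
        using mult_left_mono[OF zc, of k] \<open>0 < k\<close> by linarith
      have "\<bar>b\<bar> \<le> k * norm (z - c)"
        using d2(2)[OF z] zc near(2) by (simp add: b_def n_def)
      then have b: "\<bar>b\<bar> \<le> k * norm h"
        using mult_left_mono[OF zc, of k] \<open>0 < k\<close> by linarith
      have q: "\<bar>q\<bar> \<le> k * norm h"
        using d3(2)[of y] near(3) by (simp add: q_def r_def h_def heightx)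
      have "\<bar>n \<bullet> h\<bar> \<le> norm h"
        using Cauchy_Schwarz_ineq2[of n h] nn(2) by simp
      then have rt: "\<bar>r - t\<bar> \<le> (1 + k) * norm h"
        using q by (simp add: q_def distrib_right)
      have Ndiff: "norm (N z - n) \<le> k / (1 + k)"
        using d4(2)[of z] zc near(4) by (simp add: Nc dist_norm)
      \<comment> \<open>An exact identity. The errors are the nonlinearity \<open>a\<close> of the
        normal, the deviation \<open>b\<close> of \<open>z\<close> from the tangent plane, the
        nonlinearity \<open>q\<close> of the height, and the product of the changes in height and
        normal.\<close>
      have "L (z - c) - (h - (n \<bullet> h) *\<^sub>R n) = - (t *\<^sub>R a) - (t * b) *\<^sub>R N' n - q *\<^sub>R n - (r - t) *\<^sub>R (N z - n)"
      proof -
        have h: "h = z + r *\<^sub>R N z - c - t *\<^sub>R n"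
          unfolding h_def Nz by (subst yz) simp
        have "N' (z - c - b *\<^sub>R n) = N' (z - c) - b *\<^sub>R N' n"
          by (simp add: linear_diff[OF linN] linear_cmul[OF linN])
        then have "L (z - c) = z - c + t *\<^sub>R (N' (z - c) - b *\<^sub>R N' n)"
          by (simp add: L_def b_def)
        also have "N' (z - c) = N z - n - a"
          by (simp add: a_def)
        finally have L1: "L (z - c) = z - c + t *\<^sub>R (N z - n - a - b *\<^sub>R N' n)" .
        have nh: "n \<bullet> h = r - t - q" by (simp add: q_def)
        show ?thesis
          unfolding L1 nh by (subst h) (simp add: algebra_simps)
      qed
      also have "norm \<dots> \<le> t * norm a + t * \<bar>b\<bar> * norm (N' n) + \<bar>q\<bar> + \<bar>r - t\<bar> * norm (N z - n)"
      proof -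
        have tri: "norm (- u - v - w - s) \<le> norm u + norm v + norm w + norm s" for u v w s :: 'a
        proof -
          have "norm (- u - v - w - s) \<le> norm (- u - v - w) + norm s"
            by (rule norm_triangle_ineq4)
          also have "norm (- u - v - w) \<le> norm (- u - v) + norm w"
            by (rule norm_triangle_ineq4)
          also have "norm (- u - v) \<le> norm (- u) + norm v"
            by (rule norm_triangle_ineq4)
          finally show ?thesis by simp
        qed
        show ?thesis
          using tri[of "t *\<^sub>R a" "(t * b) *\<^sub>R N' n" "q *\<^sub>R n" "(r - t) *\<^sub>R (N z - n)"] t
          by (simp add: abs_mult nn(2))
      qed
      also have "\<dots> \<le> t * (k * norm h) + t * (k * norm h) * norm (N' n) + k * norm h + ((1 + k) * norm h) * (k / (1 + k))"
        using a b q rt Ndiff t \<open>0 < k\<close>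
        by (intro add_mono mult_mono mult_nonneg_nonneg mult_left_mono mult_right_mono) auto
      also have "\<dots> = (t + t * norm (N' n) + 2) * (k * norm h)"
        using \<open>0 < k\<close> by (simp add: field_simps)
      finally have bound: "norm (L (z - c) - (h - (n \<bullet> h) *\<^sub>R n)) \<le> (t + t * norm (N' n) + 2) * (k * norm h)" .
      have "z - c - K (h - (n \<bullet> h) *\<^sub>R n) = K (L (z - c) - (h - (n \<bullet> h) *\<^sub>R n))"
        by (simp add: linear_diff[OF K(1)] KL)
      also have "norm \<dots> \<le> B * ((t + t * norm (N' n) + 2) * (k * norm h))"
        using B(2) mult_left_mono[OF bound, of B] B(1) by (meson less_imp_le order_trans)
      also have "\<dots> = e * norm h"
        using B(1) kpos by (simp add: k_def)
      finally show "norm (proj y - proj ?x - K (y - ?x - (n \<bullet> (y - ?x)) *\<^sub>R n)) \<le> e * norm (y - ?x)"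
        by (simp only: z_def h_def projx)
    qed
  qed
  then show thesis
    using that[OF L(1) K(1) KL] L(2) unfolding n_def by blast
qed

end

section \<open>The domain as a sublevel set\<close>

locale thick_domain = smooth_function C x0 "thickness C \<Omega>" for C :: "'a::euclidean_space set" and x0 \<Omega> +
  assumes open_dom: "open \<Omega>" and bounded_dom: "bounded \<Omega>" and sub_dom: "C \<subseteq> \<Omega>"
    and radial_bij: "bij_betw (radial_map C \<Omega>) (frontier C) (frontier \<Omega> - C)"
begin

abbreviation d :: "'a \<Rightarrow> real" where "d \<equiv> thickness C \<Omega>"

lemma radial_map_eq: "c \<in> M \<Longrightarrow> radial_map C \<Omega> c = c + d c *\<^sub>R nu c"
  by (simp add: radial_map_def outward_normal_C)

lemma thickness_upper:
  assumes c: "c \<in> M" and r: "0 \<le> r" "c + r *\<^sub>R nu c \<in> \<Omega>"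
  shows "r \<le> d c"
proof -
  let ?S = "{r. 0 \<le> r \<and> c + r *\<^sub>R nu c \<in> \<Omega>}"
  obtain B where B: "\<And>y. y \<in> \<Omega> \<Longrightarrow> norm y \<le> B"
    using bounded_dom unfolding bounded_iff by blast
  have "s \<le> B + norm c" if "s \<in> ?S" for s
  proof -
    have "s = norm (s *\<^sub>R nu c)"
      using that norm_nu[OF c] by simp
    also have "\<dots> \<le> norm (c + s *\<^sub>R nu c) + norm c"
      using norm_triangle_ineq4[of "c + s *\<^sub>R nu c" c] by simp
    also have "\<dots> \<le> B + norm c"
      using B that by simp
    finally show ?thesis .
  qed
  then have "bdd_above ?S"
    by (rule bdd_aboveI)
  then have "r \<le> Sup ?S"
    using r by (intro cSup_upper) simp_all
  then show ?thesis
    by (simp add: thickness_def outward_normal_C[OF c])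
qed

lemma frontier_dom_disjoint: "y \<in> frontier \<Omega> \<Longrightarrow> y \<notin> \<Omega>"
  using open_dom by (simp add: frontier_def interior_open)

lemma
  assumes c: "c \<in> M"
  shows thickness_pos: "0 < d c" and radial_map_frontier: "c + d c *\<^sub>R nu c \<in> frontier \<Omega>"
proof -
  have "radial_map C \<Omega> c \<in> frontier \<Omega> - C"
    using radial_bij c unfolding bij_betw_def by blast
  then have *: "c + d c *\<^sub>R nu c \<in> frontier \<Omega>" "c + d c *\<^sub>R nu c \<notin> C"
    by (simp_all add: radial_map_eq[OF c])
  then show "c + d c *\<^sub>R nu c \<in> frontier \<Omega>" by simp
  have "c + 0 *\<^sub>R nu c \<in> \<Omega>"
    using sub_dom frontier_subset[OF c] by auto
  then have "0 \<le> d c"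
    by (intro thickness_upper[OF c]) auto
  moreover have "d c \<noteq> 0"
    using *(2) frontier_subset[OF c] by auto
  ultimately show "0 < d c" by simp
qed

lemma frontier_dom:
  assumes "y \<in> frontier \<Omega>"
  shows "y \<notin> C" and "height y = d (proj y)"
proof -
  show y: "y \<notin> C"
    using frontier_dom_disjoint[OF assms] sub_dom by blast
  then obtain c where c: "c \<in> M" "y = radial_map C \<Omega> c"
    using radial_bij assms unfolding bij_betw_def by blast
  then have "y = c + d c *\<^sub>R nu c"
    using radial_map_eq by simp
  then show "height y = d (proj y)"
    using proj_normal[OF c(1)] height_normal[OF c(1)] thickness_pos[OF c(1)] by simp
qed

text \<open>For the converse, \<open>C\<close> with the segment from the foot to \<open>y\<close> is
  connected and meets \<Omega>. A frontier point on the segment would have the same foot, so its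
  height would be \<open>d\<close> of that foot, which exceeds every height on the segment. Hence
  the connected set never leaves \<Omega>.\<close>

lemma in_dom_iff:
  assumes y: "y \<notin> C"
  shows "y \<in> \<Omega> \<longleftrightarrow> height y < d (proj y)"
proof
  let ?m = "proj y"
  have m: "?m \<in> M" and h: "0 < height y" and yeq: "y = ?m + height y *\<^sub>R nu ?m"
    using proj_in_frontier height_pos eq_proj_plus_normal y by auto
  assume "y \<in> \<Omega>"
  then have le: "height y \<le> d ?m"
    using thickness_upper[OF m, of "height y"] h yeq by simp
  have "height y \<noteq> d ?m"
  proof
    assume "height y = d ?m"
    then have "y \<in> frontier \<Omega>"
      using radial_map_frontier[OF m] yeq by simp
    then show False using frontier_dom_disjoint \<open>y \<in> \<Omega>\<close> by blast
  qed
  with le show "height y < d ?m" by simp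
next
  let ?m = "proj y"
  have m: "?m \<in> M" and h: "0 < height y" and yeq: "y = ?m + height y *\<^sub>R nu ?m"
    using proj_in_frontier height_pos eq_proj_plus_normal y by auto
  assume lt: "height y < d ?m"
  let ?P = "C \<union> closed_segment ?m y"
  have "connected ?P"
    using convex_connected[OF convex] proj_in_C by (intro connected_Un) auto
  moreover have "?P \<inter> \<Omega> \<noteq> {}"
    using sub_dom C_ne by blast
  moreover have "?P \<inter> frontier \<Omega> = {}"
  proof (rule ccontr)
    assume "?P \<inter> frontier \<Omega> \<noteq> {}"
    then obtain z where z: "z \<in> ?P" "z \<in> frontier \<Omega>" by blast
    have zC: "z \<notin> C" by (rule frontier_dom(1)[OF z(2)])
    then obtain s where s: "0 \<le> s" "s \<le> 1" "z = (1 - s) *\<^sub>R ?m + s *\<^sub>R y"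
      using z(1) by (auto simp: in_segment)
    have "z = ?m + (s * height y) *\<^sub>R nu ?m"
    proof -
      have "z = ?m + s *\<^sub>R (y - ?m)"
        using s(3) by (simp add: algebra_simps)
      also have "y - ?m = height y *\<^sub>R nu ?m"
        using yeq by (metis add_diff_cancel_left')
      finally show ?thesis by simp
    qed
    then have "height z = s * height y" "proj z = ?m"
      using proj_normal[OF m] height_normal[OF m] s(1) h by auto
    then have "s * height y = d ?m"
      using frontier_dom(2)[OF z(2)] by simp
    moreover have "s * height y \<le> 1 * height y"
      using s(2) h by (intro mult_right_mono) auto
    ultimately show False using lt by simp
  qed
  ultimately have "?P - \<Omega> = {}"
    using connected_Int_frontier by blast
  then show "y \<in> \<Omega>" by auto
qed

text \<open>\<open>g\<close> is the gradient of height - d \<circ> proj. Its normal component is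
  always 1, and its tangential part vanishes exactly with \<open>G c\<close>: on tangent vectors the
  derivative of the projection inverts \<open>L\<close>, so testing against \<open>L (G c)\<close>
  gives -|G c|^2.\<close>

lemma domain_normal:
  assumes c: "c \<in> M"
  obtains g where "is_inward_normal \<Omega> (c + d c *\<^sub>R nu c) (- g /\<^sub>R norm g)" "g \<bullet> nu c = 1"
    "G c = 0 \<Longrightarrow> g = nu c" "G c \<noteq> 0 \<Longrightarrow> \<exists>h. nu c \<bullet> h = 0 \<and> g \<bullet> h \<noteq> 0"
proof -
  let ?n = "nu c" and ?x = "c + d c *\<^sub>R nu c"
  have t: "0 < d c" by (rule thickness_pos[OF c])
  have nn: "?n \<bullet> ?n = 1" by (rule nu_inner_nu[OF c])
  obtain L K where L: "linear L" and K: "linear K" and KL: "\<And>v. K (L v) = v" and Lnu: "\<And>v. ?n \<bullet> L v = ?n \<bullet> v"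
    and dproj: "(proj has_derivative (\<lambda>h. K (h - (?n \<bullet> h) *\<^sub>R ?n))) (at ?x)"
    by (rule has_derivative_proj[OF c t]) (rule that)
  have projx: "proj ?x = c" and heightx: "height ?x = d c"
    using proj_normal[OF c] height_normal[OF c] t by auto
  have xC: "?x \<notin> C" by (rule not_in_C_normal[OF c t])
  have opC: "open (- C)" using closed by (simp add: open_Compl)
  define u where "u = (\<lambda>y. height y - d (proj y))"
  \<comment> \<open>\<open>d\<close> is known to be differentiable within \<open>M\<close>. As
    \<open>proj\<close> maps the complement of \<open>C\<close> into \<open>M\<close>, the chain
    rule is applied within this complement, and openness removes the restriction.\<close>
  have "((\<lambda>y. d (proj y)) has_derivative (\<lambda>h. G c \<bullet> K (h - (?n \<bullet> h) *\<^sub>R ?n))) (at ?x within - C)"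
  proof (rule has_derivative_in_compose[OF has_derivative_at_withinI[OF dproj]])
    have "proj ` (- C) \<subseteq> M"
      using proj_in_frontier by blast
    then show "(d has_derivative (\<bullet>) (G c)) (at (proj ?x) within proj ` (- C))"
      unfolding projx using has_derivative_gradient[OF c] by (rule has_derivative_subset[rotated])
  qed
  then have "((\<lambda>y. d (proj y)) has_derivative (\<lambda>h. G c \<bullet> K (h - (?n \<bullet> h) *\<^sub>R ?n))) (at ?x)"
    using at_within_open[OF _ opC, of ?x] xC by simp
  then have du: "(u has_derivative (\<lambda>h. ?n \<bullet> h - G c \<bullet> K (h - (?n \<bullet> h) *\<^sub>R ?n))) (at ?x)"
    unfolding u_def by (rule has_derivative_diff[OF has_derivative_height[OF c t]])
  \<comment> \<open>The adjoint of a linear functional, applied to 1, is its representing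
    vector.\<close>
  define g where "g = adjoint (\<lambda>h. ?n \<bullet> h - G c \<bullet> K (h - (?n \<bullet> h) *\<^sub>R ?n)) 1"
  have g: "g \<bullet> h = ?n \<bullet> h - G c \<bullet> K (h - (?n \<bullet> h) *\<^sub>R ?n)" for h
    using adjoint_works[OF has_derivative_linear[OF du], of h 1] by (simp add: g_def inner_commute)
  have gn: "g \<bullet> ?n = 1"
    using linear_0[OF K] by (simp add: g nn)
  then have g0: "g \<noteq> 0" by auto
  have du': "(u has_derivative (\<lambda>h. g \<bullet> h)) (at ?x)"
    using du by (simp add: g)
  have ux: "u ?x = 0"
    by (simp add: u_def projx heightx)
  have "\<forall>\<^sub>F y in at ?x. y \<in> - C"
    using eventually_at_in_open'[OF opC] xC by blast
  then have "\<forall>\<^sub>F y in at ?x. y \<in> \<Omega> \<longleftrightarrow> u y < 0"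
    by (rule eventually_mono) (simp add: in_dom_iff u_def)
  from is_inward_normal_sublevel[OF du' ux g0 this]
  have normal: "is_inward_normal \<Omega> ?x (- g /\<^sub>R norm g)" .
  show thesis
  proof (rule that[OF normal gn])
    assume "G c = 0"
    then have "(g - ?n) \<bullet> (g - ?n) = 0"
      by (simp add: inner_diff_left g)
    then show "g = ?n" by simp
  next
    assume "G c \<noteq> 0"
    have nG: "?n \<bullet> G c = 0" by (rule nu_inner_gradient[OF c])
    have "g \<bullet> L (G c) = - (G c \<bullet> G c)"
      by (simp add: g Lnu nG KL)
    then show "\<exists>h. ?n \<bullet> h = 0 \<and> g \<bullet> h \<noteq> 0"
      using \<open>G c \<noteq> 0\<close> by (intro exI[of _ "L (G c)"]) (simp add: Lnu nG)
  qed
qed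

text \<open>If \<open>G c = 0\<close>, the inward normal is -nu c, and the ray retraces the radial
  segment and meets \<open>C\<close> at \<open>c\<close>, not before. Conversely, a ray that leads
  back to \<open>c\<close> is parallel to \<open>nu c\<close>, which a tangential part of
  \<open>g\<close> excludes.\<close>

lemma return_map_fixed_iff:
  assumes c: "c \<in> M"
  shows "return_map C \<Omega> c = c \<longleftrightarrow> G c = 0"
proof -
  let ?n = "nu c" and ?x = "c + d c *\<^sub>R nu c"
  have t: "0 < d c" by (rule thickness_pos[OF c])
  have nn: "?n \<bullet> ?n = 1" by (rule nu_inner_nu[OF c])
  obtain g where g: "is_inward_normal \<Omega> ?x (- g /\<^sub>R norm g)" "g \<bullet> ?n = 1"
    and crit: "G c = 0 \<Longrightarrow> g = ?n" and noncrit: "G c \<noteq> 0 \<Longrightarrow> \<exists>h. ?n \<bullet> h = 0 \<and> g \<bullet> h \<noteq> 0"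
    by (rule domain_normal[OF c]) (rule that)
  define m where "m = - g /\<^sub>R norm g"
  define T where "T = Inf {t. 0 \<le> t \<and> ?x + t *\<^sub>R m \<in> C}"
  have ret: "return_map C \<Omega> c = ?x + T *\<^sub>R m"
    using inward_normal_eqI[OF g(1)]
    by (simp add: return_map_def reciprocal_map_def radial_map_eq[OF c] T_def m_def)
  show ?thesis
  proof
    assume "G c = 0"
    then have m: "m = - ?n"
      using crit norm_nu[OF c] by (simp add: m_def)
    have "T = d c"
      unfolding T_def
    proof (rule cInf_eq_minimum)
      show "d c \<in> {t. 0 \<le> t \<and> ?x + t *\<^sub>R m \<in> C}"
        using t frontier_subset[OF c] by (simp add: m)
      fix s assume "s \<in> {t. 0 \<le> t \<and> ?x + t *\<^sub>R m \<in> C}"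
      then have "c + (d c - s) *\<^sub>R ?n \<in> C"
        by (simp add: m algebra_simps)
      then show "d c \<le> s"
        using not_in_C_normal[OF c, of "d c - s"] by force
    qed
    then show "return_map C \<Omega> c = c"
      by (simp add: ret m)
  next
    assume "return_map C \<Omega> c = c"
    then have eq: "d c *\<^sub>R ?n + T *\<^sub>R m = 0"
      by (simp add: ret add.assoc)
    show "G c = 0"
    proof (rule ccontr)
      assume "G c \<noteq> 0"
      then obtain h where h: "?n \<bullet> h = 0" "g \<bullet> h \<noteq> 0"
        using noncrit by blast
      have "(d c *\<^sub>R ?n + T *\<^sub>R m) \<bullet> h = 0"
        by (simp add: eq)
      then have "T * (m \<bullet> h) = 0"
        by (simp add: inner_add_left h(1))
      moreover have "m \<bullet> h \<noteq> 0"
        using h(2) by (auto simp: m_def)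
      ultimately have "T = 0" by simp
      then have "d c *\<^sub>R ?n = 0" using eq by simp
      then show False using t nn by auto
    qed
  qed
qed

lemma Fix_return_map: "Fix_on M (return_map C \<Omega>) = {c \<in> M. G c = 0}"
  using return_map_fixed_iff by (auto simp: Fix_on_def)

end

section \<open>Euler characteristic of the boundary of a convex body\<close>

text \<open>Fraction-free elimination, one equation per induction step: the pivot
  \<open>a k c\<close> multiplies the other equations and the recovered solution, so everything
  stays in the integers.\<close>

lemma int_dependent:
  fixes a :: "'k \<Rightarrow> 'b \<Rightarrow> int"
  assumes "finite K" "finite B" "card K < card B"
  shows "\<exists>m. (\<exists>b\<in>B. m b \<noteq> 0) \<and> (\<forall>k\<in>K. (\<Sum>b\<in>B. m b * a k b) = 0)"
  using assms
proof (induction K arbitrary: B a rule: finite_induct)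
  case empty
  then obtain b where "b \<in> B" by fastforce
  then show ?case by (intro exI[of _ "\<lambda>_. 1"]) auto
next
  case (insert k K)
  show ?case
  proof (cases "\<forall>b\<in>B. a k b = 0")
    case True
    obtain m where "\<exists>b\<in>B. m b \<noteq> 0" "\<forall>k\<in>K. (\<Sum>b\<in>B. m b * a k b) = 0"
      using insert.IH[of B a] insert.prems insert.hyps by auto
    with True show ?thesis by (intro exI[of _ m]) auto
  next
    case False
    then obtain c where c: "c \<in> B" "a k c \<noteq> 0" by blast
    define B' where "B' = B - {c}"
    have B': "finite B'" "card K < card B'" "B = insert c B'" "c \<notin> B'"
      using insert c by (auto simp: B'_def)
    obtain m where m: "\<exists>b\<in>B'. m b \<noteq> 0"
      "\<forall>j\<in>K. (\<Sum>b\<in>B'. m b * (a k c * a j b - a k b * a j c)) = 0"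
      using insert.IH[OF B'(1,2), of "\<lambda>j b. a k c * a j b - a k b * a j c"] by blast
    define m' where "m' = (\<lambda>b. if b = c then - (\<Sum>b\<in>B'. m b * a k b) else a k c * m b)"
    have sum: "(\<Sum>b\<in>B. m' b * a j b) = - (\<Sum>b\<in>B'. m b * a k b) * a j c + (\<Sum>b\<in>B'. a k c * m b * a j b)" for j
    proof -
      have "(\<Sum>b\<in>B'. m' b * a j b) = (\<Sum>b\<in>B'. a k c * m b * a j b)"
        using B'(4) by (intro sum.cong) (auto simp: m'_def)
      then show ?thesis
        using B' by (simp add: m'_def)
    qed
    have "(\<Sum>b\<in>B. m' b * a j b) = 0" if "j \<in> insert k K" for j
    proof (cases "j = k")
      case True
      then show ?thesis
        unfolding sum by (simp add: sum_distrib_right sum_distrib_left mult_ac)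
    next
      case False
      then have "(\<Sum>b\<in>B'. m b * (a k c * a j b - a k b * a j c)) = 0"
        using m(2) that by auto
      then show ?thesis
        unfolding sum
        by (simp add: sum_distrib_right sum_distrib_left algebra_simps sum_subtractf)
    qed
    moreover have "\<exists>b\<in>B. m' b \<noteq> 0"
      using m(1) B' c by (auto simp: m'_def)
    ultimately show ?thesis by blast
  qed
qed

lemma additive_finprod:
  fixes a :: "'a \<Rightarrow> int" and m :: "'a \<Rightarrow> int"
  assumes G: "comm_group G"
    and add: "\<And>x y. \<lbrakk>x \<in> carrier G; y \<in> carrier G\<rbrakk> \<Longrightarrow> a (x \<otimes>\<^bsub>G\<^esub> y) = a x + a y"
    and B: "finite B" "B \<subseteq> carrier G"
  shows "a (finprod G (\<lambda>b. b [^]\<^bsub>G\<^esub> m b) B) = (\<Sum>b\<in>B. m b * a b)"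
proof -
  interpret comm_group G by (rule G)
  have hom: "group_hom G integer_group a"
    using add is_group by (auto simp: group_hom_def group_hom_axioms_def hom_def integer_group_def group_integer_group[unfolded integer_group_def])
  have one: "a \<one>\<^bsub>G\<^esub> = 0"
    using group_hom.hom_one[OF hom] by (simp add: integer_group_def)
  have pow: "a (x [^]\<^bsub>G\<^esub> (i::int)) = i * a x" if "x \<in> carrier G" for x i
    using group_hom.hom_int_pow[OF hom that, of i] by simp
  show ?thesis
    using B
  proof (induction B rule: finite_induct)
    case empty
    then show ?case by (simp add: one)
  next
    case (insert x F)
    have "finprod G (\<lambda>b. b [^]\<^bsub>G\<^esub> m b) (insert x F)
        = x [^]\<^bsub>G\<^esub> m x \<otimes>\<^bsub>G\<^esub> finprod G (\<lambda>b. b [^]\<^bsub>G\<^esub> m b) F"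
      using insert by (intro finprod_insert) auto
    moreover have "finprod G (\<lambda>b. b [^]\<^bsub>G\<^esub> m b) F \<in> carrier G"
      using insert by (intro finprod_closed) auto
    ultimately show ?case
      using insert by (simp add: add pow)
  qed
qed

text \<open>The functions \<open>a k\<close> act as integer coordinates, jointly injective and with
  dual family \<open>x\<close>. The dual elements are independent; in a larger finite set the
  coordinates satisfy a nontrivial integer relation, which injectivity lifts to the group.\<close>

lemma abelian_rank_eqI:
  fixes G :: "('a, 'b) monoid_scheme" and a :: "'k \<Rightarrow> 'a \<Rightarrow> int"
  assumes G: "comm_group G" and K: "finite K"
    and add: "\<And>k x y. \<lbrakk>k \<in> K; x \<in> carrier G; y \<in> carrier G\<rbrakk> \<Longrightarrow> a k (x \<otimes>\<^bsub>G\<^esub> y) = a k x + a k y"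
    and ker: "\<And>x. \<lbrakk>x \<in> carrier G; \<And>k. k \<in> K \<Longrightarrow> a k x = 0\<rbrakk> \<Longrightarrow> x = \<one>\<^bsub>G\<^esub>"
    and basis: "\<And>k. k \<in> K \<Longrightarrow> x k \<in> carrier G"
      "\<And>k j. \<lbrakk>k \<in> K; j \<in> K\<rbrakk> \<Longrightarrow> a j (x k) = (if j = k then 1 else 0)"
  shows "abelian_rank G = card K"
proof -
  interpret comm_group G by (rule G)
  have a_finprod: "a k (finprod G (\<lambda>b. b [^]\<^bsub>G\<^esub> m b) B) = (\<Sum>b\<in>B. m b * a k b)"
    if "k \<in> K" "finite B" "B \<subseteq> carrier G" for k B and m :: "'a \<Rightarrow> int"
    using that by (intro additive_finprod[OF G] add)
  have upper: "card B \<le> card K" if B: "int_independent G B" for B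
  proof (rule ccontr)
    assume "\<not> card B \<le> card K"
    moreover have fin: "finite B" "B \<subseteq> carrier G"
      using B by (auto simp: int_independent_def)
    ultimately obtain m where m: "\<exists>b\<in>B. m b \<noteq> 0" "\<forall>k\<in>K. (\<Sum>b\<in>B. m b * a k b) = 0"
      using int_dependent[OF K, of B a] by auto
    have "finprod G (\<lambda>b. b [^]\<^bsub>G\<^esub> m b) B = \<one>\<^bsub>G\<^esub>"
    proof (rule ker)
      show "finprod G (\<lambda>b. b [^]\<^bsub>G\<^esub> m b) B \<in> carrier G"
        using fin by (intro finprod_closed) auto
    qed (use a_finprod[OF _ fin] m(2) in auto)
    then show False
      using B m(1) by (auto simp: int_independent_def)
  qed
  have inj: "inj_on x K"
    using basis(2) by (metis inj_onI zero_neq_one)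
  have "int_independent G (x ` K)"
    unfolding int_independent_def
  proof (intro conjI allI impI ballI)
    show "finite (x ` K)" "x ` K \<subseteq> carrier G"
      using K basis by auto
    fix m b assume *: "finprod G (\<lambda>b. b [^]\<^bsub>G\<^esub> (m b :: int)) (x ` K) = \<one>\<^bsub>G\<^esub>" and "b \<in> x ` K"
    then obtain k where k: "k \<in> K" "b = x k" by blast
    have "(\<Sum>b\<in>x ` K. m b * a k b) = a k \<one>\<^bsub>G\<^esub>"
    proof -
      have "finite (x ` K)" "x ` K \<subseteq> carrier G"
        using K basis(1) by auto
      from a_finprod[OF k(1) this, of m] * show ?thesis by simp
    qed
    also have "\<dots> = 0"
      using add[OF k(1) one_closed one_closed] by simp
    finally have "(\<Sum>j\<in>K. m (x j) * a k (x j)) = 0"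
      using inj by (simp add: sum.reindex)
    moreover have "(\<Sum>j\<in>K. m (x j) * a k (x j)) = (\<Sum>j\<in>K. if j = k then m (x j) else 0)"
      using basis(2) k(1) by (intro sum.cong) auto
    ultimately show "m b = 0"
      using K k by simp
  qed
  then have "card K \<in> {card B |B. int_independent G B}"
    using card_image[OF inj] by force
  moreover have "n \<le> card K" if "n \<in> {card B |B. int_independent G B}" for n
    using upper that by blast
  ultimately have "Sup {card B |B. int_independent G B} = card K"
    by (intro cSup_eq_maximum) auto
  then show ?thesis
    by (simp add: abelian_rank_def)
qed

lemma abelian_rank_trivial:
  assumes "trivial_group G"
  shows "abelian_rank G = 0"
proof -
  have "comm_group G"
    using assms by (simp add: trivial_imp_cyclic_group group.cyclic_imp_abelian_group trivial_group_def)
  then have "abelian_rank G = card ({} :: nat set)"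
    using assms by (intro abelian_rank_eqI) (auto simp: trivial_group_def)
  then show ?thesis by simp
qed

lemma abelian_rank_integer:
  assumes "comm_group G" "G \<cong> integer_group"
  shows "abelian_rank G = 1"
proof -
  obtain h where h: "h \<in> iso G integer_group"
    using assms(2) by (auto simp: is_iso_def)
  interpret comm_group G by (rule assms)
  have bij: "bij_betw h (carrier G) UNIV" and hom: "h \<in> hom G integer_group"
    using h by (auto simp: iso_def integer_group_def)
  have add: "h (x \<otimes>\<^bsub>G\<^esub> y) = h x + h y" if "x \<in> carrier G" "y \<in> carrier G" for x y
    using hom_mult[OF hom that] by (simp add: integer_group_def)
  have one: "h \<one>\<^bsub>G\<^esub> = 0"
    using add[OF one_closed one_closed] by simp
  obtain x where x: "x \<in> carrier G" "h x = 1"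
    using bij by (metis UNIV_I bij_betw_def image_iff)
  have "abelian_rank G = card {()}"
  proof (rule abelian_rank_eqI[OF assms(1), of _ "\<lambda>_. h" "\<lambda>_. x"])
    fix y assume "y \<in> carrier G" "\<And>k. k \<in> {()} \<Longrightarrow> h y = 0"
    then show "y = \<one>\<^bsub>G\<^esub>"
      using bij one by (metis bij_betw_imp_inj_on inj_on_def insertI1 one_closed)
  qed (use x add in auto)
  then show ?thesis by simp
qed

lemma abelian_rank_free:
  assumes "comm_group G" "G \<cong> free_Abelian_group K" "finite K"
  shows "abelian_rank G = card K"
proof -
  obtain h where h: "h \<in> iso G (free_Abelian_group K)"
    using assms(2) by (auto simp: is_iso_def)
  interpret comm_group G by (rule assms)
  have bij: "bij_betw h (carrier G) {c. Poly_Mapping.keys c \<subseteq> K}" and hom: "h \<in> hom G (free_Abelian_group K)"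
    using h by (auto simp: iso_def free_Abelian_group_def)
  have add: "h (x \<otimes>\<^bsub>G\<^esub> y) = h x + h y" if "x \<in> carrier G" "y \<in> carrier G" for x y
    using hom_mult[OF hom that] by simp
  have one: "h \<one>\<^bsub>G\<^esub> = 0"
    using add[OF one_closed one_closed] by simp
  define x where "x = (\<lambda>k. inv_into (carrier G) h (frag_of k))"
  have x: "x k \<in> carrier G" "h (x k) = frag_of k" if "k \<in> K" for k
  proof -
    have "frag_of k \<in> h ` carrier G"
      using bij that by (auto simp: bij_betw_def)
    then show "x k \<in> carrier G" "h (x k) = frag_of k"
      by (auto simp: x_def inv_into_into f_inv_into_f)
  qed
  show ?thesis
  proof (rule abelian_rank_eqI[OF assms(1,3), of "\<lambda>k g. Poly_Mapping.lookup (h g) k" x])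
    fix y assume y: "y \<in> carrier G" "\<And>k. k \<in> K \<Longrightarrow> Poly_Mapping.lookup (h y) k = 0"
    have "Poly_Mapping.keys (h y) \<subseteq> K"
      using y(1) bij by (auto simp: bij_betw_def)
    then have "Poly_Mapping.lookup (h y) k = 0" for k
      using y(2)[of k] by (cases "k \<in> K") (auto simp: in_keys_iff subset_iff)
    then have "h y = 0"
      by (intro poly_mapping_eqI) simp
    then have "h y = h \<one>\<^bsub>G\<^esub>"
      by (simp add: one)
    then show "y = \<one>\<^bsub>G\<^esub>"
      using bij y(1) by (metis bij_betw_imp_inj_on inj_on_def one_closed)
  qed (use x in \<open>auto simp: add lookup_add lookup_single when_def\<close>)
qed

section \<open>Homology of the boundary\<close>

lemma frontier_convex_homeomorphic_sphere:
  fixes C :: "'a::euclidean_space set"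
  assumes "compact C" "convex C" "interior C \<noteq> {}"
  shows "frontier C homeomorphic sphere (0::'a) 1"
proof -
  have "rel_frontier C homeomorphic rel_frontier (cball (0::'a) 1)"
    using assms compact_imp_bounded
    by (intro homeomorphic_rel_frontiers_convex_bounded_sets)
      (auto simp: aff_dim_nonempty_interior aff_dim_cball)
  then show ?thesis
    using assms(3) by (simp add: rel_frontier_nonempty_interior)
qed

lemma sphere_homeomorphic_nsphere:
  "top_of_set (sphere (0::'a::euclidean_space) 1) homeomorphic_space nsphere (DIM('a) - 1)"
proof -
  have "DIM('a) \<noteq> 0" by simp
  then obtain f :: "(nat \<Rightarrow> real) \<Rightarrow> 'a" and g where
    "homeomorphic_maps (nsphere (DIM('a) - 1)) (top_of_set (sphere 0 1 \<inter> span Basis)) f g"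
    by (rule homeomorphic_maps_nsphere_euclidean_sphere[OF independent_Basis orthogonal_Basis refl _ norm_Basis])
      (assumption, erule that)
  then have "nsphere (DIM('a) - 1) homeomorphic_space top_of_set (sphere (0::'a) 1)"
    unfolding homeomorphic_space_def by (intro exI[of _ f] exI[of _ g]) simp
  then show ?thesis
    by (rule homeomorphic_space_sym[THEN iffD1])
qed

text \<open>Degree zero counts path components. In dimension one the unit sphere consists of a unit
  vector and its negative; in higher dimensions it is path connected.\<close>

lemma betti_number_0_sphere:
  assumes "Y homeomorphic_space top_of_set (sphere (0::'a::euclidean_space) 1)"
  shows "betti_number 0 Y = (if DIM('a) = 1 then 2 else 1)"
proof -
  let ?X = "top_of_set (sphere (0::'a) 1)"
  have "homology_group 0 Y \<cong> free_Abelian_group (path_components_of ?X)"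
    using homeomorphic_space_imp_isomorphic_homology_groups[OF assms] zeroth_homology_group
    by (rule iso_trans)
  then have rank: "betti_number 0 Y = card (path_components_of ?X)" if "finite (path_components_of ?X)"
    unfolding betti_number_def of_nat_0
    by (rule abelian_rank_free[OF abelian_homology_group _ that])
  show ?thesis
  proof (cases "DIM('a) = 1")
    case True
    then obtain b :: 'a where b: "Basis = {b}"
      by (meson card_1_singletonE)
    have "norm b = 1"
      using b norm_Basis by (metis insertI1)
    have "x = b \<or> x = - b" if "norm x = 1" for x
    proof -
      have x: "x = (x \<bullet> b) *\<^sub>R b"
        using euclidean_representation[of x] by (simp add: b)
      have "norm x = \<bar>x \<bullet> b\<bar>"
        by (subst x) (simp add: \<open>norm b = 1\<close>)
      then have "x \<bullet> b = 1 \<or> x \<bullet> b = -1"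
        using that by linarith
      then show ?thesis
        using x by (metis scaleR_minus1_left scaleR_one)
    qed
    then have "sphere (0::'a) 1 \<subseteq> {b, - b}"
      by (intro subsetI) (simp add: dist_norm)
    moreover have "{b, - b} \<subseteq> sphere (0::'a) 1"
      using \<open>norm b = 1\<close> by simp
    ultimately have S: "sphere (0::'a) 1 = {b, - b}"
      by (rule subset_antisym)
    have "b \<noteq> - b"
    proof
      assume "b = - b"
      then have "b \<bullet> b = - b \<bullet> b" by (rule arg_cong)
      then show False using \<open>norm b = 1\<close> by (simp add: norm_eq_1)
    qed
    have "?X = discrete_topology {b, - b}"
      unfolding S by (intro subtopology_eq_discrete_topology_finite t1_space_euclidean) auto
    then have "path_components_of ?X = {{b}, {- b}}"
      by simp
    then show ?thesis
      using rank True \<open>b \<noteq> - b\<close> by simp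
  next
    case False
    then have "2 \<le> DIM('a)"
      using DIM_positive[where 'a = 'a] by linarith
    then have "path_connected_space ?X"
      by (simp add: path_connected_space_euclidean_subtopology path_connected_sphere)
    then have sub: "path_components_of ?X \<subseteq> {sphere 0 1}"
      by (simp add: path_components_of_subset_singleton)
    have "\<Union> (path_components_of ?X) = sphere 0 1"
      by (simp add: Union_path_components_of)
    moreover have "sphere (0::'a) 1 \<noteq> {}"
      by simp
    ultimately have "path_components_of ?X \<noteq> {}"
      by (metis Union_empty)
    then have "path_components_of ?X = {sphere 0 1}"
      using subset_singletonD[OF sub] by simp
    then show ?thesis
      using rank False by simp
  qed
qed

text \<open>In positive degree homology and reduced homology coincide, and the latter is known for
  the sphere of dimension N - 1.\<close>

lemma betti_number_sphere:
  assumes "X homeomorphic_space top_of_set (sphere (0::'a::euclidean_space) 1)" "0 < k"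
  shows "betti_number k X = (if k = DIM('a) - 1 then 1 else 0)"
proof -
  let ?n = "DIM('a) - 1"
  have iso: "homology_group (int k) X \<cong> homology_group (int k) (nsphere ?n)"
    by (rule homeomorphic_space_imp_isomorphic_homology_groups)
      (rule homeomorphic_space_trans[OF assms(1) sphere_homeomorphic_nsphere])
  have red: "reduced_homology_group (int k) (nsphere ?n) = homology_group (int k) (nsphere ?n)"
    using assms by (intro un_reduced_homology_group) simp
  show ?thesis
  proof (cases "k = ?n")
    case True
    then have "homology_group (int k) X \<cong> integer_group"
      using iso red reduced_homology_group_nsphere(1) iso_trans by metis
    then show ?thesis
      using True by (simp add: betti_number_def abelian_rank_integer)
  next
    case False
    then have "trivial_group (homology_group (int k) (nsphere ?n))"
      using red reduced_homology_group_nsphere(2)[of "int k" ?n] by simp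
    then have "trivial_group (homology_group (int k) X)"
      using isomorphic_group_triviality[OF iso] by simp
    then show ?thesis
      using False by (simp add: betti_number_def abelian_rank_trivial)
  qed
qed

text \<open>For N = 1 the single degree 0 has rank 2 = 1 + (-1)^0; otherwise rank 1 occurs in degree
  0 and in degree N - 1. The formula is the same in both cases.\<close>

theorem Euler_characteristic_convex_frontier:
  fixes C :: "'a::euclidean_space set"
  assumes "compact C" "convex C" "interior C \<noteq> {}"
  shows "(\<Sum>k = 0..DIM('a) - 1. (- 1) ^ k * int (betti_number k (top_of_set (frontier C))))
           = 1 + (- 1) ^ (DIM('a) - 1)"
proof -
  let ?X = "top_of_set (frontier C)" and ?S = "top_of_set (sphere (0::'a) 1)" and ?n = "DIM('a) - 1"
  have hom: "?X homeomorphic_space ?S"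
    using frontier_convex_homeomorphic_sphere[OF assms] by simp
  have "(\<Sum>k = 0..?n. (- 1) ^ k * int (betti_number k ?X)) =
      int (betti_number 0 ?X) + (\<Sum>k\<in>{0<..?n}. (- 1) ^ k * int (betti_number k ?X))"
    by (subst sum.head) auto
  also have "(\<Sum>k\<in>{0<..?n}. (- 1) ^ k * int (betti_number k ?X)) = (\<Sum>k\<in>{0<..?n}. if k = ?n then (- 1) ^ k else 0)"
    by (intro sum.cong) (auto simp: betti_number_sphere[OF hom])
  also have "\<dots> = (if ?n = 0 then 0 else (- 1) ^ ?n)"
    by simp
  also have "int (betti_number 0 ?X) + \<dots> = 1 + (- 1) ^ ?n"
    using DIM_positive[where 'a = 'a]
    by (cases "DIM('a) = 1") (auto simp: betti_number_0_sphere[OF hom] simp del: DIM_positive)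
  finally show ?thesis .
qed

section \<open>The main theorem\<close>

theorem corollary6p2:
  fixes C \<Omega> :: "'a::euclidean_space set"
  assumes "compact C" and "convex C" and "interior C \<noteq> {}"
    and "C2_hypersurface (frontier C)"
    and "open \<Omega>" and "connected \<Omega>" and "bounded \<Omega>" and "C \<subseteq> \<Omega>"
    and "class_O C \<Omega>"
    and "C2_function_on (frontier C) (thickness C \<Omega>)"
    and "bij_betw (radial_map C \<Omega>) (frontier C) (frontier \<Omega> - C)"
    and "Morse_function_on (frontier C) (thickness C \<Omega>)"
  shows "finite (Fix_on (frontier C) (return_map C \<Omega>)) \<and>
    (\<Sum>c \<in> Fix_on (frontier C) (return_map C \<Omega>).
        (- 1 :: int) ^ Morse_index (frontier C) (thickness C \<Omega>) c)
      = (\<Sum>k = 0..DIM('a) - 1.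
          (- 1) ^ k * int (betti_number k (top_of_set (frontier C))))"
proof -
  \<comment> \<open>An arbitrary centre for the radial extension; neither side of the claim mentions
    it.\<close>
  obtain x0 where "x0 \<in> interior C"
    using assms(3) by blast
  then interpret thick_domain C x0 \<Omega>
    using assms by unfold_locales
  have "(\<Sum>c \<in> {c \<in> M. G c = 0}. (- 1 :: int) ^ Morse_index M d c) = 1 - (- 1) ^ DIM('a)"
    by (rule Morse_sum(2)[OF assms(12)])
  \<comment> \<open>As N \<ge> 1, the subtraction on naturals is a true predecessor and the sign
    flips.\<close>
  also have "\<dots> = 1 + (- 1) ^ (DIM('a) - 1)"
    using DIM_positive[where 'a = 'a] by (cases "DIM('a)") auto
  finally show ?thesis
    unfolding Fix_return_map Euler_characteristic_convex_frontier[OF assms(1-3)]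
    using Morse_sum(1)[OF assms(12)] by blast
qed

end
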